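(* Let $S$ be a compact manifold with volume form $\mu_S$, let $\bar M$ be a manifold, and let $\mathcal O$ be a compact Lie group with Lie algebra $\mathfrak o$. Then the group $\mathcal{A}ut_{\rm vol}(S\times\mathcal O)\simeq\mathrm{Diff}_{\rm vol}(S)\,\circledS\,\mathcal F(S,\mathcal O)$ acts transitively on the level sets of the momentum map $\mathbf J_L:\mathrm{Emb}_{\mathcal O}(S\times\mathcal O,T^*\bar M\times T^*\mathcal O)\to\mathcal F(T^*\bar M\times\mathfrak o^* )^*$ given, for $(\eta,\gamma)\in\mathrm{Emb}(S,T^*\bar M\times\mathfrak o^* )\times\mathcal F(S,\mathcal O)\simeq\mathrm{Emb}_{\mathcal O}(S\times\mathcal O,T^*\bar M\times T^*\mathcal O)$ with $\eta=(\mathbf P_{\mathbf Q},\sigma)$, by $\mathbf J_L(\mathbf P_{\mathbf Q},\sigma,\gamma)=(\mathbf P_{\mathbf Q},\sigma)_*\mu_S$, i.e. $$\langle\mathbf J_L(\eta,\gamma),h\rangle=\int_S(h\circ\eta)\,\mu_S,\qquad h\in\mathcal F(T^*\bar M\times\mathfrak o^* ).$$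
   Context: All finite dimensional manifolds are smooth, Hausdorff, paracompact, without boundary; all maps are smooth. $\mathcal F(X,Y)$ is the space of smooth maps $X\to Y$ and $\mathcal F(X)=\mathcal F(X,\mathbb R)$; $\mathcal F(X)^*$ is the distributional dual. $\mathrm{Emb}(X,Y)$ is the space of embeddings of $X$ into $Y$. $\mathcal O$ acts on $S\times\mathcal O$ by right multiplication on the second factor, and on $T^*\bar M\times T^*\mathcal O$ by $(\alpha_q,\alpha_g)\cdot k=(\alpha_q,\alpha_gk)$ (cotangent lift of right translation). $\mathrm{Emb}_{\mathcal O}(S\times\mathcal O,T^*\bar M\times T^*\mathcal O)$ is the space of $\mathcal O$-equivariant embeddings $f(x,g)=(\mathbf P_{\mathbf Q}(x),\kappa_\gamma(x)g)$, with $\mathbf P_{\mathbf Q}:S\to T^*\bar M$ and $\kappa_\gamma:S\to T^*\mathcal O$ covering $\gamma:S\to\mathcal O$; it is identified with $\mathrm{Emb}(S,T^*\bar M\times\mathfrak o^* )\times\mathcal F(S,\mathcal O)$ by $f\mapsto(\eta,\gamma)$, where $\eta=(\mathbf P_{\mathbf Q},\sigma)$ and $\sigma=\kappa_\gamma\gamma^{-1}:S\to\mathfrak o^*$, that is, $\langle\kappa_\gamma\gamma^{-1},\xi\rangle=\langle\kappa_\gamma,\xi\gamma\rangle$ for $\xi\in\mathfrak o$. $\mathrm{Diff}_{\rm vol}(S)$ is the group of diffeomorphisms $\psi$ of $S$ that preserve the volume form, $\psi^*\mu_S=\mu_S$. $\mathcal{A}ut_{\rm vol}(S\times\mathcal O)$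 is the group of automorphisms of the trivial principal $\mathcal O$-bundle $S\times\mathcal O\to S$ that descend to elements of $\mathrm{Diff}_{\rm vol}(S)$; the pair $(\psi,b)\in\mathrm{Diff}_{\rm vol}(S)\,\circledS\,\mathcal F(S,\mathcal O)$ corresponds to the automorphism $(x,g)\mapsto(\psi(x),b(x)g)$. The group law is $(\psi_1,b_1)(\psi_2,b_2)=(\psi_1\circ\psi_2,(b_1\circ\psi_2)b_2)$, and the group acts from the right on $\mathrm{Emb}(S,T^*\bar M\times\mathfrak o^* )\times\mathcal F(S,\mathcal O)$ by $(\eta,\gamma)\cdot(\psi,b)=(\eta\circ\psi,(\gamma\circ\psi)b)$.
   Formalization: Preserving the volume form is read as preserving its density |μ_S|, so Diff_vol(S) also contains volume-preserving maps reversing orientation (S may be non-orientable); with signed ψ^*μ_S=μ_S the claim fails for a circle embedded in T^*R and its reflection. *)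

theory Defs
  imports "HOL-Analysis.Analysis" "HOL-Algebra.Group_Action"
begin

section \<open>Smooth manifolds\<close>

primrec Ck_on :: "nat \<Rightarrow> 'e::euclidean_space set \<Rightarrow> ('e \<Rightarrow> 'f::euclidean_space) \<Rightarrow> bool" where
  "Ck_on 0 U f \<longleftrightarrow> continuous_on U f"
| "Ck_on (Suc k) U f \<longleftrightarrow>
     (\<forall>x\<in>U. f differentiable (at x)) \<and>
     (\<forall>v. Ck_on k U (\<lambda>x. frechet_derivative f (at x) v))"

text \<open>Smoothness on an arbitrary subset of a Euclidean space is local extendability to a smooth
  function on an open set.\<close>

definition smooth_on :: "'e::euclidean_space set \<Rightarrow> ('e \<Rightarrow> 'f::euclidean_space) \<Rightarrow> bool" where
  "smooth_on X f \<longleftrightarrow>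
     (\<forall>x\<in>X. \<exists>U g. open U \<and> x \<in> U \<and> (\<forall>k. Ck_on k U g) \<and> (\<forall>y\<in>X \<inter> U. g y = f y))"

definition dir_deriv :: "('e::euclidean_space \<Rightarrow> 'f::euclidean_space) \<Rightarrow> 'e \<Rightarrow> 'e \<Rightarrow> 'f" where
  "dir_deriv f x v = vector_derivative (\<lambda>t. f (x + t *\<^sub>R v)) (at 0)"

text \<open>A chart is a domain together with a map. Every Isabelle type of class
  \<^class>\<open>euclidean_space\<close> has positive dimension, whereas manifolds of dimension 0
  (such as finite Lie groups) have to be allowed. Therefore the model space of a manifold is the
  span of a subset \<open>model_basis\<close> of the standard basis, and the dimension of the manifold is the
  cardinality of that subset.\<close>

type_synonym ('a, 'e) chart = "'a set \<times> ('a \<Rightarrow> 'e)"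

record ('a, 'e) mfd =
  points :: "'a set"
  model_basis :: "'e set"
  atlas :: "('a, 'e) chart set"

abbreviation model_space :: "('a, 'e::euclidean_space) mfd \<Rightarrow> 'e set" where
  "model_space M \<equiv> span (model_basis M)"

abbreviation chart_inv :: "('a, 'e) chart \<Rightarrow> 'e \<Rightarrow> 'a" where
  "chart_inv c \<equiv> inv_into (fst c) (snd c)"

definition mtop :: "('a, 'e::euclidean_space) mfd \<Rightarrow> 'a topology" where
  "mtop M = topology (\<lambda>U. U \<subseteq> points M \<and>
     (\<forall>c\<in>atlas M. openin (top_of_set (model_space M)) (snd c ` (U \<inter> fst c))))"

definition paracompact_space :: "'a topology \<Rightarrow> bool" where
  "paracompact_space X \<longleftrightarrow>
     (\<forall>\<U>. (\<forall>U\<in>\<U>. openin X U) \<and> \<Union>\<U> = topspace X \<longrightarrow>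
        (\<exists>\<V>. (\<forall>V\<in>\<V>. openin X V \<and> (\<exists>U\<in>\<U>. V \<subseteq> U)) \<and> \<Union>\<V> = topspace X \<and>
             locally_finite_in X \<V>))"

definition manifold :: "('a, 'e::euclidean_space) mfd \<Rightarrow> bool" where
  "manifold M \<longleftrightarrow>
     model_basis M \<subseteq> Basis \<and>
     \<Union>(fst ` atlas M) = points M \<and>
     (\<forall>c\<in>atlas M. inj_on (snd c) (fst c)) \<and>
     (\<forall>c\<in>atlas M. \<forall>d\<in>atlas M.
        openin (top_of_set (model_space M)) (snd c ` (fst c \<inter> fst d)) \<and>
        smooth_on (snd c ` (fst c \<inter> fst d)) (snd d \<circ> chart_inv c)) \<and>
     (\<forall>c\<in>atlas M. openin (top_of_set (model_space M)) (snd c ` fst c)) \<and>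
     Hausdorff_space (mtop M) \<and>
     paracompact_space (mtop M)"

definition euclidean_mfd :: "('e::euclidean_space, 'e) mfd" where
  "euclidean_mfd = \<lparr>points = UNIV, model_basis = Basis, atlas = {(UNIV, id)}\<rparr>"

definition prod_mfd :: "('a, 'e::euclidean_space) mfd \<Rightarrow> ('b, 'f::euclidean_space) mfd \<Rightarrow>
    ('a \<times> 'b, 'e \<times> 'f) mfd"  (infixr "\<times>\<^sub>m" 80) where
  "M \<times>\<^sub>m N = \<lparr>points = points M \<times> points N,
     model_basis = (\<lambda>b. (b, 0)) ` model_basis M \<union> (\<lambda>b. (0, b)) ` model_basis N,
     atlas = {(fst c \<times> fst d, map_prod (snd c) (snd d)) |c d. c \<in> atlas M \<and> d \<in> atlas N}\<rparr>"

definition smooth_map ::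
    "('a, 'e::euclidean_space) mfd \<Rightarrow> ('b, 'f::euclidean_space) mfd \<Rightarrow> ('a \<Rightarrow> 'b) \<Rightarrow> bool" where
  "smooth_map M N f \<longleftrightarrow>
     continuous_map (mtop M) (mtop N) f \<and>
     (\<forall>c\<in>atlas M. \<forall>d\<in>atlas N.
        smooth_on (snd c ` {x \<in> fst c. f x \<in> fst d}) (snd d \<circ> f \<circ> chart_inv c))"

text \<open>Maps between manifolds are taken to be extensional, so that equality of maps is equality on
  the points of the source.\<close>

definition smooth_maps ::
    "('a, 'e::euclidean_space) mfd \<Rightarrow> ('b, 'f::euclidean_space) mfd \<Rightarrow> ('a \<Rightarrow> 'b) set" where
  "smooth_maps M N = {f \<in> points M \<rightarrow>\<^sub>E points N. smooth_map M N f}"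

abbreviation smooth_funs :: "('a, 'e::euclidean_space) mfd \<Rightarrow> ('a \<Rightarrow> real) set" where
  "smooth_funs M \<equiv> smooth_maps M euclidean_mfd"

definition diffeos :: "('a, 'e::euclidean_space) mfd \<Rightarrow> ('a \<Rightarrow> 'a) set" where
  "diffeos M = {\<psi> \<in> smooth_maps M M. bij_betw \<psi> (points M) (points M) \<and>
     restrict (inv_into (points M) \<psi>) (points M) \<in> smooth_maps M M}"


section \<open>Tangent and cotangent vectors\<close>

text \<open>A tangent vector is represented by the derivative operator on smooth functions that it
  induces.\<close>

type_synonym 'a tvec = "('a \<Rightarrow> real) \<Rightarrow> real"

definition coord_vec :: "('a, 'e::euclidean_space) mfd \<Rightarrow> ('a, 'e) chart \<Rightarrow> 'a \<Rightarrow> 'e \<Rightarrow> 'a tvec" where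
  "coord_vec M c p v = (\<lambda>h\<in>smooth_funs M. dir_deriv (h \<circ> chart_inv c) (snd c p) v)"

definition tangent_space :: "('a, 'e::euclidean_space) mfd \<Rightarrow> 'a \<Rightarrow> 'a tvec set" where
  "tangent_space M p = {coord_vec M c p v |c v. c \<in> atlas M \<and> p \<in> fst c \<and> v \<in> model_space M}"

definition tangent_map :: "('a, 'e::euclidean_space) mfd \<Rightarrow> ('b, 'f::euclidean_space) mfd \<Rightarrow>
    ('a \<Rightarrow> 'b) \<Rightarrow> 'a tvec \<Rightarrow> 'b tvec" where
  "tangent_map M N f X = (\<lambda>h\<in>smooth_funs N. X (compose (points M) h f))"

definition cotangent_space :: "('a, 'e::euclidean_space) mfd \<Rightarrow> 'a \<Rightarrow> ('a tvec \<Rightarrow> real) set" where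
  "cotangent_space M p = {\<alpha> \<in> extensional (tangent_space M p).
     \<forall>X\<in>tangent_space M p. \<forall>Y\<in>tangent_space M p. \<forall>a b.
       \<alpha> (\<lambda>h\<in>smooth_funs M. a * X h + b * Y h) = a * \<alpha> X + b * \<alpha> Y}"

definition covec_coords ::
    "('a, 'e::euclidean_space) mfd \<Rightarrow> ('a, 'e) chart \<Rightarrow> 'a \<Rightarrow> ('a tvec \<Rightarrow> real) \<Rightarrow> 'e" where
  "covec_coords M c p \<alpha> = (\<Sum>b\<in>model_basis M. \<alpha> (coord_vec M c p b) *\<^sub>R b)"

definition cotangent_bundle ::
    "('a, 'e::euclidean_space) mfd \<Rightarrow> ('a \<times> ('a tvec \<Rightarrow> real), 'e \<times> 'e) mfd" where
  "cotangent_bundle M = \<lparr>points = Sigma (points M) (cotangent_space M),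
     model_basis = (\<lambda>b. (b, 0)) ` model_basis M \<union> (\<lambda>b. (0, b)) ` model_basis M,
     atlas = {(Sigma (fst c) (cotangent_space M), \<lambda>(p, \<alpha>). (snd c p, covec_coords M c p \<alpha>)) |c.
                c \<in> atlas M}\<rparr>"

text \<open>The vector space of covectors at \<open>p\<close> as a manifold: its charts are linear isomorphisms onto
  the model space.\<close>

definition cotangent_space_mfd ::
    "('a, 'e::euclidean_space) mfd \<Rightarrow> 'a \<Rightarrow> ('a tvec \<Rightarrow> real, 'e) mfd" where
  "cotangent_space_mfd M p = \<lparr>points = cotangent_space M p,
     model_basis = model_basis M,
     atlas = {(cotangent_space M p, covec_coords M c p) |c. c \<in> atlas M \<and> p \<in> fst c}\<rparr>"

definition embeddings ::
    "('a, 'e::euclidean_space) mfd \<Rightarrow> ('b, 'f::euclidean_space) mfd \<Rightarrow> ('a \<Rightarrow> 'b) set" where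
  "embeddings M N = {f \<in> smooth_maps M N.
     embedding_map (mtop M) (mtop N) f \<and>
     (\<forall>p\<in>points M. inj_on (tangent_map M N f) (tangent_space M p))}"


section \<open>Volumes\<close>

text \<open>The absolute value of the Jacobian determinant with respect to the orthonormal family \<open>B\<close>,
  by the Leibniz formula.\<close>

definition abs_jacobian :: "'e::euclidean_space set \<Rightarrow> ('e \<Rightarrow> 'e) \<Rightarrow> 'e \<Rightarrow> real" where
  "abs_jacobian B f x =
     \<bar>\<Sum>\<pi> | \<pi> permutes B. of_int (sign \<pi>) * (\<Prod>b\<in>B. dir_deriv f x b \<bullet> \<pi> b)\<bar>"

text \<open>Volume forms are twisted (odd) forms, that is, positive smooth densities: the manifold carries
  no orientation, integration uses none, and pullback involves the absolute value of the Jacobian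
  determinant. An untwisted nowhere vanishing top-degree form \<open>\<omega>\<close> enters through its density
  \<open>\<bar>\<omega>\<bar>\<close>, which is integrated exactly as \<open>\<omega>\<close> is with respect to the orientation that \<open>\<omega>\<close> defines.

  With untwisted forms the level sets would be the same but the group of volume preserving
  diffeomorphisms would lack the orientation reversing ones, and then it need not act transitively:
  for an embedding \<open>\<eta>\<close> of the circle in the plane and a reflection \<open>\<rho>\<close> of the circle, \<open>\<eta>\<close> and
  \<open>\<eta> \<circ> \<rho>\<close> push the arc length forward to the same measure, but \<open>\<rho>\<close> changes the sign of the form
  and is the only reparametrization relating them.

  \<open>\<mu> c\<close> is the coefficient of the density in the chart \<open>c\<close>, as a function on the chart domain.\<close>

type_synonym ('a, 'e) volume = "('a, 'e) chart \<Rightarrow> 'a \<Rightarrow> real"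

definition volume_form :: "('a, 'e::euclidean_space) mfd \<Rightarrow> ('a, 'e) volume \<Rightarrow> bool" where
  "volume_form M \<mu> \<longleftrightarrow>
     (\<forall>c\<in>atlas M. (\<forall>p\<in>fst c. \<mu> c p > 0) \<and> smooth_on (snd c ` fst c) (\<mu> c \<circ> chart_inv c)) \<and>
     (\<forall>c\<in>atlas M. \<forall>d\<in>atlas M. \<forall>p\<in>fst c \<inter> fst d.
        \<mu> c p = abs_jacobian (model_basis M) (snd d \<circ> chart_inv c) (snd c p) * \<mu> d p)"

definition preserves_volume ::
    "('a, 'e::euclidean_space) mfd \<Rightarrow> ('a, 'e) volume \<Rightarrow> ('a \<Rightarrow> 'a) \<Rightarrow> bool" where
  "preserves_volume M \<mu> \<psi> \<longleftrightarrow>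
     (\<forall>c\<in>atlas M. \<forall>d\<in>atlas M. \<forall>p\<in>fst c. \<psi> p \<in> fst d \<longrightarrow>
        abs_jacobian (model_basis M) (snd d \<circ> \<psi> \<circ> chart_inv c) (snd c p) * \<mu> d (\<psi> p) = \<mu> c p)"

definition diffeos_vol :: "('a, 'e::euclidean_space) mfd \<Rightarrow> ('a, 'e) volume \<Rightarrow> ('a \<Rightarrow> 'a) set" where
  "diffeos_vol M \<mu> = {\<psi> \<in> diffeos M. preserves_volume M \<mu> \<psi>}"

text \<open>Lebesgue measure on \<open>span B\<close>, for \<open>B\<close> a subset of the standard basis, as a measure on the
  ambient space; for \<open>B = Basis\<close> this is \<^const>\<open>lborel\<close>, for \<open>B = {}\<close> the unit mass at 0.\<close>

definition lborel_span :: "'e::euclidean_space set \<Rightarrow> 'e measure" where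
  "lborel_span B = distr (\<Pi>\<^sub>M b\<in>B. lborel) borel (\<lambda>f. \<Sum>b\<in>B. f b *\<^sub>R b)"

text \<open>The Borel measure that is \<open>\<mu> c\<close> times Lebesgue measure in each chart \<open>c\<close>. It is unique if the
  manifold is second countable, in particular if it is compact.\<close>

definition volume_measure :: "('a, 'e::euclidean_space) mfd \<Rightarrow> ('a, 'e) volume \<Rightarrow> 'a measure" where
  "volume_measure M \<mu> = (THE N.
     space N = points M \<and>
     sets N = sigma_sets (points M) {U. openin (mtop M) U} \<and>
     (\<forall>c\<in>atlas M. \<forall>A\<in>sets N. A \<subseteq> fst c \<longrightarrow>
        emeasure N A =
          (\<integral>\<^sup>+ y. ennreal (\<mu> c (chart_inv c y)) * indicator (snd c ` A) y \<partial>lborel_span (model_basis M))))"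


section \<open>Equivariant embeddings and bundle automorphisms\<close>

definition lie_group :: "('g, 'f::euclidean_space) mfd \<Rightarrow> 'g monoid \<Rightarrow> bool" where
  "lie_group L G \<longleftrightarrow>
     manifold L \<and> group G \<and> carrier G = points L \<and>
     smooth_map (L \<times>\<^sub>m L) L (\<lambda>(g, k). g \<otimes>\<^bsub>G\<^esub> k) \<and>
     smooth_map L L (\<lambda>g. inv\<^bsub>G\<^esub> g)"

definition right_transl :: "'g monoid \<Rightarrow> 'g \<Rightarrow> 'g \<Rightarrow> 'g" where
  "right_transl G k = (\<lambda>g\<in>carrier G. g \<otimes>\<^bsub>G\<^esub> k)"

definition cotangent_right :: "('g, 'f::euclidean_space) mfd \<Rightarrow> 'g monoid \<Rightarrow>
    'g \<times> ('g tvec \<Rightarrow> real) \<Rightarrow> 'g \<Rightarrow> 'g \<times> ('g tvec \<Rightarrow> real)" where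
  "cotangent_right L G = (\<lambda>(g, \<alpha>) k.
     (g \<otimes>\<^bsub>G\<^esub> k,
      \<lambda>v\<in>tangent_space L (g \<otimes>\<^bsub>G\<^esub> k). \<alpha> (tangent_map L L (right_transl G (inv\<^bsub>G\<^esub> k)) v)))"

definition lie_dual_mfd ::
    "('g, 'f::euclidean_space) mfd \<Rightarrow> 'g monoid \<Rightarrow> ('g tvec \<Rightarrow> real, 'f) mfd" where
  "lie_dual_mfd L G = cotangent_space_mfd L \<one>\<^bsub>G\<^esub>"

definition equiv_embeddings :: "('s, 'e::euclidean_space) mfd \<Rightarrow> ('m, 'h::euclidean_space) mfd \<Rightarrow>
    ('g, 'f::euclidean_space) mfd \<Rightarrow> 'g monoid \<Rightarrow>
    ('s \<times> 'g \<Rightarrow> ('m \<times> ('m tvec \<Rightarrow> real)) \<times> ('g \<times> ('g tvec \<Rightarrow> real))) set" where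
  "equiv_embeddings S M L G =
     {f \<in> embeddings (S \<times>\<^sub>m L) (cotangent_bundle M \<times>\<^sub>m cotangent_bundle L).
        \<forall>x\<in>points S. \<forall>g\<in>points L. \<forall>k\<in>points L.
          f (x, g \<otimes>\<^bsub>G\<^esub> k) =
            (fst (f (x, g)), cotangent_right L G (snd (f (x, g))) k)}"

definition aut_vol :: "('s, 'e::euclidean_space) mfd \<Rightarrow> ('s, 'e) volume \<Rightarrow>
    ('g, 'f::euclidean_space) mfd \<Rightarrow> 'g monoid \<Rightarrow> ('s \<times> 'g \<Rightarrow> 's \<times> 'g) monoid" where
  "aut_vol S \<mu> L G =
     \<lparr>carrier = {\<Phi> \<in> diffeos (S \<times>\<^sub>m L).
        (\<forall>x\<in>points S. \<forall>g\<in>points L. \<forall>k\<in>points L.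
           \<Phi> (x, g \<otimes>\<^bsub>G\<^esub> k) = (fst (\<Phi> (x, g)), snd (\<Phi> (x, g)) \<otimes>\<^bsub>G\<^esub> k)) \<and>
        (\<exists>\<psi>\<in>diffeos_vol S \<mu>. \<forall>x\<in>points S. \<forall>g\<in>points L. fst (\<Phi> (x, g)) = \<psi> x)},
      mult = compose (points (S \<times>\<^sub>m L)),
      one = (\<lambda>z\<in>points (S \<times>\<^sub>m L). z)\<rparr>"


section \<open>The momentum map\<close>

text \<open>An equivariant embedding has the form \<open>f (x, g) = (P x, \<kappa> x \<cdot> g)\<close>, so \<open>(P x, \<kappa> x)\<close> is its value
  at the unit. The point \<open>\<gamma> x\<close> is the base point of \<open>\<kappa> x\<close>, and \<open>\<sigma> x = \<kappa> x \<cdot> (\<gamma> x)\<inverse>\<close> is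
  \<open>\<xi> \<mapsto> \<langle>\<kappa> x, \<xi> \<cdot> \<gamma> x\<rangle>\<close>.\<close>

definition emb_eta :: "('s, 'e::euclidean_space) mfd \<Rightarrow> ('g, 'f::euclidean_space) mfd \<Rightarrow> 'g monoid \<Rightarrow>
    ('s \<times> 'g \<Rightarrow> ('m \<times> ('m tvec \<Rightarrow> real)) \<times> ('g \<times> ('g tvec \<Rightarrow> real))) \<Rightarrow>
    's \<Rightarrow> ('m \<times> ('m tvec \<Rightarrow> real)) \<times> ('g tvec \<Rightarrow> real)" where
  "emb_eta S L G f = (\<lambda>x\<in>points S.
     let (P, (\<gamma>, \<kappa>)) = f (x, \<one>\<^bsub>G\<^esub>)
     in (P, \<lambda>\<xi>\<in>tangent_space L \<one>\<^bsub>G\<^esub>. \<kappa> (tangent_map L L (right_transl G \<gamma>) \<xi>)))"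

definition momentum_L :: "('s, 'e::euclidean_space) mfd \<Rightarrow> ('s, 'e) volume \<Rightarrow>
    ('m, 'h::euclidean_space) mfd \<Rightarrow> ('g, 'f::euclidean_space) mfd \<Rightarrow> 'g monoid \<Rightarrow>
    ('s \<times> 'g \<Rightarrow> ('m \<times> ('m tvec \<Rightarrow> real)) \<times> ('g \<times> ('g tvec \<Rightarrow> real))) \<Rightarrow>
    (('m \<times> ('m tvec \<Rightarrow> real)) \<times> ('g tvec \<Rightarrow> real) \<Rightarrow> real) \<Rightarrow> real" where
  "momentum_L S \<mu> M L G f =
     (\<lambda>h\<in>smooth_funs (cotangent_bundle M \<times>\<^sub>m lie_dual_mfd L G).
        LINT x|volume_measure S \<mu>. h (emb_eta S L G f x))"

definition level_set :: "('s, 'e::euclidean_space) mfd \<Rightarrow> ('s, 'e) volume \<Rightarrow>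
    ('m, 'h::euclidean_space) mfd \<Rightarrow> ('g, 'f::euclidean_space) mfd \<Rightarrow> 'g monoid \<Rightarrow>
    ((('m \<times> ('m tvec \<Rightarrow> real)) \<times> ('g tvec \<Rightarrow> real) \<Rightarrow> real) \<Rightarrow> real) \<Rightarrow>
    ('s \<times> 'g \<Rightarrow> ('m \<times> ('m tvec \<Rightarrow> real)) \<times> ('g \<times> ('g tvec \<Rightarrow> real))) set" where
  "level_set S \<mu> M L G j = {f \<in> equiv_embeddings S M L G. momentum_L S \<mu> M L G f = j}"

end

theory Submission
  imports Defs
begin

text \<open>Write an equivariant embedding as \<open>f (x, g) = (P x, \<kappa> x g)\<close> and let \<open>\<eta> = (P, \<sigma>)\<close>. If \<open>f\<^sub>1\<close> and \<open>f\<^sub>2\<close>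
  have the same momentum, then \<open>h \<circ> \<eta>\<^sub>1\<close> and \<open>h \<circ> \<eta>\<^sub>2\<close> have the same integral for every smooth \<open>h\<close>.
  Testing with bump functions gives \<open>\<eta>\<^sub>1(S) = \<eta>\<^sub>2(S)\<close>, and hence by equivariance \<open>f\<^sub>1\<close> and \<open>f\<^sub>2\<close> have the
  same image. As \<open>f\<^sub>1\<close> is an immersion and a homeomorphism onto its image, \<open>\<Phi> = f\<^sub>1\<^sup>-\<^sup>1 \<circ> f\<^sub>2\<close> is a
  diffeomorphism of \<open>S \<times> \<O>\<close>; it is equivariant because \<open>f\<^sub>1\<close> is injective, and it covers a diffeomorphism \<open>\<psi>\<close>
  of \<open>S\<close> with \<open>\<eta>\<^sub>1 \<circ> \<psi> = \<eta>\<^sub>2\<close>. Where \<open>\<psi>\<close> does not preserve the volume it contracts or expands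
  it by a definite factor on an open set, which a bump function supported there would detect. Working with
  \<open>f\<^sub>1\<^sup>-\<^sup>1 \<circ> f\<^sub>2\<close> on the total space makes it unnecessary to know that \<open>\<eta>\<close> is an immersion or
  that the base point map \<open>\<gamma>\<close> is smooth.\<close>


section \<open>Smooth functions on Euclidean spaces\<close>

text \<open>Model spaces are spans of subsets of the standard basis, so they may have smaller
  dimension than the ambient space, even dimension 0. Derivatives are therefore taken within
  relatively open subsets of the span, and wherever a full-dimensional theorem enters (the inverse
  function theorem for embeddings, the change of variables formula for volumes) the coordinate map
  is completed by the identity in the remaining directions. The tests with bump functions need only
  continuity of \<eta>: images of closed subsets of the compact \<open>S\<close> are compact, hence
  closed in the Hausdorff target, and a bump function separates a point from them. The Hausdorff
  property of cotangent bundles is proved for this purpose. That \<open>aut_vol\<close> is a group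
  at all has to be shown as well. For a diffeomorphism the Jacobian condition
  \<open>preserves_volume\<close> turns out to be equivalent to invariance of the volume measure.
  The measure does not refer to charts, so composites and inverses are handled through images of
  Borel sets instead of determinants.\<close>

abbreviation Cinf_on :: "'e::euclidean_space set \<Rightarrow> ('e \<Rightarrow> 'f::euclidean_space) \<Rightarrow> bool" where
  "Cinf_on U f \<equiv> \<forall>k. Ck_on k U f"

lemma Ck_on_cong:
  assumes "Ck_on k U f" and "open U" and "\<And>x. x \<in> U \<Longrightarrow> f x = g x"
  shows "Ck_on k U g"
  using assms(1,3)
proof (induction k arbitrary: f g)
  case 0
  then show ?case using continuous_on_eq by auto
next
  case (Suc k)
  have d: "f differentiable (at x)" if "x \<in> U" for x
    using Suc.prems that by simp
  have "g differentiable (at x)" if "x \<in> U" for x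
    using d[OF that] that Suc.prems(2) assms(2)
    by (meson differentiable_def has_derivative_transform_within_open)
  moreover have "frechet_derivative f (at x) = frechet_derivative g (at x)" if "x \<in> U" for x
    using frechet_derivative_transform_within_open[OF d[OF that] assms(2) that] Suc.prems(2) by blast
  ultimately show ?case
    using Suc.IH Suc.prems(1) by fastforce
qed

text \<open>The definition speaks of the chosen derivative \<open>frechet_derivative\<close>. As the
  full derivative at a point is unique, any explicitly known derivative can take its place.\<close>

lemma Ck_on_SucI:
  assumes "open U" and "\<And>x. x \<in> U \<Longrightarrow> (f has_derivative f' x) (at x)"
    and "\<And>v. Ck_on k U (\<lambda>x. f' x v)"
  shows "Ck_on (Suc k) U f"
proof -
  have "frechet_derivative f (at x) = f' x" if "x \<in> U" for x
    using assms(2)[OF that] frechet_derivative_at by fastforce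
  then show ?thesis
    using assms(2) by (auto simp: differentiable_def intro!: Ck_on_cong[OF assms(3) assms(1)])
qed

lemma Ck_on_SucD:
  assumes "Ck_on (Suc k) U f"
  shows "x \<in> U \<Longrightarrow> (f has_derivative frechet_derivative f (at x)) (at x)"
    and "Ck_on k U (\<lambda>x. frechet_derivative f (at x) v)"
  using assms by (auto simp: frechet_derivative_works)

lemma Ck_on_continuous_on: "Ck_on k U f \<Longrightarrow> continuous_on U f"
  by (cases k) (auto intro!: differentiable_imp_continuous_on
      simp: differentiable_on_def differentiable_at_withinI)

lemma Ck_on_Suc_imp: "Ck_on (Suc k) U f \<Longrightarrow> Ck_on k U f"
proof (induction k arbitrary: f)
  case 0
  then show ?case using Ck_on_continuous_on[OF 0] by simp
next
  case (Suc k)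
  then show ?case by (metis Ck_on.simps(2))
qed

lemma Ck_on_subset: "Ck_on k U f \<Longrightarrow> V \<subseteq> U \<Longrightarrow> Ck_on k V f"
  by (induction k arbitrary: f) (auto intro: continuous_on_subset)

lemma Ck_on_const: "open U \<Longrightarrow> Ck_on k U (\<lambda>_. c)"
  by (induction k arbitrary: c) (auto simp: frechet_derivative_const)

lemma Ck_on_bounded_linear: "open U \<Longrightarrow> bounded_linear f \<Longrightarrow> Ck_on k U f"
proof (cases k)
  case (Suc n)
  assume "open U" "bounded_linear f"
  then show ?thesis
    unfolding Suc
    by (intro Ck_on_SucI[where f' = "\<lambda>_. f"])
      (auto intro: bounded_linear_imp_has_derivative Ck_on_const)
qed (auto intro: linear_continuous_on)

lemma Ck_on_add:
  assumes "open U" "Ck_on k U f" "Ck_on k U g"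
  shows "Ck_on k U (\<lambda>x. f x + g x)"
  using assms(2,3)
proof (induction k arbitrary: f g)
  case 0
  then show ?case by (auto intro: continuous_intros)
next
  case (Suc k)
  show ?case
    by (rule Ck_on_SucI[OF assms(1) has_derivative_add[OF Ck_on_SucD(1)[OF Suc.prems(1)] Ck_on_SucD(1)[OF Suc.prems(2)]]])
      (auto intro!: Suc.IH Ck_on_SucD(2)[OF Suc.prems(1)] Ck_on_SucD(2)[OF Suc.prems(2)])
qed

lemma Ck_on_bounded_linear_comp:
  assumes "open U" "bounded_linear L" "Ck_on k U f"
  shows "Ck_on k U (\<lambda>x. L (f x))"
  using assms(3)
proof (induction k arbitrary: f)
  case 0
  then show ?case
    using linear_continuous_on_compose[of U f L] assms(2) by (auto simp: bounded_linear.linear)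
next
  case (Suc k)
  show ?case
    by (rule Ck_on_SucI[OF assms(1) bounded_linear.has_derivative[OF assms(2) Ck_on_SucD(1)[OF Suc.prems]]])
      (auto intro!: Suc.IH Ck_on_SucD(2)[OF Suc.prems])
qed

lemma Ck_on_scaleR:
  assumes "open U" "Ck_on k U a" "Ck_on k U f"
  shows "Ck_on k U (\<lambda>x. a x *\<^sub>R f x)"
  using assms(2,3)
proof (induction k arbitrary: a f)
  case 0
  then show ?case by (auto intro: continuous_intros)
next
  case (Suc k)
  show ?case
    by (rule Ck_on_SucI[OF assms(1) has_derivative_scaleR[OF Ck_on_SucD(1)[OF Suc.prems(1)] Ck_on_SucD(1)[OF Suc.prems(2)]]])
      (auto intro!: Ck_on_add[OF assms(1)] Suc.IH Ck_on_SucD(2)[OF Suc.prems(1)] Ck_on_SucD(2)[OF Suc.prems(2)]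
        Ck_on_Suc_imp[OF Suc.prems(1)] Ck_on_Suc_imp[OF Suc.prems(2)])
qed

lemma Ck_on_mult:
  fixes a b :: "'e::euclidean_space \<Rightarrow> real"
  assumes "open U" "Ck_on k U a" "Ck_on k U b"
  shows "Ck_on k U (\<lambda>x. a x * b x)"
  using Ck_on_scaleR[OF assms] by simp

lemma Ck_on_sum:
  assumes "open U" "finite I" "\<And>i. i \<in> I \<Longrightarrow> Ck_on k U (f i)"
  shows "Ck_on k U (\<lambda>x. \<Sum>i\<in>I. f i x)"
  using assms(2,3) by (induction I rule: finite_induct) (auto intro: Ck_on_const Ck_on_add assms(1))

lemma linear_eq_sum_Basis:
  fixes f :: "'e::euclidean_space \<Rightarrow> 'f::real_vector"
  assumes "linear f"
  shows "f v = (\<Sum>b\<in>Basis. (v \<bullet> b) *\<^sub>R f b)"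
proof -
  have "f v = f (\<Sum>b\<in>Basis. (v \<bullet> b) *\<^sub>R b)" by (simp add: euclidean_representation)
  also have "\<dots> = (\<Sum>b\<in>Basis. (v \<bullet> b) *\<^sub>R f b)"
    using assms by (simp add: linear_sum linear_scale)
  finally show ?thesis .
qed

lemma Ck_on_compose:
  assumes "open U" "open V" "Ck_on k U f" "Ck_on k V g" "f ` U \<subseteq> V"
  shows "Ck_on k U (\<lambda>x. g (f x))"
  using assms(3,4)
proof (induction k arbitrary: g)
  case 0
  then show ?case using assms(5) by (auto intro: continuous_on_compose2)
next
  case (Suc k)
  let ?g' = "\<lambda>x. frechet_derivative g (at (f x))"
  let ?f' = "\<lambda>x. frechet_derivative f (at x)"
  have g': "(g has_derivative ?g' x) (at (f x))" if "x \<in> U" for x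
    using Ck_on_SucD(1)[OF Suc.prems(2)] that assms(5) by auto
  have "((\<lambda>x. g (f x)) has_derivative (\<lambda>v. ?g' x (?f' x v))) (at x)" if "x \<in> U" for x
    using diff_chain_at[OF Ck_on_SucD(1)[OF Suc.prems(1) that] g'[OF that]] by (simp add: o_def)
  moreover have "Ck_on k U (\<lambda>x. ?g' x (?f' x v))" for v
  proof -
    \<comment> \<open>The direction fed to the outer derivative varies with \<open>x\<close>.
      Expanding it in the standard basis leaves derivatives of \<open>g\<close> in fixed directions,
      to which the induction hypothesis applies, with scalar coefficients of class
      \<open>k\<close>.\<close>
    have "Ck_on k U (\<lambda>x. \<Sum>b\<in>Basis. (?f' x v \<bullet> b) *\<^sub>R ?g' x b)"
      by (intro Ck_on_sum Ck_on_scaleR assms(1) finite_Basis Suc.IH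
          Ck_on_SucD(2)[OF Suc.prems(2)] Ck_on_Suc_imp[OF Suc.prems(1)]
          Ck_on_bounded_linear_comp[OF assms(1) bounded_linear_inner_left Ck_on_SucD(2)[OF Suc.prems(1)]])
    then show ?thesis
      by (rule Ck_on_cong[OF _ assms(1)])
        (use linear_eq_sum_Basis[OF has_derivative_linear[OF g']] in auto)
  qed
  ultimately show ?case
    by (intro Ck_on_SucI[where f' = "\<lambda>x v. ?g' x (?f' x v)"] assms(1))
qed

lemma bounded_linear_inl: "bounded_linear (\<lambda>x. (x, 0))"
  and bounded_linear_inr: "bounded_linear (\<lambda>y. (0, y))"
  by (auto intro: bounded_linear_Pair bounded_linear_ident bounded_linear_zero)

lemma Ck_on_Pair:
  assumes "open U" "Ck_on k U f" "Ck_on k U g"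
  shows "Ck_on k U (\<lambda>x. (f x, g x))"
  using Ck_on_add[OF assms(1) Ck_on_bounded_linear_comp[OF assms(1) bounded_linear_inl assms(2)]
      Ck_on_bounded_linear_comp[OF assms(1) bounded_linear_inr assms(3)]] by simp

text \<open>A product rule in which \<open>g\<close> is merely continuous: at a zero of the scalar
  factor the increment of \<open>g\<close> contributes only to second order. It allows an inverse
  operator to be differentiated before anything beyond its continuity is known.\<close>

lemma has_derivative_scaleR_vanishing:
  fixes s :: "'a::real_normed_vector \<Rightarrow> real" and g :: "'a \<Rightarrow> 'b::real_normed_vector"
  assumes s: "(s has_derivative s') (at x)" and "s x = 0" and g: "continuous (at x) g"
  shows "((\<lambda>y. s y *\<^sub>R g y) has_derivative (\<lambda>h. s' h *\<^sub>R g x)) (at x)"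
proof -
  interpret s': bounded_linear s' using s by (rule has_derivative_bounded_linear)
  obtain K where K: "\<And>h. norm (s' h) \<le> norm h * K" using s'.bounded by blast
  have l1: "((\<lambda>y. norm (s y - s' (y - x)) / norm (y - x)) \<longlongrightarrow> 0) (at x)"
  proof -
    have "((\<lambda>y. (s y - s x - s' (y - x)) /\<^sub>R norm (y - x)) \<longlongrightarrow> 0) (at x)"
      using s by (simp add: has_derivative_at_within)
    from tendsto_norm_zero[OF this] show ?thesis
      using \<open>s x = 0\<close> by (simp add: divide_inverse mult.commute abs_mult)
  qed
  have gl: "(g \<longlongrightarrow> g x) (at x)" using g by (simp add: continuous_at)
  have l2: "((\<lambda>y. norm (g y - g x)) \<longlongrightarrow> 0) (at x)"
    using tendsto_norm[OF tendsto_diff[OF gl tendsto_const[of "g x"]]] by simp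
  have lim: "((\<lambda>y. norm (s y - s' (y - x)) / norm (y - x) * norm (g y) + K * norm (g y - g x)) \<longlongrightarrow> 0) (at x)"
    using tendsto_add[OF tendsto_mult[OF l1 tendsto_norm[OF gl]] tendsto_mult[OF tendsto_const[of K] l2]] by simp
  have bound: "norm ((s y *\<^sub>R g y - s' (y - x) *\<^sub>R g x) /\<^sub>R norm (y - x))
      \<le> norm (s y - s' (y - x)) / norm (y - x) * norm (g y) + K * norm (g y - g x)" if "y \<noteq> x" for y
  proof -
    have "s y *\<^sub>R g y - s' (y - x) *\<^sub>R g x = (s y - s' (y - x)) *\<^sub>R g y + s' (y - x) *\<^sub>R (g y - g x)"
      by (simp add: algebra_simps)
    then have "norm (s y *\<^sub>R g y - s' (y - x) *\<^sub>R g x)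
        \<le> norm (s y - s' (y - x)) * norm (g y) + norm (s' (y - x)) * norm (g y - g x)"
      by (metis norm_triangle_ineq norm_scaleR real_norm_def)
    also have "\<dots> \<le> norm (s y - s' (y - x)) * norm (g y) + (norm (y - x) * K) * norm (g y - g x)"
      by (intro add_mono mult_right_mono K) auto
    finally have "norm (s y *\<^sub>R g y - s' (y - x) *\<^sub>R g x) / norm (y - x)
        \<le> (norm (s y - s' (y - x)) * norm (g y) + (norm (y - x) * K) * norm (g y - g x)) / norm (y - x)"
      by (rule divide_right_mono) simp
    also have "\<dots> = norm (s y - s' (y - x)) / norm (y - x) * norm (g y) + K * norm (g y - g x)"
      using that by (simp add: add_divide_distrib)
    finally show ?thesis by (simp only: norm_scaleR norm_inverse real_norm_def abs_norm_cancel abs_inverse divide_inverse mult.commute)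
  qed
  show ?thesis
    unfolding has_derivative_at_within
  proof (intro conjI)
    show "bounded_linear (\<lambda>h. s' h *\<^sub>R g x)"
      by (rule bounded_linear_scaleR_left[THEN bounded_linear_compose, OF s'.bounded_linear_axioms])
    show "((\<lambda>y. (s y *\<^sub>R g y - s x *\<^sub>R g x - s' (y - x) *\<^sub>R g x) /\<^sub>R norm (y - x)) \<longlongrightarrow> 0) (at x)"
      by (rule Lim_null_comparison[OF _ lim]) (use bound \<open>s x = 0\<close> in \<open>auto simp: eventually_at_filter\<close>)
  qed
qed

section \<open>Inversion of operators and the smooth inverse function theorem\<close>

text \<open>From \<open>B y - B x = - B y \<circ> (A y - A x) \<circ> B x\<close> one reads off first a bound, then continuity and
  finally the derivative of \<open>B\<close>.\<close>

lemma continuous_inverse_operator: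
  fixes A B :: "'a::euclidean_space \<Rightarrow> 'e::euclidean_space \<Rightarrow> 'e"
  assumes "open U" and linA: "\<And>x. x \<in> U \<Longrightarrow> linear (A x)" and linB: "\<And>x. x \<in> U \<Longrightarrow> linear (B x)"
    and AB: "\<And>x v. x \<in> U \<Longrightarrow> A x (B x v) = v" and BA: "\<And>x v. x \<in> U \<Longrightarrow> B x (A x v) = v"
    and cont: "\<And>v. continuous_on U (\<lambda>x. A x v)"
  shows "continuous_on U (\<lambda>x. B x v)"
proof -
  have "continuous (at x) (\<lambda>x. B x v)" if x: "x \<in> U" for x
  proof -
    have cA: "((\<lambda>y. A y w) \<longlongrightarrow> A x w) (at x)" for w
      using cont x \<open>open U\<close> by (simp add: continuous_on_eq_continuous_at continuous_at)
    obtain K where K: "K > 0" "\<And>w. norm (B x w) \<le> norm w * K"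
      using bounded_linear.pos_bounded linB[OF x] linear_conv_bounded_linear by blast
    \<comment> \<open>Errors below \<open>e\<close> on each basis vector add up to at most
      \<open>norm w / (2 * K)\<close> on \<open>w\<close>, half of the lower bound
      \<open>norm w / K\<close> for \<open>norm (A x w)\<close>.\<close>
    define e where "e = 1 / (2 * K * DIM('e))"
    have "e > 0" using K by (simp add: e_def)
    have ev: "eventually (\<lambda>y. y \<in> U \<and> (\<forall>b\<in>Basis. norm (A y b - A x b) < e)) (at x)"
    proof (intro eventually_conj eventually_ball_finite ballI finite_Basis)
      show "eventually (\<lambda>y. y \<in> U) (at x)"
        using \<open>open U\<close> x by (rule eventually_at_in_open')
      show "eventually (\<lambda>y. norm (A y b - A x b) < e) (at x)" for b
        using tendstoD[OF cA \<open>e > 0\<close>] by (simp add: dist_norm)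
    qed
    have bound: "norm (B y w) \<le> 2 * K * norm w"
      if y: "y \<in> U" and *: "\<forall>b\<in>Basis. norm (A y b - A x b) < e" for y w
    proof -
      let ?w = "B y w"
      have "A y ?w - A x ?w = (\<Sum>b\<in>Basis. (?w \<bullet> b) *\<^sub>R (A y b - A x b))"
        using linear_eq_sum_Basis[OF linA[OF x], of ?w] linear_eq_sum_Basis[OF linA[OF y], of ?w]
        by (simp add: sum_subtractf scaleR_diff_right)
      also have "norm \<dots> \<le> (\<Sum>b\<in>(Basis::'e set). norm ?w * e)"
        using * by (intro sum_norm_le) (simp add: mult_mono Basis_le_norm less_imp_le)
      also have "\<dots> = norm ?w / (2 * K)" by (simp add: e_def)
      finally have 1: "norm (A y ?w - A x ?w) \<le> norm ?w / (2 * K)" .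
      have "norm ?w \<le> norm (A x ?w) * K" using K(2)[of "A x ?w"] BA[OF x] by simp
      also have "\<dots> \<le> (norm (A y ?w) + norm ?w / (2 * K)) * K"
        using 1 K(1) norm_triangle_ineq2[of "A x ?w" "A y ?w"]
        by (intro mult_right_mono) (auto simp: norm_minus_commute)
      also have "\<dots> = K * norm w + norm ?w / 2"
        using K(1) AB[OF y] by (simp add: field_simps)
      finally show ?thesis by simp
    qed
    have "((\<lambda>y. B y v - B x v) \<longlongrightarrow> 0) (at x)"
    proof (rule Lim_null_comparison)
      show "eventually (\<lambda>y. norm (B y v - B x v) \<le> 2 * K * norm (A y (B x v) - A x (B x v))) (at x)"
        using ev
      proof eventually_elim
        case (elim y)
        have "B x v - B y v = B y (A y (B x v) - A x (B x v))"
          using elim linB[of y] BA AB x by (simp add: linear_diff)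
        then show ?case
          using bound[of y] elim by (metis norm_minus_commute)
      qed
      show "((\<lambda>y. 2 * K * norm (A y (B x v) - A x (B x v))) \<longlongrightarrow> 0) (at x)"
        using tendsto_mult[OF tendsto_const[of "2*K"] tendsto_norm[OF tendsto_diff[OF cA tendsto_const]], of "B x v" "A x (B x v)"]
        by simp
    qed
    then show ?thesis by (simp add: continuous_at Lim_null[symmetric] LIM_zero_iff)
  qed
  then show ?thesis by (simp add: continuous_at_imp_continuous_on)
qed

text \<open>The derivative of \<open>B\<close> is a polynomial expression in \<open>B\<close> and
  the derivative of \<open>A\<close>, so by induction every order of smoothness of \<open>A\<close>
  passes to \<open>B\<close>.\<close>

lemma Ck_on_inverse_operator:
  fixes A B :: "'a::euclidean_space \<Rightarrow> 'e::euclidean_space \<Rightarrow> 'e"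
  assumes "open U" and linA: "\<And>x. x \<in> U \<Longrightarrow> linear (A x)" and linB: "\<And>x. x \<in> U \<Longrightarrow> linear (B x)"
    and AB: "\<And>x v. x \<in> U \<Longrightarrow> A x (B x v) = v" and BA: "\<And>x v. x \<in> U \<Longrightarrow> B x (A x v) = v"
    and "\<And>v. Ck_on k U (\<lambda>x. A x v)"
  shows "Ck_on k U (\<lambda>x. B x v)"
  using assms(6)
proof (induction k arbitrary: v)
  case 0
  then show ?case using continuous_inverse_operator[OF assms(1-5)] by simp
next
  case (Suc k)
  let ?A' = "\<lambda>w x. frechet_derivative (\<lambda>x. A x w) (at x)"
  \<comment> \<open>In coordinates, this is \<open>- B x (A' (B x v))\<close> with \<open>A'\<close>
    the derivative of \<open>A\<close> at \<open>x\<close> in direction \<open>h\<close>. Only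
    values of \<open>A\<close> and \<open>B\<close> on fixed vectors are differentiated or known to
    be of class \<open>k\<close>, hence the two basis expansions.\<close>
  let ?B' = "\<lambda>x h. - (\<Sum>c\<in>Basis. (\<Sum>b\<in>Basis. (B x v \<bullet> b) * (?A' b x h \<bullet> c)) *\<^sub>R B x c)"
  have IH: "Ck_on k U (\<lambda>x. B x v)" for v
    using Suc.IH Suc.prems Ck_on_Suc_imp by blast
  have contB: "continuous (at x) (\<lambda>y. B y v)" if "x \<in> U" for x v
    using Ck_on_continuous_on[OF IH] \<open>open U\<close> that by (simp add: continuous_on_eq_continuous_at)
  have der: "((\<lambda>x. B x v) has_derivative ?B' x) (at x)" if x: "x \<in> U" for x
  proof -
    let ?u = "B x v"
    have A': "((\<lambda>y. A y w) has_derivative ?A' w x) (at x)" for w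
      using Ck_on_SucD(1)[OF Suc.prems] x by blast
    have s: "((\<lambda>y. \<Sum>b\<in>Basis. (?u \<bullet> b) * ((A y b - A x b) \<bullet> c)) has_derivative
        (\<lambda>h. \<Sum>b\<in>Basis. (?u \<bullet> b) * (?A' b x h \<bullet> c))) (at x)" for c
      by (auto intro!: derivative_eq_intros A')
    \<comment> \<open>The coefficient of \<open>B y c\<close> vanishes at \<open>y = x\<close>,
      while \<open>B y c\<close> is so far only continuous there: the situation of
      \<open>has_derivative_scaleR_vanishing\<close>.\<close>
    have "((\<lambda>y. ?u + - (\<Sum>c\<in>Basis. (\<Sum>b\<in>Basis. (?u \<bullet> b) * ((A y b - A x b) \<bullet> c)) *\<^sub>R B y c))
        has_derivative (\<lambda>h. 0 + ?B' x h)) (at x)"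
      by (intro has_derivative_add has_derivative_const has_derivative_minus has_derivative_sum
          has_derivative_scaleR_vanishing[OF s _ contB[OF x]]) simp
    then have "((\<lambda>y. ?u + - (\<Sum>c\<in>Basis. (\<Sum>b\<in>Basis. (?u \<bullet> b) * ((A y b - A x b) \<bullet> c)) *\<^sub>R B y c))
        has_derivative ?B' x) (at x)" by simp
    then show ?thesis
    proof (rule has_derivative_transform_within_open[OF _ \<open>open U\<close> x])
      fix y assume y: "y \<in> U"
      have "A y ?u - v = A y ?u - A x ?u" using AB[OF x] by simp
      also have "\<dots> = (\<Sum>b\<in>Basis. (?u \<bullet> b) *\<^sub>R (A y b - A x b))"
        using linear_eq_sum_Basis[OF linA[OF x], of ?u] linear_eq_sum_Basis[OF linA[OF y], of ?u]
        by (simp add: sum_subtractf scaleR_diff_right)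
      finally have *: "A y ?u - v = (\<Sum>b\<in>Basis. (?u \<bullet> b) *\<^sub>R (A y b - A x b))" .
      have "?u - B y v = B y (A y ?u - v)"
        using linB[OF y] BA[OF y] by (simp add: linear_diff)
      also have "\<dots> = (\<Sum>c\<in>Basis. ((A y ?u - v) \<bullet> c) *\<^sub>R B y c)"
        by (rule linear_eq_sum_Basis[OF linB[OF y]])
      finally show "?u + - (\<Sum>c\<in>Basis. (\<Sum>b\<in>Basis. (?u \<bullet> b) * ((A y b - A x b) \<bullet> c)) *\<^sub>R B y c) = B y v"
        by (simp add: * inner_sum_left algebra_simps)
    qed
  qed
  have "Ck_on k U (\<lambda>x. - (\<Sum>c\<in>Basis. (\<Sum>b\<in>Basis. (B x v \<bullet> b) * (?A' b x h \<bullet> c)) *\<^sub>R B x c))" for h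
    by (intro Ck_on_bounded_linear_comp[OF \<open>open U\<close> bounded_linear_minus[OF bounded_linear_ident]]
        Ck_on_scaleR Ck_on_sum Ck_on_mult \<open>open U\<close> finite_Basis IH
        Ck_on_bounded_linear_comp[OF \<open>open U\<close> bounded_linear_inner_left] Ck_on_SucD(2)[OF Suc.prems])
  then show ?case
    by (intro Ck_on_SucI[where f' = ?B'] \<open>open U\<close> der)
qed

text \<open>The theorem for continuously differentiable maps supplies the local inverse
  \<open>g\<close> and its derivative, the inverse of \<open>?D (g y)\<close>. This bootstraps: if
  \<open>g\<close> has class \<open>k\<close>, so has \<open>?D (g y)\<close>, hence by
  \<open>Ck_on_inverse_operator\<close> also its inverse, and \<open>g\<close> has class
  \<open>k + 1\<close>.\<close>

lemma smooth_inverse_function_theorem: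
  fixes f :: "'e::euclidean_space \<Rightarrow> 'e"
  assumes "open U" and f: "Cinf_on U f" and "x0 \<in> U" and inj: "inj (frechet_derivative f (at x0))"
  obtains U' V g where "open U'" "U' \<subseteq> U" "x0 \<in> U'" "open V" "homeomorphism U' V f g" "Cinf_on V g"
proof -
  let ?D = "\<lambda>x. frechet_derivative f (at x)"
  define f' where "f' = (\<lambda>x. Blinfun (?D x))"
  have C1: "Ck_on (Suc k) U f" for k using f by blast
  have der: "(f has_derivative ?D x) (at x)" if "x \<in> U" for x
    using Ck_on_SucD(1)[OF C1 that] .
  have f'[simp]: "blinfun_apply (f' x) = ?D x" if "x \<in> U" for x
    unfolding f'_def using has_derivative_bounded_linear[OF der[OF that]]
    by (rule bounded_linear_Blinfun_apply)
  have contf: "continuous_on U f'"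
  proof (rule continuous_on_blinfun_componentwise)
    fix i :: 'e
    show "continuous_on U (\<lambda>x. blinfun_apply (f' x) i)"
      using Ck_on_continuous_on[OF Ck_on_SucD(2)[OF C1]] by (rule continuous_on_eq) auto
  qed
  obtain h where h: "linear h" "h \<circ> ?D x0 = id"
    using linear_injective_left_inverse[OF has_derivative_linear[OF der[OF \<open>x0 \<in> U\<close>]] inj] by blast
  have "Blinfun h o\<^sub>L f' x0 = id_blinfun"
    using h(1) \<open>x0 \<in> U\<close> pointfree_idE[OF h(2)]
    by (intro blinfun_eqI) (simp add: bounded_linear_Blinfun_apply linear_conv_bounded_linear)
  then obtain U' V g g' where *: "open U'" "U' \<subseteq> U" "x0 \<in> U'" "open V" "homeomorphism U' V f g"
    "\<And>y. y \<in> V \<Longrightarrow> (g has_derivative (g' y)) (at y)"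
    "\<And>y. y \<in> V \<Longrightarrow> g' y = inv_into UNIV (blinfun_apply (f'(g y)))"
    "\<And>y. y \<in> V \<Longrightarrow> bij (blinfun_apply (f'(g y)))"
    using inverse_function_theorem[OF \<open>open U\<close> _ contf \<open>x0 \<in> U\<close>] der f' by metis
  have gV: "g ` V \<subseteq> U" using *(2,5) by (auto simp: homeomorphism_def)
  have "Ck_on k V g" for k
  proof (induction k)
    case 0
    then show ?case using *(5) by (simp add: homeomorphism_def)
  next
    case (Suc k)
    have "Ck_on k V (\<lambda>y. g' y v)" for v
    proof (rule Ck_on_inverse_operator[where A = "\<lambda>y. ?D (g y)"])
      fix y assume y: "y \<in> V"
      then have gy: "g y \<in> U" using gV by auto
      show "linear (?D (g y))" using has_derivative_linear[OF der[OF gy]] .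
      show "linear (g' y)" using has_derivative_linear[OF *(6)[OF y]] .
      show "?D (g y) (g' y v) = v" "g' y (?D (g y) v) = v" for v
        using *(7,8)[OF y] gy by (simp_all add: bij_is_surj surj_f_inv_f bij_is_inj inv_f_f)
    qed (use *(4) Ck_on_compose[OF *(4) \<open>open U\<close> Suc.IH Ck_on_SucD(2)[OF C1] gV] in auto)
    then show ?case using Ck_on_SucI[OF *(4), of g g' k] *(6) by blast
  qed
  then show thesis using that * by blast
qed

section \<open>A smooth bump function on Euclidean space\<close>

lemma Ck_on_exp_inverse:
  "Ck_on k UNIV (\<lambda>t::real. if t > 0 then inverse t ^ n * exp (- inverse t) else 0)"
proof (induction k arbitrary: n)
  \<comment> \<open>The exponent \<open>n\<close> is kept free because the family is closed under
    differentiation: the derivative of member \<open>n\<close> is a combination of the members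
    \<open>n + 1\<close> and \<open>n + 2\<close>, also at the origin, where all of them
    vanish.\<close>
  have der: "((\<lambda>t::real. if t > 0 then inverse t ^ n * exp (- inverse t) else 0) has_derivative
      (*) (- real n * (if t > 0 then inverse t ^ (n+1) * exp (- inverse t) else 0)
         + (if t > 0 then inverse t ^ (n+2) * exp (- inverse t) else 0))) (at t)" (is "(?f n has_derivative (*) (?f' t)) (at t)") for n t
  proof -
    consider "t > 0" | "t < 0" | "t = 0" by linarith
    then have "(?f n has_field_derivative ?f' t) (at t)"
    proof cases
      case 1
      have "((\<lambda>t. inverse t ^ n * exp (- inverse t)) has_field_derivative
          (- real n * (inverse t ^ (n+1) * exp (- inverse t)) + inverse t ^ (n+2) * exp (- inverse t))) (at t)"
      proof (cases n)
        case (Suc m)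
        show ?thesis
        proof -
          have i: "(inverse has_field_derivative - (inverse t * inverse t)) (at t)"
            using DERIV_inverse[of t UNIV] 1 by (simp add: numeral_2_eq_2)
          have e: "((\<lambda>t. exp (- inverse t)) has_field_derivative exp (- inverse t) * (- (- (inverse t * inverse t)))) (at t)"
            by (rule DERIV_fun_exp[OF DERIV_minus[OF i]])
          show ?thesis unfolding Suc
            by (rule DERIV_cong[OF DERIV_mult[OF DERIV_power_Suc[OF i] e]]) (simp add: algebra_simps)
        qed
      qed (use 1 in \<open>auto intro!: derivative_eq_intros simp: field_simps power2_eq_square\<close>)
      then have "(?f n has_field_derivative
          (- real n * (inverse t ^ (n+1) * exp (- inverse t)) + inverse t ^ (n+2) * exp (- inverse t))) (at t)"
        by (rule has_field_derivative_transform_within_open[where S = "{0<..}"]) (use 1 in auto)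
      then show ?thesis using 1 by simp
    next
      case 2
      have "(?f n has_field_derivative 0) (at t)"
        by (rule has_field_derivative_transform_within_open[where S = "{..<0}" and f = "\<lambda>_. 0"]) (use 2 in auto)
      then show ?thesis using 2 by simp
    next
      case 3
      \<comment> \<open>Substituting \<open>s = inverse t\<close> turns the right-hand difference
        quotient at 0 into \<open>s ^ (n+1) / exp s\<close>, so flatness is the growth of the
        exponential against powers.\<close>
      have "((\<lambda>s::real. s ^ (n+1) / exp s) \<longlongrightarrow> 0) at_top" by (rule tendsto_power_div_exp_0)
      then have "((\<lambda>t::real. inverse t ^ (n+1) / exp (inverse t)) \<longlongrightarrow> 0) (at_right 0)"
        by (rule filterlim_compose[OF _ filterlim_inverse_at_top_right])
      then have "((\<lambda>h. ?f n h / h) \<longlongrightarrow> 0) (at_right 0)"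
        by (rule Lim_transform_eventually)
          (auto simp: eventually_at_filter field_simps exp_minus)
      moreover have "((\<lambda>h. ?f n h / h) \<longlongrightarrow> 0) (at_left 0)"
        by (rule Lim_transform_eventually[where f = "\<lambda>_. 0"]) (auto simp: eventually_at_filter)
      ultimately have "((\<lambda>h. ?f n h / h) \<longlongrightarrow> 0) (at 0)"
        by (simp add: filterlim_split_at)
      then show ?thesis using 3 by (simp only: DERIV_def add_0_left) simp
    qed
    then show ?thesis by (simp add: has_field_derivative_def)
  qed
  {
    case 0
    show ?case
      using der by (auto intro!: has_derivative_continuous_on[of UNIV, OF has_derivative_at_withinI])
  next
    case (Suc k)
    show ?case
      by (rule Ck_on_SucI[OF open_UNIV der])
        (intro Ck_on_mult Ck_on_add Ck_on_const open_UNIV Suc.IH)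
  }
qed

lemma smooth_bump:
  fixes x0 :: "'e::euclidean_space"
  assumes "r > 0"
  obtains \<beta> :: "'e \<Rightarrow> real" where "Cinf_on UNIV \<beta>" "\<And>x. \<beta> x \<ge> 0" "\<beta> x0 > 0" "\<And>x. x \<notin> ball x0 r \<Longrightarrow> \<beta> x = 0"
proof
  let ?e = "\<lambda>t::real. if t > 0 then inverse t ^ 0 * exp (- inverse t) else 0"
  \<comment> \<open>The radius squared minus the squared distance to \<open>x0\<close>, positive
    exactly inside the ball. It is written as a polynomial built from sums and products so that its
    smoothness follows from the closure rules.\<close>
  let ?q = "\<lambda>x. r\<^sup>2 + (\<Sum>b\<in>Basis. (- 1) * (((x + - x0) \<bullet> b) * ((x + - x0) \<bullet> b)))"
  let ?b = "\<lambda>x. ?e (?q x)"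
  have "Ck_on k UNIV (\<lambda>x. (x + - x0) \<bullet> b)" for b k
    by (intro Ck_on_bounded_linear_comp[OF open_UNIV bounded_linear_inner_left]
        Ck_on_add Ck_on_bounded_linear Ck_on_const open_UNIV bounded_linear_ident)
  then have "Ck_on k UNIV ?q" for k
    by (intro Ck_on_add Ck_on_sum Ck_on_mult Ck_on_const open_UNIV finite_Basis)
  then show "Cinf_on UNIV ?b"
    using Ck_on_compose[OF open_UNIV open_UNIV _ Ck_on_exp_inverse] by blast
  have q: "?q x = r\<^sup>2 - (dist x0 x)\<^sup>2" for x
  proof -
    have "(dist x0 x)\<^sup>2 = (x - x0) \<bullet> (x - x0)"
      by (subst dist_commute) (simp only: dist_norm power2_norm_eq_inner)
    also have "\<dots> = (\<Sum>b\<in>Basis. ((x - x0) \<bullet> b) * ((x - x0) \<bullet> b))"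
      by (rule euclidean_inner)
    finally show ?thesis by (simp add: sum_negf)
  qed
  show "?b x \<ge> 0" for x by simp
  show "?b x0 > 0" unfolding q using assms by simp
  show "?b x = 0" if "x \<notin> ball x0 r" for x
  proof -
    have "r\<^sup>2 \<le> (dist x0 x)\<^sup>2" using that assms by (intro power_mono) auto
    then show ?thesis unfolding q by (simp add: not_less)
  qed
qed

section \<open>Smooth subsets and smooth maps\<close>

lemma smooth_onI:
  assumes "\<And>x. x \<in> X \<Longrightarrow> \<exists>U g. open U \<and> x \<in> U \<and> Cinf_on U g \<and> (\<forall>y\<in>X \<inter> U. g y = f y)"
  shows "smooth_on X f"
  using assms by (auto simp: smooth_on_def)

lemma smooth_onE:
  assumes "smooth_on X f" "x \<in> X"
  obtains U g where "open U" "x \<in> U" "Cinf_on U g" "\<forall>y\<in>X \<inter> U. g y = f y"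
proof -
  have "\<exists>U g. open U \<and> x \<in> U \<and> Cinf_on U g \<and> (\<forall>y\<in>X \<inter> U. g y = f y)"
    using assms by (simp add: smooth_on_def)
  then show thesis using that by auto
qed

lemma smooth_on_Cinf: "open U \<Longrightarrow> Cinf_on U f \<Longrightarrow> X \<subseteq> U \<Longrightarrow> smooth_on X f"
  by (blast intro: smooth_onI)

lemma smooth_on_cong_subset:
  assumes "smooth_on X f" "Y \<subseteq> X" "\<And>x. x \<in> Y \<Longrightarrow> f x = g x"
  shows "smooth_on Y g"
proof (rule smooth_onI)
  fix x assume "x \<in> Y"
  then obtain U h where "open U" "x \<in> U" "Cinf_on U h" "\<forall>y\<in>X \<inter> U. h y = f y"
    using smooth_onE[OF assms(1), of x] assms(2) by blast
  then show "\<exists>U h. open U \<and> x \<in> U \<and> Cinf_on U h \<and> (\<forall>y\<in>Y \<inter> U. h y = g y)"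
    using assms(2,3) by (intro exI[of _ U] exI[of _ h]) auto
qed

lemma smooth_on_subset: "smooth_on X f \<Longrightarrow> Y \<subseteq> X \<Longrightarrow> smooth_on Y f"
  by (rule smooth_on_cong_subset) auto

lemma smooth_on_cong: "smooth_on X f \<Longrightarrow> (\<And>x. x \<in> X \<Longrightarrow> f x = g x) \<Longrightarrow> smooth_on X g"
  by (rule smooth_on_cong_subset[OF _ subset_refl])

lemma smooth_on_local:
  assumes "\<And>x. x \<in> X \<Longrightarrow> \<exists>T. open T \<and> x \<in> T \<and> smooth_on (X \<inter> T) f"
  shows "smooth_on X f"
proof (rule smooth_onI)
  fix x assume x: "x \<in> X"
  then obtain T where T: "open T" "x \<in> T" "smooth_on (X \<inter> T) f" using assms by blast
  then obtain U g where "open U" "x \<in> U" "Cinf_on U g" "\<forall>y\<in>X \<inter> T \<inter> U. g y = f y"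
    using x smooth_onE[OF T(3)] by blast
  then show "\<exists>U g. open U \<and> x \<in> U \<and> Cinf_on U g \<and> (\<forall>y\<in>X \<inter> U. g y = f y)"
    using T by (intro exI[of _ "U \<inter> T"] exI[of _ g]) (auto intro: Ck_on_subset)
qed

lemma smooth_on_compose:
  assumes "smooth_on X f" "smooth_on Y g" "f ` X \<subseteq> Y"
  shows "smooth_on X (\<lambda>x. g (f x))"
proof (rule smooth_onI)
  fix x assume x: "x \<in> X"
  obtain U f0 where U: "open U" "x \<in> U" "Cinf_on U f0" "\<forall>y\<in>X \<inter> U. f0 y = f y"
    by (rule smooth_onE[OF assms(1) x]) blast
  obtain V g0 where V: "open V" "f x \<in> V" "Cinf_on V g0" "\<forall>y\<in>Y \<inter> V. g0 y = g y"
    using smooth_onE[OF assms(2), of "f x"] x assms(3) by blast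
  have o: "open (U \<inter> f0 -` V)"
    using U(1,3) V(1) Ck_on_continuous_on continuous_open_preimage by blast
  have "Ck_on k (U \<inter> f0 -` V) (\<lambda>x. g0 (f0 x))" for k
    by (rule Ck_on_compose[OF o V(1)]) (use U V in \<open>auto intro: Ck_on_subset\<close>)
  then show "\<exists>U h. open U \<and> x \<in> U \<and> Cinf_on U h \<and> (\<forall>y\<in>X \<inter> U. h y = g (f y))"
    using o U V assms(3) x
    by (intro exI[of _ "U \<inter> f0 -` V"] exI[of _ "\<lambda>x. g0 (f0 x)"]) fastforce
qed

lemma smooth_on_continuous_on:
  assumes "smooth_on X f"
  shows "continuous_on X f"
proof -
  have "continuous (at x within X) f" if x: "x \<in> X" for x
  proof -
    obtain U g where U: "open U" "x \<in> U" "Cinf_on U g" "\<forall>y\<in>X \<inter> U. g y = f y"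
      by (rule smooth_onE[OF assms x]) blast
    obtain e where e: "e > 0" "ball x e \<subseteq> U" using U(1,2) openE by blast
    from U have "continuous (at x within X) g"
      by (meson Ck_on_continuous_on continuous_at_imp_continuous_at_within continuous_on_eq_continuous_at)
    then show ?thesis
      by (rule continuous_transform_within[OF _ e(1) x]) (use e(2) U(4) in \<open>auto simp: dist_commute subset_iff\<close>)
  qed
  then show ?thesis by (simp add: continuous_on_eq_continuous_within)
qed

lemma smooth_on_bounded_linear: "bounded_linear f \<Longrightarrow> smooth_on X f"
  by (auto intro: smooth_on_Cinf[of UNIV] Ck_on_bounded_linear)

lemma smooth_on_const: "smooth_on X (\<lambda>_. c)"
  by (auto intro: smooth_on_Cinf[of UNIV] Ck_on_const)

lemma smooth_on_ident: "smooth_on X (\<lambda>x. x)"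
  by (rule smooth_on_bounded_linear) simp

lemma smooth_on_bounded_linear_comp:
  "bounded_linear L \<Longrightarrow> smooth_on X f \<Longrightarrow> smooth_on X (\<lambda>x. L (f x))"
  by (rule smooth_on_compose[of X f UNIV L]) (auto intro: smooth_on_bounded_linear)

lemma smooth_on_Pair:
  assumes "smooth_on X f" "smooth_on X g"
  shows "smooth_on X (\<lambda>x. (f x, g x))"
proof (rule smooth_onI)
  fix x assume x: "x \<in> X"
  obtain U f0 where U: "open U" "x \<in> U" "Cinf_on U f0" "\<forall>y\<in>X \<inter> U. f0 y = f y"
    by (rule smooth_onE[OF assms(1) x]) blast
  obtain V g0 where V: "open V" "x \<in> V" "Cinf_on V g0" "\<forall>y\<in>X \<inter> V. g0 y = g y"
    by (rule smooth_onE[OF assms(2) x]) blast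
  show "\<exists>U h. open U \<and> x \<in> U \<and> Cinf_on U h \<and> (\<forall>y\<in>X \<inter> U. h y = (f y, g y))"
    using U V by (intro exI[of _ "U \<inter> V"] exI[of _ "\<lambda>x. (f0 x, g0 x)"])
      (auto intro!: Ck_on_Pair intro: Ck_on_subset)
qed

lemma smooth_on_fst: "smooth_on X f \<Longrightarrow> smooth_on X (\<lambda>x. fst (f x))"
  and smooth_on_snd: "smooth_on X f \<Longrightarrow> smooth_on X (\<lambda>x. snd (f x))"
  by (auto intro: smooth_on_bounded_linear_comp bounded_linear_fst bounded_linear_snd)

lemma smooth_on_add:
  assumes "smooth_on X f" "smooth_on X g"
  shows "smooth_on X (\<lambda>x. f x + g x)"
  using smooth_on_bounded_linear_comp[OF bounded_linear_add[OF bounded_linear_fst bounded_linear_snd]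
      smooth_on_Pair[OF assms]] by simp

lemma smooth_on_scaleR:
  assumes "smooth_on X a" "smooth_on X f"
  shows "smooth_on X (\<lambda>x. a x *\<^sub>R f x)"
proof -
  have "smooth_on UNIV (\<lambda>p. fst p *\<^sub>R snd p)"
    by (rule smooth_on_Cinf[OF open_UNIV _ subset_UNIV])
      (intro allI Ck_on_scaleR Ck_on_bounded_linear bounded_linear_fst bounded_linear_snd open_UNIV)
  from smooth_on_compose[OF smooth_on_Pair[OF assms] this] show ?thesis by simp
qed

lemma smooth_on_sum:
  assumes "finite I" "\<And>i. i \<in> I \<Longrightarrow> smooth_on X (f i)"
  shows "smooth_on X (\<lambda>x. \<Sum>i\<in>I. f i x)"
  using assms by (induction I rule: finite_induct) (auto intro: smooth_on_const smooth_on_add)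

section \<open>Directional derivatives on relatively open subsets of a coordinate subspace\<close>

lemma smooth_on_has_derivative:
  assumes "smooth_on X f" "x \<in> X"
  obtains f' where "(f has_derivative f') (at x within X)"
proof -
  obtain U g where U: "open U" "x \<in> U" "Cinf_on U g" "\<forall>y\<in>X \<inter> U. g y = f y"
    by (rule smooth_onE[OF assms]) blast
  obtain e where e: "e > 0" "ball x e \<subseteq> U" using U openE by blast
  have "Ck_on (Suc 0) U g" using U(3) by blast
  from Ck_on_SucD(1)[OF this U(2)]
  have "(f has_derivative frechet_derivative g (at x)) (at x within X)"
    by (rule has_derivative_transform_within[OF has_derivative_at_withinI e(1) assms(2)])
      (use e(2) U(4) in \<open>auto simp: dist_commute subset_iff\<close>)
  then show thesis using that by blast
qed

text \<open>\<open>dir_deriv\<close> only looks along the line through \<open>x\<close> in direction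
  \<open>v\<close>, and this line stays in \<open>X\<close> for small parameters because
  \<open>X\<close> is relatively open. Derivatives within \<open>X\<close> are not unique, but all
  of them agree with \<open>dir_deriv\<close> on the span.\<close>

lemma dir_deriv_eq:
  assumes X: "openin (top_of_set (span B)) X" and x: "x \<in> X" and v: "v \<in> span B"
    and f: "(f has_derivative f') (at x within X)"
  shows "dir_deriv f x v = f' v"
proof -
  obtain O' where O: "open O'" "X = span B \<inter> O'" using X by (meson openin_open)
  let ?c = "\<lambda>t. x + t *\<^sub>R v"
  have inX: "?c t \<in> X" if "t \<in> ?c -` O'" for t
    using x v that by (auto simp: O(2) span_add span_scale)
  have oT: "open (?c -` O')"
    by (rule open_vimage[OF O(1)]) (intro continuous_intros)
  have "(?c has_derivative (\<lambda>t. t *\<^sub>R v)) (at 0 within ?c -` O')"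
    by (auto intro!: derivative_eq_intros)
  moreover have "(f has_derivative f') (at (?c 0) within ?c ` (?c -` O'))"
    using f inX by (auto intro: has_derivative_subset)
  ultimately have "((\<lambda>t. f (?c t)) has_derivative (\<lambda>t. f' (t *\<^sub>R v))) (at 0 within ?c -` O')"
    by (rule has_derivative_in_compose)
  moreover have "0 \<in> ?c -` O'" using x O(2) by simp
  ultimately have "((\<lambda>t. f (?c t)) has_derivative (\<lambda>t. t *\<^sub>R f' v)) (at 0)"
    by (simp only: at_within_open[OF _ oT] linear_scale[OF has_derivative_linear[OF f]])
  then show ?thesis
    unfolding dir_deriv_def by (intro vector_derivative_at) (simp add: has_vector_derivative_def)
qed

lemma smooth_on_dir_derivE:
  assumes "openin (top_of_set (span B)) X" "smooth_on X f" "x \<in> X"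
  obtains f' where "linear f'" "(f has_derivative f') (at x within X)"
    "\<And>v. v \<in> span B \<Longrightarrow> dir_deriv f x v = f' v"
  by (metis assms dir_deriv_eq has_derivative_linear smooth_on_has_derivative)

lemma dir_deriv_cong:
  assumes "openin (top_of_set (span B)) X" "smooth_on X f" "x \<in> X" "v \<in> span B"
    and "\<And>x. x \<in> X \<Longrightarrow> f x = g x"
  shows "dir_deriv f x v = dir_deriv g x v"
proof -
  obtain f' where f': "(f has_derivative f') (at x within X)"
    by (rule smooth_on_has_derivative[OF assms(2,3)]) blast
  then have "(g has_derivative f') (at x within X)"
    by (rule has_derivative_transform[rotated 2]) (use assms in auto)
  then show ?thesis using dir_deriv_eq[OF assms(1,3,4)] f' by metis
qed

lemma dir_deriv_compose:
  assumes X: "openin (top_of_set (span B)) X" and Y: "openin (top_of_set (span C)) Y"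
    and f: "smooth_on X f" and g: "smooth_on Y g" and fX: "f ` X \<subseteq> Y" and x: "x \<in> X"
    and v: "v \<in> span B" and w: "dir_deriv f x v \<in> span C"
  shows "dir_deriv (\<lambda>x. g (f x)) x v = dir_deriv g (f x) (dir_deriv f x v)"
proof -
  obtain f' where f': "(f has_derivative f') (at x within X)"
    by (rule smooth_on_has_derivative[OF f x]) blast
  obtain g' where g': "(g has_derivative g') (at (f x) within Y)"
    using smooth_on_has_derivative[OF g] x fX by blast
  have "((\<lambda>x. g (f x)) has_derivative (\<lambda>v. g' (f' v))) (at x within X)"
    using has_derivative_in_compose[OF f' has_derivative_subset[OF g' fX]] .
  from dir_deriv_eq[OF X x v this] show ?thesis
    using dir_deriv_eq[OF X x v f'] dir_deriv_eq[OF Y _ w g'] x fX by auto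
qed

text \<open>The coordinates of \<open>f\<close> outside \<open>C\<close> vanish on all of
  \<open>X\<close>, and so do their derivatives along the span.\<close>

lemma dir_deriv_in_span:
  fixes f :: "'e::euclidean_space \<Rightarrow> 'f::euclidean_space"
  assumes X: "openin (top_of_set (span B)) X" and f: "smooth_on X f" and x: "x \<in> X"
    and v: "v \<in> span B" and C: "C \<subseteq> Basis" and fX: "f ` X \<subseteq> span C"
  shows "dir_deriv f x v \<in> span C"
proof -
  obtain f' where f': "(f has_derivative f') (at x within X)"
    by (rule smooth_on_has_derivative[OF f x]) blast
  have "f' v \<bullet> b = 0" if b: "b \<in> Basis" "b \<notin> C" for b
  proof -
    have z: "f y \<bullet> b = 0" if "y \<in> X" for y
      using fX that b span_substd_basis[OF C] by auto
    have "((\<lambda>y. f y \<bullet> b) has_derivative (\<lambda>_. 0)) (at x within X)"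
      by (rule has_derivative_transform[OF x _ has_derivative_const[of 0]]) (use z in auto)
    moreover have "((\<lambda>y. f y \<bullet> b) has_derivative (\<lambda>v. f' v \<bullet> b)) (at x within X)"
      using f' by (rule has_derivative_inner_left)
    ultimately show ?thesis using dir_deriv_eq[OF X x v] by metis
  qed
  then show ?thesis
    using dir_deriv_eq[OF X x v f'] span_substd_basis[OF C] by auto
qed

text \<open>In directions of the span the derivative of a local smooth extension is independent of
  the extension, and it is itself a local smooth extension of \<open>dir_deriv\<close>.\<close>

lemma smooth_on_dir_deriv:
  assumes X: "openin (top_of_set (span B)) X" and f: "smooth_on X f" and v: "v \<in> span B"
  shows "smooth_on X (\<lambda>x. dir_deriv f x v)"
proof (rule smooth_onI)
  fix x assume x: "x \<in> X"
  obtain U g where U: "open U" "x \<in> U" "Cinf_on U g" "\<forall>y\<in>X \<inter> U. g y = f y"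
    by (rule smooth_onE[OF f x]) blast
  have C: "Ck_on (Suc k) U g" for k using U(3) by blast
  have "frechet_derivative g (at y) v = dir_deriv f y v" if "y \<in> X \<inter> U" for y
  proof -
    have XU: "openin (top_of_set (span B)) (X \<inter> U)" using X U(1) by (rule openin_Int_open)
    have "(g has_derivative frechet_derivative g (at y)) (at y within X \<inter> U)"
      using Ck_on_SucD(1)[OF C] that by (blast intro: has_derivative_at_withinI)
    then have "dir_deriv g y v = frechet_derivative g (at y) v"
      by (rule dir_deriv_eq[OF XU that v])
    moreover have "dir_deriv f y v = dir_deriv g y v"
      by (rule dir_deriv_cong[OF XU smooth_on_subset[OF f] that v]) (use U in auto)
    ultimately show ?thesis by simp
  qed
  then show "\<exists>U g. open U \<and> x \<in> U \<and> Cinf_on U g \<and> (\<forall>y\<in>X \<inter> U. g y = dir_deriv f y v)"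
    using U(1,2) Ck_on_SucD(2)[OF C] by blast
qed

text \<open>Manifolds without the separation axioms. Products and cotangent bundles are only used as such,
  together with the Hausdorff property; their paracompactness plays no role.\<close>

definition premanifold :: "('a, 'e::euclidean_space) mfd \<Rightarrow> bool" where
  "premanifold M \<longleftrightarrow>
     model_basis M \<subseteq> Basis \<and>
     \<Union>(fst ` atlas M) = points M \<and>
     (\<forall>c\<in>atlas M. inj_on (snd c) (fst c)) \<and>
     (\<forall>c\<in>atlas M. \<forall>d\<in>atlas M.
        openin (top_of_set (model_space M)) (snd c ` (fst c \<inter> fst d)) \<and>
        smooth_on (snd c ` (fst c \<inter> fst d)) (snd d \<circ> chart_inv c)) \<and>
     (\<forall>c\<in>atlas M. openin (top_of_set (model_space M)) (snd c ` fst c))"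

lemma manifold_premanifold: "manifold M \<Longrightarrow> premanifold M"
  and manifold_Hausdorff: "manifold M \<Longrightarrow> Hausdorff_space (mtop M)"
  by (simp_all add: manifold_def premanifold_def)

context
  fixes M :: "('a, 'e::euclidean_space) mfd"
  assumes pm: "premanifold M"
begin

lemma premanifold_model_basis: "model_basis M \<subseteq> Basis"
  and premanifold_points: "\<Union>(fst ` atlas M) = points M"
  using pm by (auto simp: premanifold_def)

lemma premanifold_chart_at:
  assumes "p \<in> points M" obtains c where "c \<in> atlas M" "p \<in> fst c"
  using assms premanifold_points by blast

context
  fixes c assumes c: "c \<in> atlas M"
begin

lemma chart_inj: "inj_on (snd c) (fst c)"
  and chart_image_openin: "openin (top_of_set (model_space M)) (snd c ` fst c)"
  and chart_subset_points: "fst c \<subseteq> points M"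
  using pm c premanifold_points by (auto simp: premanifold_def)

lemma chart_image_subset: "snd c ` fst c \<subseteq> model_space M"
  using chart_image_openin openin_imp_subset by blast

lemma chart_inv_chart[simp]: "p \<in> fst c \<Longrightarrow> chart_inv c (snd c p) = p"
  using chart_inj by simp

lemma transition_openin: "d \<in> atlas M \<Longrightarrow> openin (top_of_set (model_space M)) (snd c ` (fst c \<inter> fst d))"
  and transition_smooth: "d \<in> atlas M \<Longrightarrow> smooth_on (snd c ` (fst c \<inter> fst d)) (\<lambda>y. snd d (chart_inv c y))"
  using pm c by (auto simp: premanifold_def o_def)

end

text \<open>The definition of \<open>mtop\<close> by \<open>topology\<close> gives these open sets
  only once they are known to form a topology. Injectivity of the charts is what lets images commute
  with intersections.\<close>

lemma openin_mtop:
  "openin (mtop M) U \<longleftrightarrow> U \<subseteq> points M \<and>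
     (\<forall>c\<in>atlas M. openin (top_of_set (model_space M)) (snd c ` (U \<inter> fst c)))"
proof -
  let ?P = "\<lambda>U. U \<subseteq> points M \<and> (\<forall>c\<in>atlas M. openin (top_of_set (model_space M)) (snd c ` (U \<inter> fst c)))"
  have "istopology ?P"
    unfolding istopology_def
  proof (intro conjI allI impI ballI)
    fix U V c assume U: "?P U" and V: "?P V" and c: "c \<in> atlas M"
    have "snd c ` (U \<inter> V \<inter> fst c) = snd c ` (U \<inter> fst c) \<inter> snd c ` (V \<inter> fst c)"
      using chart_inj[OF c] by (auto simp: inj_on_def)
    then show "openin (top_of_set (model_space M)) (snd c ` (U \<inter> V \<inter> fst c))"
      using U V c by (simp add: openin_Int)
  next
    fix K c assume K: "Ball K ?P" and c: "c \<in> atlas M"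
    have "snd c ` (\<Union>K \<inter> fst c) = \<Union>((\<lambda>U. snd c ` (U \<inter> fst c)) ` K)" by auto
    then show "openin (top_of_set (model_space M)) (snd c ` (\<Union>K \<inter> fst c))"
      using K c by (auto intro!: openin_Union)
  qed auto
  then show ?thesis by (simp add: mtop_def topology_inverse')
qed

lemma openin_chart_image:
  "openin (mtop M) U \<Longrightarrow> c \<in> atlas M \<Longrightarrow> openin (top_of_set (model_space M)) (snd c ` (U \<inter> fst c))"
  by (simp add: openin_mtop)

text \<open>Continuity of the transition maps carries openness from the chart \<open>c\<close> to
  every other chart.\<close>

lemma openin_chart_vimage:
  assumes W: "openin (top_of_set (model_space M)) W" and c: "c \<in> atlas M"
  shows "openin (mtop M) {p \<in> fst c. snd c p \<in> W}"
  unfolding openin_mtop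
proof (intro conjI ballI)
  show "{p \<in> fst c. snd c p \<in> W} \<subseteq> points M" using chart_subset_points[OF c] by auto
  fix d assume d: "d \<in> atlas M"
  let ?D = "snd d ` (fst d \<inter> fst c)"
  have "openin (top_of_set ?D) (?D \<inter> (\<lambda>y. snd c (chart_inv d y)) -` W)"
    by (rule continuous_openin_preimage[OF smooth_on_continuous_on[OF transition_smooth[OF d c]] _ W])
      (use chart_image_subset[OF c] chart_inv_chart[OF d] in auto)
  moreover have "?D \<inter> (\<lambda>y. snd c (chart_inv d y)) -` W = snd d ` ({p \<in> fst c. snd c p \<in> W} \<inter> fst d)"
    using chart_inv_chart[OF d] by (auto simp: image_iff)
  ultimately show "openin (top_of_set (model_space M)) (snd d ` ({p \<in> fst c. snd c p \<in> W} \<inter> fst d))"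
    using openin_trans[OF _ transition_openin[OF d c]] by simp
qed

lemma openin_chart_domain: "c \<in> atlas M \<Longrightarrow> openin (mtop M) (fst c)"
proof -
  assume c: "c \<in> atlas M"
  have "{p \<in> fst c. snd c p \<in> snd c ` fst c} = fst c" by auto
  then show ?thesis using openin_chart_vimage[OF chart_image_openin[OF c] c] by simp
qed

lemma topspace_mtop[simp]: "topspace (mtop M) = points M"
proof
  show "topspace (mtop M) \<subseteq> points M"
    using openin_mtop openin_topspace by blast
  show "points M \<subseteq> topspace (mtop M)"
    using premanifold_points openin_subset[OF openin_chart_domain] by blast
qed

lemma openin_mtop_chart:
  assumes "c \<in> atlas M" "W \<subseteq> fst c" "openin (top_of_set (model_space M)) (snd c ` W)"
  shows "openin (mtop M) W"
proof -
  have "{p \<in> fst c. snd c p \<in> snd c ` W} = W"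
    using assms(2) chart_inj[OF assms(1)] by (auto simp: inj_on_def)
  then show ?thesis using openin_chart_vimage[OF assms(3,1)] by simp
qed

lemma continuous_map_chart_inv:
  assumes c: "c \<in> atlas M"
  shows "continuous_map (top_of_set (snd c ` fst c)) (mtop M) (chart_inv c)"
  unfolding continuous_map_def
proof (intro conjI allI impI)
  show "chart_inv c \<in> topspace (top_of_set (snd c ` fst c)) \<rightarrow> topspace (mtop M)"
    using chart_subset_points[OF c] by (auto simp: c)
  fix U assume U: "openin (mtop M) U"
  have "{y \<in> topspace (top_of_set (snd c ` fst c)). chart_inv c y \<in> U} = snd c ` (U \<inter> fst c)"
    by (auto simp: c)
  then show "openin (top_of_set (snd c ` fst c)) {y \<in> topspace (top_of_set (snd c ` fst c)). chart_inv c y \<in> U}"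
    using openin_chart_image[OF U c] chart_image_subset[OF c]
    by (auto intro: openin_subset_trans)
qed

end

section \<open>Smooth maps between premanifolds\<close>

lemma smooth_map_on_charts:
  assumes "premanifold M" "premanifold N" "smooth_map M N f" "c \<in> atlas M" "d \<in> atlas N"
  shows "openin (mtop M) {x \<in> fst c. f x \<in> fst d}"
    and "openin (top_of_set (model_space M)) (snd c ` {x \<in> fst c. f x \<in> fst d})"
    and "smooth_on (snd c ` {x \<in> fst c. f x \<in> fst d}) (\<lambda>y. snd d (f (chart_inv c y)))"
proof -
  have f: "continuous_map (mtop M) (mtop N) f" using assms(3) by (simp add: smooth_map_def)
  have "{x \<in> fst c. f x \<in> fst d} = {x \<in> topspace (mtop M). f x \<in> fst d} \<inter> fst c"
    using assms(1,4) chart_subset_points by fastforce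
  then show 1: "openin (mtop M) {x \<in> fst c. f x \<in> fst d}"
    using openin_continuous_map_preimage[OF f openin_chart_domain[OF assms(2,5)]]
      openin_chart_domain[OF assms(1,4)] by (simp add: openin_Int)
  have "{x \<in> fst c. f x \<in> fst d} \<inter> fst c = {x \<in> fst c. f x \<in> fst d}" by auto
  then show "openin (top_of_set (model_space M)) (snd c ` {x \<in> fst c. f x \<in> fst d})"
    using openin_chart_image[OF assms(1) 1 assms(4)] by simp
  show "smooth_on (snd c ` {x \<in> fst c. f x \<in> fst d}) (\<lambda>y. snd d (f (chart_inv c y)))"
    using assms(3,4,5) by (auto simp: smooth_map_def o_def)
qed

lemma smooth_map_in: "premanifold M \<Longrightarrow> premanifold N \<Longrightarrow> smooth_map M N f \<Longrightarrow> p \<in> points M \<Longrightarrow> f p \<in> points N"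
  by (auto simp: smooth_map_def continuous_map_def)

text \<open>Transition maps on both sides carry smoothness in one pair of charts to every other
  pair, and continuity can be checked in the given pair too. A proof of smoothness thus has to
  exhibit just one convenient pair around each point.\<close>

lemma smooth_mapI:
  assumes M: "premanifold M" and N: "premanifold N"
    and loc: "\<And>p. p \<in> points M \<Longrightarrow> \<exists>c\<in>atlas M. \<exists>d\<in>atlas N. \<exists>W. openin (mtop M) W \<and> p \<in> W \<and>
      W \<subseteq> fst c \<and> f ` W \<subseteq> fst d \<and> smooth_on (snd c ` W) (\<lambda>y. snd d (f (chart_inv c y)))"
  shows "smooth_map M N f"
proof -
  have "continuous_map (mtop M) (mtop N) f"
    unfolding continuous_map_def
  proof (intro conjI allI impI)
    show "f \<in> topspace (mtop M) \<rightarrow> topspace (mtop N)"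
    proof
      fix p assume "p \<in> topspace (mtop M)"
      then obtain d W where "d \<in> atlas N" "p \<in> W" "f ` W \<subseteq> fst d" using loc[of p] M by auto
      then show "f p \<in> topspace (mtop N)"
        using chart_subset_points[OF N \<open>d \<in> atlas N\<close>] topspace_mtop[OF N] by blast
    qed
    fix U assume U: "openin (mtop N) U"
    show "openin (mtop M) {x \<in> topspace (mtop M). f x \<in> U}"
    proof (subst openin_subopen, intro ballI)
      fix p assume "p \<in> {x \<in> topspace (mtop M). f x \<in> U}"
      then have p: "p \<in> points M" "f p \<in> U" using M by auto
      obtain c d W where c: "c \<in> atlas M" and d: "d \<in> atlas N" and W: "openin (mtop M) W" "p \<in> W"
        "W \<subseteq> fst c" "f ` W \<subseteq> fst d" "smooth_on (snd c ` W) (\<lambda>y. snd d (f (chart_inv c y)))"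
        using loc[OF p(1)] by blast
      let ?F = "\<lambda>y. snd d (f (chart_inv c y))"
      have "openin (top_of_set (snd c ` W)) (snd c ` W \<inter> ?F -` (snd d ` (U \<inter> fst d)))"
        by (rule continuous_openin_preimage[OF smooth_on_continuous_on[OF W(5)] _ openin_chart_image[OF N U d]])
          (use chart_image_subset[OF N d] chart_inv_chart[OF M c] W in \<open>fastforce simp: subset_iff\<close>)
      moreover have "openin (top_of_set (model_space M)) (snd c ` W)"
        using openin_chart_image[OF M W(1) c] W(3) by (simp add: inf_absorb1)
      moreover have "snd c ` W \<inter> ?F -` (snd d ` (U \<inter> fst d)) = snd c ` {q \<in> W. f q \<in> U}"
      proof -
        have "snd d (f q) \<in> snd d ` (U \<inter> fst d) \<longleftrightarrow> f q \<in> U" if "q \<in> W" for q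
          using that W(4) chart_inj[OF N d] by (auto simp: inj_on_def)
        then show ?thesis using W(3) chart_inv_chart[OF M c] by (force simp: image_iff subset_iff)
      qed
      ultimately have "openin (mtop M) {q \<in> W. f q \<in> U}"
        using openin_mtop_chart[OF M c, of "{q \<in> W. f q \<in> U}"] W(3) openin_trans by fastforce
      then show "\<exists>T. openin (mtop M) T \<and> p \<in> T \<and> T \<subseteq> {x \<in> topspace (mtop M). f x \<in> U}"
        using W p by (intro exI[of _ "{q \<in> W. f q \<in> U}"]) (auto dest: openin_subset)
    qed
  qed
  note cont = this
  have "smooth_on (snd c' ` {x \<in> fst c'. f x \<in> fst d'}) (\<lambda>y. snd d' (f (chart_inv c' y)))"
    if c': "c' \<in> atlas M" and d': "d' \<in> atlas N" for c' d'
  proof (rule smooth_on_local)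
    fix y assume "y \<in> snd c' ` {x \<in> fst c'. f x \<in> fst d'}"
    then obtain p where p: "p \<in> fst c'" "f p \<in> fst d'" "y = snd c' p" by auto
    then have pM: "p \<in> points M" using chart_subset_points[OF M c'] by auto
    obtain c d W where c: "c \<in> atlas M" and d: "d \<in> atlas N" and W: "openin (mtop M) W" "p \<in> W"
      "W \<subseteq> fst c" "f ` W \<subseteq> fst d" "smooth_on (snd c ` W) (\<lambda>y. snd d (f (chart_inv c y)))"
      using loc[OF pM] by blast
    let ?W = "W \<inter> fst c' \<inter> {x \<in> topspace (mtop M). f x \<in> fst d'}"
    have oW: "openin (mtop M) ?W"
      using W(1) openin_chart_domain[OF M c'] openin_chart_domain[OF N d'] cont
      by (intro openin_Int openin_continuous_map_preimage[OF cont])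
    have "?W \<inter> fst c' = ?W" by auto
    then have "openin (top_of_set (model_space M)) (snd c' ` ?W)"
      using openin_chart_image[OF M oW c'] by (simp only:)
    then obtain T where T: "open T" "snd c' ` ?W = model_space M \<inter> T" by (meson openin_open)
    have WD: "x \<in> fst c" "f x \<in> fst d" if "x \<in> W" for x using W(3,4) that by auto
    have s1: "smooth_on (snd c' ` ?W) (\<lambda>y. snd c (chart_inv c' y))"
      by (rule smooth_on_subset[OF transition_smooth[OF M c' c]]) (use W in auto)
    have s2: "smooth_on (snd c' ` ?W) (\<lambda>y. snd d (f (chart_inv c (snd c (chart_inv c' y)))))"
      by (rule smooth_on_compose[OF s1 W(5)]) (use chart_inv_chart[OF M c'] in auto)
    have "smooth_on (snd c' ` ?W) (\<lambda>y. snd d' (chart_inv d (snd d (f (chart_inv c (snd c (chart_inv c' y)))))))"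
      by (rule smooth_on_compose[OF s2 transition_smooth[OF N d d']])
        (use chart_inv_chart[OF M c'] chart_inv_chart[OF M c] WD in auto)
    then have s: "smooth_on (snd c' ` ?W) (\<lambda>y. snd d' (f (chart_inv c' y)))"
      by (rule smooth_on_cong)
        (use chart_inv_chart[OF M c'] chart_inv_chart[OF M c] chart_inv_chart[OF N d] WD in auto)
    show "\<exists>T. open T \<and> y \<in> T \<and> smooth_on (snd c' ` {x \<in> fst c'. f x \<in> fst d'} \<inter> T) (\<lambda>y. snd d' (f (chart_inv c' y)))"
    proof (intro exI conjI)
      show "open T" by fact
      have "y \<in> snd c' ` ?W" using p pM W M by auto
      then show "y \<in> T" using T by auto
      show "smooth_on (snd c' ` {x \<in> fst c'. f x \<in> fst d'} \<inter> T) (\<lambda>y. snd d' (f (chart_inv c' y)))"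
        by (rule smooth_on_subset[OF s]) (use chart_image_subset[OF M c'] T(2) in auto)
    qed
  qed
  then show ?thesis using cont by (simp add: smooth_map_def o_def)
qed

lemma smooth_map_cong:
  assumes M: "premanifold M" and N: "premanifold N" and f: "smooth_map M N f"
    and eq: "\<And>x. x \<in> points M \<Longrightarrow> f x = g x"
  shows "smooth_map M N g"
proof (rule smooth_mapI[OF M N])
  fix p assume p: "p \<in> points M"
  obtain c where c: "c \<in> atlas M" "p \<in> fst c" using premanifold_chart_at[OF M p] .
  obtain d where d: "d \<in> atlas N" "f p \<in> fst d" using premanifold_chart_at[OF N smooth_map_in[OF M N f p]] .
  have sub: "fst c \<subseteq> points M" using chart_subset_points[OF M c(1)] .
  have "smooth_on (snd c ` {x \<in> fst c. f x \<in> fst d}) (\<lambda>y. snd d (g (chart_inv c y)))"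
    by (rule smooth_on_cong[OF smooth_map_on_charts(3)[OF M N f c(1) d(1)]])
      (use chart_inv_chart[OF M c(1)] sub eq in auto)
  then show "\<exists>c\<in>atlas M. \<exists>d\<in>atlas N. \<exists>W. openin (mtop M) W \<and> p \<in> W \<and>
      W \<subseteq> fst c \<and> g ` W \<subseteq> fst d \<and> smooth_on (snd c ` W) (\<lambda>y. snd d (g (chart_inv c y)))"
    using smooth_map_on_charts(1)[OF M N f c(1) d(1)] c d sub eq
    by (intro bexI[OF _ c(1)] bexI[OF _ d(1)] exI[of _ "{x \<in> fst c. f x \<in> fst d}"]) auto
qed

lemma smooth_map_compose:
  assumes M: "premanifold M" and N: "premanifold N" and P: "premanifold P"
    and f: "smooth_map M N f" and g: "smooth_map N P g"
  shows "smooth_map M P (\<lambda>x. g (f x))"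
proof (rule smooth_mapI[OF M P])
  fix p assume p: "p \<in> points M"
  note fp = smooth_map_in[OF M N f p]
  obtain c where c: "c \<in> atlas M" "p \<in> fst c" using premanifold_chart_at[OF M p] .
  obtain d where d: "d \<in> atlas N" "f p \<in> fst d" using premanifold_chart_at[OF N fp] .
  obtain e where e: "e \<in> atlas P" "g (f p) \<in> fst e"
    using premanifold_chart_at[OF P smooth_map_in[OF N P g fp]] .
  have cf: "continuous_map (mtop M) (mtop N) f" using f by (simp add: smooth_map_def)
  let ?W = "{x \<in> fst c. f x \<in> fst d} \<inter> {x \<in> topspace (mtop M). f x \<in> {z \<in> fst d. g z \<in> fst e}}"
  have o: "openin (mtop M) ?W"
    by (intro openin_Int smooth_map_on_charts(1)[OF M N f c(1) d(1)]
        openin_continuous_map_preimage[OF cf] smooth_map_on_charts(1)[OF N P g d(1) e(1)])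
  have s1: "smooth_on (snd c ` ?W) (\<lambda>y. snd d (f (chart_inv c y)))"
    by (rule smooth_on_subset[OF smooth_map_on_charts(3)[OF M N f c(1) d(1)]]) auto
  have "smooth_on (snd c ` ?W) (\<lambda>y. snd e (g (chart_inv d (snd d (f (chart_inv c y))))))"
    by (rule smooth_on_compose[OF s1 smooth_map_on_charts(3)[OF N P g d(1) e(1)]])
      (use chart_inv_chart[OF M c(1)] in auto)
  then have "smooth_on (snd c ` ?W) (\<lambda>y. snd e (g (f (chart_inv c y))))"
    by (rule smooth_on_cong) (use chart_inv_chart[OF M c(1)] chart_inv_chart[OF N d(1)] in auto)
  then show "\<exists>c\<in>atlas M. \<exists>e\<in>atlas P. \<exists>W. openin (mtop M) W \<and> p \<in> W \<and>
      W \<subseteq> fst c \<and> (\<lambda>x. g (f x)) ` W \<subseteq> fst e \<and> smooth_on (snd c ` W) (\<lambda>y. snd e (g (f (chart_inv c y))))"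
    using o c d e p M by (intro bexI[OF _ c(1)] bexI[OF _ e(1)] exI[of _ ?W]) auto
qed

lemma smooth_map_ident:
  assumes M: "premanifold M"
  shows "smooth_map M M (\<lambda>x. x)"
proof (rule smooth_mapI[OF M M])
  fix p assume p: "p \<in> points M"
  obtain c where c: "c \<in> atlas M" "p \<in> fst c" using premanifold_chart_at[OF M p] .
  have "smooth_on (snd c ` fst c) (\<lambda>y. snd c (chart_inv c y))"
    by (rule smooth_on_cong[OF smooth_on_ident]) (use chart_inv_chart[OF M c(1)] in auto)
  then show "\<exists>c\<in>atlas M. \<exists>d\<in>atlas M. \<exists>W. openin (mtop M) W \<and> p \<in> W \<and>
      W \<subseteq> fst c \<and> (\<lambda>x. x) ` W \<subseteq> fst d \<and> smooth_on (snd c ` W) (\<lambda>y. snd d (chart_inv c y))"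
    using c openin_chart_domain[OF M c(1)]
    by (intro bexI[OF _ c(1)] exI[of _ "fst c"]) auto
qed

lemma smooth_map_const:
  assumes M: "premanifold M" and N: "premanifold N" and q: "q \<in> points N"
  shows "smooth_map M N (\<lambda>_. q)"
proof (rule smooth_mapI[OF M N])
  fix p assume p: "p \<in> points M"
  obtain c where c: "c \<in> atlas M" "p \<in> fst c" using premanifold_chart_at[OF M p] .
  obtain d where d: "d \<in> atlas N" "q \<in> fst d" using premanifold_chart_at[OF N q] .
  show "\<exists>c\<in>atlas M. \<exists>d\<in>atlas N. \<exists>W. openin (mtop M) W \<and> p \<in> W \<and>
      W \<subseteq> fst c \<and> (\<lambda>_. q) ` W \<subseteq> fst d \<and> smooth_on (snd c ` W) (\<lambda>y. snd d q)"
    using c d openin_chart_domain[OF M c(1)]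
    by (intro bexI[OF _ c(1)] bexI[OF _ d(1)] exI[of _ "fst c"]) (auto intro: smooth_on_const)
qed

lemma smooth_maps_compose:
  assumes "premanifold M" "premanifold N" "premanifold P" "f \<in> smooth_maps M N" "g \<in> smooth_maps N P"
  shows "compose (points M) g f \<in> smooth_maps M P"
proof -
  have "smooth_map M P (compose (points M) g f)"
    by (rule smooth_map_cong[OF assms(1,3) smooth_map_compose[OF assms(1-3), of f g]])
      (use assms in \<open>auto simp: smooth_maps_def compose_def\<close>)
  then show ?thesis
    using assms by (auto simp: smooth_maps_def compose_def)
qed

section \<open>Products, bump functions and tangent vectors\<close>

lemma span_prod_basis:
  fixes B :: "'e::euclidean_space set" and C :: "'f::euclidean_space set"
  assumes "B \<subseteq> Basis" "C \<subseteq> Basis"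
  shows "span ((\<lambda>b. (b, 0)) ` B \<union> (\<lambda>b. (0, b)) ` C) = span B \<times> span C" (is "span ?D = _")
proof -
  have D: "?D \<subseteq> Basis" using assms by (auto simp: Basis_prod_def)
  have "(x, y) \<in> span ?D \<longleftrightarrow> x \<in> span B \<and> y \<in> span C" for x y
  proof -
    have "(x, y) \<in> span ?D \<longleftrightarrow> (\<forall>b\<in>Basis. (b, 0) \<notin> ?D \<longrightarrow> x \<bullet> b = 0) \<and> (\<forall>b\<in>Basis. (0, b) \<notin> ?D \<longrightarrow> y \<bullet> b = 0)"
      unfolding span_substd_basis[OF D] Basis_prod_def by (simp add: ball_Un)
    moreover have "(b, 0) \<in> ?D \<longleftrightarrow> b \<in> B" if "b \<in> Basis" for b :: 'e using that nonzero_Basis by auto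
    moreover have "(0, b) \<in> ?D \<longleftrightarrow> b \<in> C" if "b \<in> Basis" for b :: 'f using that nonzero_Basis by auto
    ultimately show ?thesis
      unfolding span_substd_basis[OF assms(1)] span_substd_basis[OF assms(2)] by blast
  qed
  then show ?thesis by auto
qed

context
  fixes M :: "('a, 'e::euclidean_space) mfd" and N :: "('b, 'f::euclidean_space) mfd"
  assumes M: "premanifold M" and N: "premanifold N"
begin

lemma model_space_prod: "model_space (M \<times>\<^sub>m N) = model_space M \<times> model_space N"
  by (simp add: prod_mfd_def span_prod_basis premanifold_model_basis[OF M] premanifold_model_basis[OF N])

lemma chart_prod_image: "map_prod (snd c) (snd d) ` (A \<times> B) = snd c ` A \<times> snd d ` B"
  by (auto simp: image_iff)

lemma chart_prod_inv:
  assumes "c \<in> atlas M" "d \<in> atlas N" "y \<in> snd c ` fst c \<times> snd d ` fst d"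
  shows "inv_into (fst c \<times> fst d) (map_prod (snd c) (snd d)) y = (chart_inv c (fst y), chart_inv d (snd y))"
proof -
  have "inj_on (map_prod (snd c) (snd d)) (fst c \<times> fst d)"
    using chart_inj[OF M assms(1)] chart_inj[OF N assms(2)] by (rule map_prod_inj_on)
  then show ?thesis
    by (rule inv_into_f_eq) (use assms in \<open>auto simp: inv_into_into f_inv_into_f\<close>)
qed

lemma points_prod[simp]: "points (M \<times>\<^sub>m N) = points M \<times> points N"
  by (simp add: prod_mfd_def)

lemma atlas_prod: "e \<in> atlas (M \<times>\<^sub>m N) \<longleftrightarrow>
    (\<exists>c\<in>atlas M. \<exists>d\<in>atlas N. e = (fst c \<times> fst d, map_prod (snd c) (snd d)))"
  unfolding prod_mfd_def mfd.select_convs mem_Collect_eq by blast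

lemma premanifold_prod: "premanifold (M \<times>\<^sub>m N)"
  unfolding premanifold_def model_space_prod
proof (intro conjI ballI)
  show "model_basis (M \<times>\<^sub>m N) \<subseteq> Basis"
    using premanifold_model_basis[OF M] premanifold_model_basis[OF N]
    by (auto simp: prod_mfd_def Basis_prod_def)
  show "\<Union> (fst ` atlas (M \<times>\<^sub>m N)) = points (M \<times>\<^sub>m N)"
  proof (intro equalityI subsetI)
    fix z assume "z \<in> \<Union> (fst ` atlas (M \<times>\<^sub>m N))"
    then obtain e where "e \<in> atlas (M \<times>\<^sub>m N)" "z \<in> fst e" by blast
    then show "z \<in> points (M \<times>\<^sub>m N)"
      using chart_subset_points[OF M] chart_subset_points[OF N] by (fastforce simp: atlas_prod)
  next
    fix z assume "z \<in> points (M \<times>\<^sub>m N)"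
    then have "fst z \<in> points M" "snd z \<in> points N" by auto
    then obtain c d where "c \<in> atlas M" "fst z \<in> fst c" "d \<in> atlas N" "snd z \<in> fst d"
      using premanifold_chart_at[OF M] premanifold_chart_at[OF N] by metis
    moreover from this have "(fst c \<times> fst d, map_prod (snd c) (snd d)) \<in> atlas (M \<times>\<^sub>m N)"
      unfolding atlas_prod by blast
    ultimately show "z \<in> \<Union> (fst ` atlas (M \<times>\<^sub>m N))"
      by (intro UN_I) (auto simp: mem_Times_iff)
  qed
next
  fix e assume "e \<in> atlas (M \<times>\<^sub>m N)"
  then obtain c d where c: "c \<in> atlas M" and d: "d \<in> atlas N"
    and e: "e = (fst c \<times> fst d, map_prod (snd c) (snd d))" by (auto simp: atlas_prod)
  show "inj_on (snd e) (fst e)"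
    using chart_inj[OF M c] chart_inj[OF N d] by (simp add: e map_prod_inj_on)
  show "openin (top_of_set (model_space M \<times> model_space N)) (snd e ` fst e)"
    by (simp add: e chart_prod_image openin_Times chart_image_openin[OF M c] chart_image_openin[OF N d])
  fix e' assume "e' \<in> atlas (M \<times>\<^sub>m N)"
  then obtain c' d' where c': "c' \<in> atlas M" and d': "d' \<in> atlas N"
    and e': "e' = (fst c' \<times> fst d', map_prod (snd c') (snd d'))" by (auto simp: atlas_prod)
  have i: "snd e ` (fst e \<inter> fst e') = snd c ` (fst c \<inter> fst c') \<times> snd d ` (fst d \<inter> fst d')"
    by (simp add: e e' Times_Int_Times chart_prod_image)
  show "openin (top_of_set (model_space M \<times> model_space N)) (snd e ` (fst e \<inter> fst e'))"
    unfolding i by (intro openin_Times transition_openin[OF M c c'] transition_openin[OF N d d'])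
  have "smooth_on (snd e ` (fst e \<inter> fst e')) (\<lambda>y. (snd c' (chart_inv c (fst y)), snd d' (chart_inv d (snd y))))"
    unfolding i
    by (intro smooth_on_Pair smooth_on_compose[OF smooth_on_fst[OF smooth_on_ident] transition_smooth[OF M c c']]
        smooth_on_compose[OF smooth_on_snd[OF smooth_on_ident] transition_smooth[OF N d d']]) auto
  then show "smooth_on (snd e ` (fst e \<inter> fst e')) (snd e' \<circ> chart_inv e)"
    by (rule smooth_on_cong) (auto simp: e e' chart_prod_inv[OF c d] chart_prod_image Times_Int_Times)
qed

text \<open>Boxes of open sets are a base of both topologies. For the product manifold, a box around
  a point is found by pulling back a Euclidean box along a product chart.\<close>

lemma mtop_prod: "mtop (M \<times>\<^sub>m N) = prod_topology (mtop M) (mtop N)"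
proof -
  note P = premanifold_prod
  have 1: "openin (mtop (M \<times>\<^sub>m N)) (U \<times> V)" if U: "openin (mtop M) U" and V: "openin (mtop N) V" for U V
    unfolding openin_mtop[OF P] model_space_prod
  proof (intro conjI ballI)
    show "U \<times> V \<subseteq> points (M \<times>\<^sub>m N)" using openin_mtop[OF M] openin_mtop[OF N] U V by auto
    fix e assume "e \<in> atlas (M \<times>\<^sub>m N)"
    then obtain c d where c: "c \<in> atlas M" and d: "d \<in> atlas N"
      and e: "e = (fst c \<times> fst d, map_prod (snd c) (snd d))" by (auto simp: atlas_prod)
    show "openin (top_of_set (model_space M \<times> model_space N)) (snd e ` (U \<times> V \<inter> fst e))"
      by (simp add: e Times_Int_Times chart_prod_image openin_Times
          openin_chart_image[OF M U c] openin_chart_image[OF N V d])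
  qed
  have 2: "\<exists>A B. openin (mtop M) A \<and> openin (mtop N) B \<and> p \<in> A \<and> q \<in> B \<and> A \<times> B \<subseteq> U"
    if U: "openin (mtop (M \<times>\<^sub>m N)) U" and pq: "(p, q) \<in> U" for U p q
  proof -
    have "p \<in> points M" "q \<in> points N" using U pq openin_mtop[OF P] by auto
    then obtain c d where c: "c \<in> atlas M" "p \<in> fst c" and d: "d \<in> atlas N" "q \<in> fst d"
      using premanifold_chart_at[OF M] premanifold_chart_at[OF N] by metis
    let ?e = "(fst c \<times> fst d, map_prod (snd c) (snd d))"
    have e: "?e \<in> atlas (M \<times>\<^sub>m N)" using c d by (auto simp: atlas_prod)
    have "openin (top_of_set (model_space M \<times> model_space N)) (map_prod (snd c) (snd d) ` (U \<inter> fst c \<times> fst d))"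
      using openin_chart_image[OF P U e] by (simp add: model_space_prod)
    then obtain T where T: "open T"
      "map_prod (snd c) (snd d) ` (U \<inter> fst c \<times> fst d) = (model_space M \<times> model_space N) \<inter> T"
      by (meson openin_open)
    have "(snd c p, snd d q) \<in> T" using T(2) pq c d by force
    then obtain A B where AB: "open A" "open B" "snd c p \<in> A" "snd d q \<in> B" "A \<times> B \<subseteq> T"
      using T(1) by (auto elim: open_prod_elim)
    let ?A = "{x \<in> fst c. snd c x \<in> model_space M \<inter> A}" and ?B = "{x \<in> fst d. snd d x \<in> model_space N \<inter> B}"
    have "?A \<times> ?B \<subseteq> U"
    proof clarify
      fix x y assume xy: "x \<in> fst c" "snd c x \<in> model_space M" "snd c x \<in> A" "y \<in> fst d" "snd d y \<in> model_space N" "snd d y \<in> B"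
      then have "map_prod (snd c) (snd d) (x, y) \<in> map_prod (snd c) (snd d) ` (U \<inter> fst c \<times> fst d)"
        using T(2) AB(5) by auto
      then obtain z where z: "z \<in> U \<inter> fst c \<times> fst d" "map_prod (snd c) (snd d) (x, y) = map_prod (snd c) (snd d) z"
        by (rule imageE)
      have "(x, y) = z"
        by (rule inj_onD[OF map_prod_inj_on[OF chart_inj[OF M c(1)] chart_inj[OF N d(1)]] z(2)]) (use z xy in auto)
      then show "(x, y) \<in> U" using z by simp
    qed
    moreover have "openin (mtop M) ?A" "openin (mtop N) ?B"
      by (rule openin_chart_vimage[OF M openin_open_Int[OF AB(1)] c(1)])
        (rule openin_chart_vimage[OF N openin_open_Int[OF AB(2)] d(1)])
    moreover have "p \<in> ?A" "q \<in> ?B"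
      using c d AB chart_image_subset[OF M c(1)] chart_image_subset[OF N d(1)] by auto
    ultimately show ?thesis by blast
  qed
  have 3: "openin (mtop (M \<times>\<^sub>m N)) U" if U: "openin (prod_topology (mtop M) (mtop N)) U" for U
  proof (subst openin_subopen, intro ballI)
    fix z assume z: "z \<in> U"
    obtain x y where xy: "z = (x, y)" by (cases z)
    have "(x, y) \<in> U" using z xy by simp
    from U[unfolded openin_prod_topology_alt, rule_format, OF this]
    obtain A B where "openin (mtop M) A" "openin (mtop N) B" "x \<in> A" "y \<in> B" "A \<times> B \<subseteq> U"
      by blast
    then show "\<exists>T. openin (mtop (M \<times>\<^sub>m N)) T \<and> z \<in> T \<and> T \<subseteq> U"
      using 1 xy by blast
  qed
  show ?thesis
    unfolding topology_eq using 2 3 by (auto simp: openin_prod_topology_alt)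
qed

lemma smooth_map_fst: "smooth_map (M \<times>\<^sub>m N) M fst"
proof (rule smooth_mapI[OF premanifold_prod M])
  fix p assume p: "p \<in> points (M \<times>\<^sub>m N)"
  then have "fst p \<in> points M" "snd p \<in> points N" by auto
  then obtain c d where c: "c \<in> atlas M" "fst p \<in> fst c" and d: "d \<in> atlas N" "snd p \<in> fst d"
    using premanifold_chart_at[OF M] premanifold_chart_at[OF N] by metis
  let ?e = "(fst c \<times> fst d, map_prod (snd c) (snd d))"
  have e: "?e \<in> atlas (M \<times>\<^sub>m N)" using c d by (auto simp: atlas_prod)
  have "smooth_on (snd ?e ` fst ?e) (\<lambda>y. snd c (fst (chart_inv ?e y)))"
    by (rule smooth_on_cong[OF smooth_on_fst[OF smooth_on_ident]])
      (auto simp: chart_prod_image chart_prod_inv[OF c(1) d(1)] chart_inv_chart[OF M c(1)])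
  moreover have "p \<in> fst ?e" "fst ` fst ?e \<subseteq> fst c"
    using c d by (auto simp: mem_Times_iff)
  ultimately show "\<exists>e\<in>atlas (M \<times>\<^sub>m N). \<exists>c\<in>atlas M. \<exists>W. openin (mtop (M \<times>\<^sub>m N)) W \<and> p \<in> W \<and>
      W \<subseteq> fst e \<and> fst ` W \<subseteq> fst c \<and> smooth_on (snd e ` W) (\<lambda>y. snd c (fst (chart_inv e y)))"
    using openin_chart_domain[OF premanifold_prod e]
    by (intro bexI[OF _ e] bexI[OF _ c(1)] exI[of _ "fst ?e"] conjI subset_refl)
qed

lemma smooth_map_Pair:
  assumes Q: "premanifold Q" and f: "smooth_map Q M f" and g: "smooth_map Q N g"
  shows "smooth_map Q (M \<times>\<^sub>m N) (\<lambda>x. (f x, g x))"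
proof (rule smooth_mapI[OF Q premanifold_prod])
  fix p assume p: "p \<in> points Q"
  obtain b where b: "b \<in> atlas Q" "p \<in> fst b" using premanifold_chart_at[OF Q p] .
  obtain c where c: "c \<in> atlas M" "f p \<in> fst c" using premanifold_chart_at[OF M smooth_map_in[OF Q M f p]] .
  obtain d where d: "d \<in> atlas N" "g p \<in> fst d" using premanifold_chart_at[OF N smooth_map_in[OF Q N g p]] .
  let ?e = "(fst c \<times> fst d, map_prod (snd c) (snd d))"
  let ?W = "{x \<in> fst b. f x \<in> fst c} \<inter> {x \<in> fst b. g x \<in> fst d}"
  have e: "?e \<in> atlas (M \<times>\<^sub>m N)" using c d by (auto simp: atlas_prod)
  have "smooth_on (snd b ` ?W) (\<lambda>y. (snd c (f (chart_inv b y)), snd d (g (chart_inv b y))))"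
    by (intro smooth_on_Pair smooth_on_subset[OF smooth_map_on_charts(3)[OF Q M f b(1) c(1)]]
        smooth_on_subset[OF smooth_map_on_charts(3)[OF Q N g b(1) d(1)]]) auto
  then show "\<exists>b\<in>atlas Q. \<exists>e\<in>atlas (M \<times>\<^sub>m N). \<exists>W. openin (mtop Q) W \<and> p \<in> W \<and> W \<subseteq> fst b \<and>
      (\<lambda>x. (f x, g x)) ` W \<subseteq> fst e \<and> smooth_on (snd b ` W) (\<lambda>y. snd e (f (chart_inv b y), g (chart_inv b y)))"
    using b c d smooth_map_on_charts(1)[OF Q M f b(1) c(1)] smooth_map_on_charts(1)[OF Q N g b(1) d(1)]
    by (intro bexI[OF _ b(1)] bexI[OF _ e] exI[of _ ?W]) auto
qed

end

section \<open>Real-valued smooth functions and bump functions on a premanifold\<close>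

lemma mtop_euclidean_mfd: "mtop (euclidean_mfd :: ('e::euclidean_space, 'e) mfd) = euclidean"
  and premanifold_euclidean_mfd: "premanifold (euclidean_mfd :: ('e::euclidean_space, 'e) mfd)"
proof -
  show P: "premanifold (euclidean_mfd :: ('e, 'e) mfd)"
    by (auto simp: premanifold_def euclidean_mfd_def span_Basis inv_id smooth_on_ident id_def[symmetric]
        intro: smooth_on_cong[OF smooth_on_ident])
  show "mtop (euclidean_mfd :: ('e, 'e) mfd) = euclidean"
    unfolding topology_eq openin_mtop[OF P] by (simp add: euclidean_mfd_def span_Basis)
qed

context
  fixes M :: "('a, 'e::euclidean_space) mfd"
  assumes M: "premanifold M"
begin

lemma smooth_funs_iff:
  "h \<in> smooth_funs M \<longleftrightarrow> h \<in> extensional (points M) \<and>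
     (\<forall>c\<in>atlas M. smooth_on (snd c ` fst c) (\<lambda>y. h (chart_inv c y)))"
proof
  assume h: "h \<in> smooth_funs M"
  have "smooth_on (snd c ` fst c) (\<lambda>y. h (chart_inv c y))" if c: "c \<in> atlas M" for c
    using smooth_map_on_charts(3)[OF M premanifold_euclidean_mfd, of h c "(UNIV, id)"] h c
    by (simp add: smooth_maps_def euclidean_mfd_def)
  then show "h \<in> extensional (points M) \<and> (\<forall>c\<in>atlas M. smooth_on (snd c ` fst c) (\<lambda>y. h (chart_inv c y)))"
    using h by (auto simp: smooth_maps_def PiE_def)
next
  assume h: "h \<in> extensional (points M) \<and> (\<forall>c\<in>atlas M. smooth_on (snd c ` fst c) (\<lambda>y. h (chart_inv c y)))"
  have "smooth_map M euclidean_mfd h"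
  proof (rule smooth_mapI[OF M premanifold_euclidean_mfd])
    fix p assume "p \<in> points M"
    then obtain c where "c \<in> atlas M" "p \<in> fst c" using premanifold_chart_at[OF M] by blast
    then show "\<exists>c\<in>atlas M. \<exists>d\<in>atlas euclidean_mfd. \<exists>W. openin (mtop M) W \<and> p \<in> W \<and>
      W \<subseteq> fst c \<and> h ` W \<subseteq> fst d \<and> smooth_on (snd c ` W) (\<lambda>y. snd d (h (chart_inv c y)))"
      using h openin_chart_domain[OF M]
      by (intro bexI[of _ c] bexI[of _ "(UNIV, id)"] exI[of _ "fst c"]) (simp_all add: euclidean_mfd_def)
  qed
  then show "h \<in> smooth_funs M"
    using h by (auto simp: smooth_maps_def PiE_def euclidean_mfd_def)
qed

lemma smooth_funs_continuous_map: "h \<in> smooth_funs M \<Longrightarrow> continuous_map (mtop M) euclidean h"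
  by (auto simp: smooth_maps_def smooth_map_def mtop_euclidean_mfd)

lemma chart_ball:
  assumes c: "c \<in> atlas M" "p \<in> fst c" and U: "openin (mtop M) U" "p \<in> U"
  obtains r where "r > 0" "model_space M \<inter> cball (snd c p) r \<subseteq> snd c ` (U \<inter> fst c)"
proof -
  obtain T where T: "open T" "snd c ` (U \<inter> fst c) = model_space M \<inter> T"
    using openin_chart_image[OF M U(1) c(1)] by (meson openin_open)
  then have "snd c p \<in> T" using c U by blast
  then obtain r where "r > 0" "cball (snd c p) r \<subseteq> T" using T(1) open_contains_cball by blast
  then show thesis using that T(2) by blast
qed

text \<open>The closed ball makes the support compact, hence closed by the Hausdorff property, so that the
  extension by zero is smooth.\<close>

lemma smooth_funs_extend_by_zero:
  fixes f :: "'e \<Rightarrow> real"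
  assumes H: "Hausdorff_space (mtop M)" and c: "c \<in> atlas M" and f: "Cinf_on UNIV f"
    and r: "model_space M \<inter> cball y0 r \<subseteq> snd c ` fst c" and f0: "\<And>y. y \<notin> ball y0 r \<Longrightarrow> f y = 0"
  shows "(\<lambda>x\<in>points M. if x \<in> fst c then f (snd c x) else 0) \<in> smooth_funs M" (is "?h \<in> _")
  unfolding smooth_funs_iff
proof (intro conjI ballI)
  show "?h \<in> extensional (points M)" by simp
  fix d assume d: "d \<in> atlas M"
  let ?K = "chart_inv c ` (model_space M \<inter> cball y0 r)"
  have "compact (model_space M \<inter> cball y0 r)"
    by (intro closed_Int_compact closed_subspace subspace_span compact_cball)
  then have "compactin (top_of_set (snd c ` fst c)) (model_space M \<inter> cball y0 r)"
    using r by (simp add: compactin_subtopology)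
  then have "compactin (mtop M) ?K"
    by (rule image_compactin[OF _ continuous_map_chart_inv[OF M c]])
  then have K: "closedin (mtop M) ?K" using H compactin_imp_closedin by blast
  have sm_f: "smooth_on UNIV f" using f by (auto intro: smooth_on_Cinf)
  show "smooth_on (snd d ` fst d) (\<lambda>y. ?h (chart_inv d y))"
  proof (rule smooth_on_local)
    fix y assume "y \<in> snd d ` fst d"
    then obtain q where q: "q \<in> fst d" "y = snd d q" by auto
    have sub: "fst d \<subseteq> points M" by (rule chart_subset_points[OF M d])
    \<comment> \<open>On the domain of \<open>c\<close> the function is read off in that chart.
      Around a point outside it, the complement of the closed set \<open>?K\<close> is an open
      neighbourhood on which the function vanishes.\<close>
    define W where "W = (if q \<in> fst c then fst c else points M - ?K)"
    have W: "openin (mtop M) W"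
      using openin_chart_domain[OF M c] openin_diff[OF openin_topspace K] M by (simp add: W_def)
    have "?K \<subseteq> fst c" using r by (auto simp: inv_into_into subset_iff)
    then have qW: "q \<in> W" using q sub by (auto simp: W_def)
    obtain T where T: "open T" "snd d ` (W \<inter> fst d) = model_space M \<inter> T"
      using openin_chart_image[OF M W d] by (meson openin_open)
    have eq: "snd d ` fst d \<inter> T = snd d ` (W \<inter> fst d)"
      using T(2) chart_image_subset[OF M d] by auto
    have "smooth_on (snd d ` (W \<inter> fst d)) (\<lambda>y. ?h (chart_inv d y))"
    proof (cases "q \<in> fst c")
      case True
      have "smooth_on (snd d ` (fst d \<inter> fst c)) (\<lambda>y. f (snd c (chart_inv d y)))"
        by (rule smooth_on_compose[OF transition_smooth[OF M d c] sm_f]) simp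
      then show ?thesis
        by (rule smooth_on_cong_subset) (use True sub chart_inv_chart[OF M d] in \<open>auto simp: W_def\<close>)
    next
      case False
      have "f (snd c x) = 0" if "x \<in> W" "x \<in> fst c" for x
      proof (rule f0, rule notI)
        assume "snd c x \<in> ball y0 r"
        then have "snd c x \<in> model_space M \<inter> cball y0 r" using that chart_image_subset[OF M c] by auto
        then have "chart_inv c (snd c x) \<in> ?K" by (rule imageI)
        then show False using that False chart_inv_chart[OF M c] by (auto simp: W_def)
      qed
      then show ?thesis
        by (intro smooth_on_cong[OF smooth_on_const[of _ 0]])
          (use sub chart_inv_chart[OF M d] in auto)
    qed
    then have "smooth_on (snd d ` fst d \<inter> T) (\<lambda>y. ?h (chart_inv d y))" by (simp only: eq)
    moreover have "y \<in> T" using eq q qW by blast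
    ultimately show "\<exists>T. open T \<and> y \<in> T \<and> smooth_on (snd d ` fst d \<inter> T) (\<lambda>y. ?h (chart_inv d y))"
      using T(1) by blast
  qed
qed

lemma smooth_bump_function:
  assumes H: "Hausdorff_space (mtop M)" and U: "openin (mtop M) U" "p \<in> U"
  obtains h where "h \<in> smooth_funs M" "\<And>x. x \<in> points M \<Longrightarrow> h x \<ge> 0" "h p > 0"
    "\<And>x. x \<in> points M - U \<Longrightarrow> h x = 0"
proof -
  have pM: "p \<in> points M" using U openin_mtop[OF M] by auto
  obtain c where c: "c \<in> atlas M" "p \<in> fst c" using premanifold_chart_at[OF M pM] .
  obtain r where r: "r > 0" "model_space M \<inter> cball (snd c p) r \<subseteq> snd c ` (U \<inter> fst c)"
    using chart_ball[OF c U] .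
  obtain \<beta> :: "'e \<Rightarrow> real" where \<beta>: "Cinf_on UNIV \<beta>" "\<And>x. \<beta> x \<ge> 0" "\<beta> (snd c p) > 0"
    "\<And>x. x \<notin> ball (snd c p) r \<Longrightarrow> \<beta> x = 0"
    by (rule smooth_bump[OF r(1), of "snd c p"]) blast
  let ?h = "\<lambda>x\<in>points M. if x \<in> fst c then \<beta> (snd c x) else 0"
  have "?h \<in> smooth_funs M"
    by (rule smooth_funs_extend_by_zero[OF H c(1) \<beta>(1)]) (use r \<beta> in auto)
  moreover have "?h x = 0" if x: "x \<in> points M - U" for x
  proof (cases "x \<in> fst c \<and> snd c x \<in> ball (snd c p) r")
    case True
    then have "snd c x \<in> model_space M \<inter> cball (snd c p) r" using chart_image_subset[OF M c(1)] by auto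
    then have "snd c x \<in> snd c ` (U \<inter> fst c)" using r(2) by blast
    then show ?thesis using x True chart_inj[OF M c(1)] by (auto simp: inj_on_def)
  qed (use x \<beta> in auto)
  ultimately show thesis
    using that[of ?h] \<beta> pM c by auto
qed

section \<open>Tangent vectors and tangent maps in coordinates\<close>

lemma coord_vec_apply:
  "h \<in> smooth_funs M \<Longrightarrow> coord_vec M c p v h = dir_deriv (\<lambda>y. h (chart_inv c y)) (snd c p) v"
  by (simp add: coord_vec_def o_def)

text \<open>The right-hand side is the linear structure on derivative operators that
  \<open>cotangent_space\<close> refers to; this translates linearity of a covector into linearity
  in coordinates.\<close>

lemma coord_vec_linear_combination:
  assumes c: "c \<in> atlas M" "p \<in> fst c" and v: "v \<in> model_space M" and w: "w \<in> model_space M"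
  shows "coord_vec M c p (a *\<^sub>R v + b *\<^sub>R w) = (\<lambda>h\<in>smooth_funs M. a * coord_vec M c p v h + b * coord_vec M c p w h)"
proof
  fix h
  show "coord_vec M c p (a *\<^sub>R v + b *\<^sub>R w) h = (\<lambda>h\<in>smooth_funs M. a * coord_vec M c p v h + b * coord_vec M c p w h) h"
  proof (cases "h \<in> smooth_funs M")
    case True
    then have "smooth_on (snd c ` fst c) (\<lambda>y. h (chart_inv c y))" using c by (simp add: smooth_funs_iff)
    then obtain f' where f': "linear f'" "\<And>v. v \<in> model_space M \<Longrightarrow> dir_deriv (\<lambda>y. h (chart_inv c y)) (snd c p) v = f' v"
      by (rule smooth_on_dir_derivE[OF chart_image_openin[OF M c(1)], of _ "snd c p"]) (use c in auto)
    then show ?thesis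
      using True v w by (simp add: coord_vec_apply span_add span_scale linear_add linear_scale)
  qed (simp add: coord_vec_def)
qed

text \<open>Both operators are tested on a bump function times the linear functional given by
  \<open>v - w\<close>; equality forces the squared norm of \<open>v - w\<close> to vanish. The
  Hausdorff property guarantees that this test function is smooth on all of
  \<open>M\<close>.\<close>

lemma coord_vec_inject:
  assumes H: "Hausdorff_space (mtop M)" and c: "c \<in> atlas M" "p \<in> fst c"
    and v: "v \<in> model_space M" and w: "w \<in> model_space M" and eq: "coord_vec M c p v = coord_vec M c p w"
  shows "v = w"
proof -
  have pM: "p \<in> points M" using chart_subset_points[OF M c(1)] c by auto
  obtain r where r: "r > 0" "model_space M \<inter> cball (snd c p) r \<subseteq> snd c ` (points M \<inter> fst c)"
    using chart_ball[OF c, of "points M"] pM openin_topspace[of "mtop M"] M by auto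
  obtain \<beta> :: "'e \<Rightarrow> real" where \<beta>: "Cinf_on UNIV \<beta>" "\<And>x. \<beta> x \<ge> 0" "\<beta> (snd c p) > 0"
    "\<And>x. x \<notin> ball (snd c p) r \<Longrightarrow> \<beta> x = 0"
    by (rule smooth_bump[OF r(1), of "snd c p"]) blast
  \<comment> \<open>The linear factor is centred at \<open>snd c p\<close>, where it vanishes, so
    the derivative of \<beta> does not contribute at that point.\<close>
  let ?f = "\<lambda>y. \<beta> y * ((y + - snd c p) \<bullet> (v - w))"
  let ?h = "\<lambda>x\<in>points M. if x \<in> fst c then ?f (snd c x) else 0"
  have l: "Ck_on k UNIV (\<lambda>y. (y + - snd c p) \<bullet> (v - w))" for k
    by (intro Ck_on_bounded_linear_comp[OF open_UNIV bounded_linear_inner_left]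
        Ck_on_add Ck_on_bounded_linear Ck_on_const open_UNIV bounded_linear_ident)
  have f: "Cinf_on UNIV ?f" using \<beta>(1) by (intro allI Ck_on_mult[OF open_UNIV] l) (rule spec)
  have h: "?h \<in> smooth_funs M"
    by (rule smooth_funs_extend_by_zero[OF H c(1) f]) (use r \<beta> in auto)
  have "Ck_on (Suc 0) UNIV \<beta>" using \<beta>(1) by blast
  note has_derivative_at_withinI[OF Ck_on_SucD(1)[OF this UNIV_I[of "snd c p"]], of "snd c ` fst c"]
  then have f': "(?f has_derivative (\<lambda>u. \<beta> (snd c p) * (u \<bullet> (v - w)))) (at (snd c p) within snd c ` fst c)"
    by (auto intro!: derivative_eq_intros)
  have sf: "smooth_on (snd c ` fst c) ?f" using smooth_on_Cinf[OF open_UNIV f] by blast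
  have E: "coord_vec M c p u ?h = \<beta> (snd c p) * (u \<bullet> (v - w))" if u: "u \<in> model_space M" for u
  proof -
    have "dir_deriv ?f (snd c p) u = dir_deriv (\<lambda>y. ?h (chart_inv c y)) (snd c p) u"
      by (rule dir_deriv_cong[OF chart_image_openin[OF M c(1)] sf _ u])
        (use c chart_inv_chart[OF M c(1)] chart_subset_points[OF M c(1)] in auto)
    then show ?thesis
      using dir_deriv_eq[OF chart_image_openin[OF M c(1)] _ u f'] c
      by (simp add: coord_vec_apply[OF h])
  qed
  have "\<beta> (snd c p) * (v \<bullet> (v - w)) = \<beta> (snd c p) * (w \<bullet> (v - w))"
    by (rule trans[OF E[OF v, unfolded eq, symmetric] E[OF w]])
  then have "(v - w) \<bullet> (v - w) = 0" using \<beta>(3) by (simp add: inner_diff_left)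
  then show ?thesis by simp
qed

lemma tangent_spaceE:
  assumes "X \<in> tangent_space M p"
  obtains c v where "c \<in> atlas M" "p \<in> fst c" "v \<in> model_space M" "X = coord_vec M c p v"
  using assms by (auto simp: tangent_space_def)

lemma tangent_map_ident: "X \<in> tangent_space M p \<Longrightarrow> tangent_map M M (\<lambda>x. x) X = X"
proof (elim tangent_spaceE, intro ext)
  fix c v h assume "X = coord_vec M c p v"
  moreover have "compose (points M) h (\<lambda>x. x) = h" if "h \<in> smooth_funs M"
    using that by (auto simp: compose_def smooth_maps_def PiE_def extensional_def restrict_def)
  ultimately show "tangent_map M M (\<lambda>x. x) X h = X h"
    by (auto simp: tangent_map_def coord_vec_def restrict_def)
qed

end

lemma coord_vec_in_tangent_space:
  "c \<in> atlas M \<Longrightarrow> p \<in> fst c \<Longrightarrow> v \<in> model_space M \<Longrightarrow> coord_vec M c p v \<in> tangent_space M p"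
  unfolding tangent_space_def by blast

lemma tangent_map_cong:
  "(\<And>x. x \<in> points M \<Longrightarrow> f x = g x) \<Longrightarrow> tangent_map M N f X = tangent_map M N g X"
proof -
  assume *: "\<And>x. x \<in> points M \<Longrightarrow> f x = g x"
  have "compose (points M) h f = compose (points M) h g" for h :: "_ \<Rightarrow> real"
    using * by (auto simp: compose_def)
  then show ?thesis by (simp add: tangent_map_def)
qed

context
  fixes M :: "('a, 'e::euclidean_space) mfd" and N :: "('b, 'f::euclidean_space) mfd" and f :: "'a \<Rightarrow> 'b"
  assumes M: "premanifold M" and N: "premanifold N" and f: "smooth_map M N f"
begin

lemma smooth_funs_compose:
  assumes h: "h \<in> smooth_funs N"
  shows "compose (points M) h f \<in> smooth_funs M"
proof -
  have "smooth_map M euclidean_mfd (compose (points M) h f)"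
    by (rule smooth_map_cong[OF M premanifold_euclidean_mfd smooth_map_compose[OF M N premanifold_euclidean_mfd f, of h]])
      (use h in \<open>auto simp: smooth_maps_def compose_def\<close>)
  then show ?thesis by (auto simp: smooth_maps_def compose_def euclidean_mfd_def)
qed

lemma chart_derivative_in_model_space:
  assumes c: "c \<in> atlas M" "p \<in> fst c" and d: "d \<in> atlas N" "f p \<in> fst d" and v: "v \<in> model_space M"
  shows "dir_deriv (\<lambda>y. snd d (f (chart_inv c y))) (snd c p) v \<in> model_space N"
  by (rule dir_deriv_in_span[OF smooth_map_on_charts(2,3)[OF M N f c(1) d(1)] _ v premanifold_model_basis[OF N]])
    (use c d chart_image_subset[OF N d(1)] chart_inv_chart[OF M c(1)] in auto)

text \<open>The chain rule, applied to a test function in the chart \<open>d\<close> after the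
  coordinate expression of \<open>f\<close>. It links tangent maps, given as operators, to
  derivatives in charts.\<close>

lemma tangent_map_coord_vec:
  assumes c: "c \<in> atlas M" "p \<in> fst c" and d: "d \<in> atlas N" "f p \<in> fst d" and v: "v \<in> model_space M"
  shows "tangent_map M N f (coord_vec M c p v) =
    coord_vec N d (f p) (dir_deriv (\<lambda>y. snd d (f (chart_inv c y))) (snd c p) v)"
proof
  fix h
  let ?X = "snd c ` {x \<in> fst c. f x \<in> fst d}"
  let ?F = "\<lambda>y. snd d (f (chart_inv c y))"
  show "tangent_map M N f (coord_vec M c p v) h = coord_vec N d (f p) (dir_deriv ?F (snd c p) v) h"
  proof (cases "h \<in> smooth_funs N")
    case h: True
    note F = smooth_map_on_charts(2,3)[OF M N f c(1) d(1)]
    have sh: "smooth_on (snd d ` fst d) (\<lambda>z. h (chart_inv d z))" using h d by (simp add: smooth_funs_iff[OF N])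
    have FX: "?F ` ?X \<subseteq> snd d ` fst d" using chart_inv_chart[OF M c(1)] by auto
    have pX: "snd c p \<in> ?X" using c d by auto
    have eq: "h (chart_inv d (?F y)) = compose (points M) h f (chart_inv c y)" if "y \<in> ?X" for y
      using that chart_inv_chart[OF M c(1)] chart_inv_chart[OF N d(1)] chart_subset_points[OF M c(1)]
      by (auto simp: compose_def)
    have "dir_deriv (\<lambda>y. h (chart_inv d (?F y))) (snd c p) v =
        dir_deriv (\<lambda>y. compose (points M) h f (chart_inv c y)) (snd c p) v"
      by (rule dir_deriv_cong[OF F(1) smooth_on_compose[OF F(2) sh FX] pX v eq])
    moreover have "dir_deriv (\<lambda>y. h (chart_inv d (?F y))) (snd c p) v =
        dir_deriv (\<lambda>z. h (chart_inv d z)) (?F (snd c p)) (dir_deriv ?F (snd c p) v)"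
      by (rule dir_deriv_compose[OF F(1) chart_image_openin[OF N d(1)] F(2) sh FX pX v
            chart_derivative_in_model_space[OF c d v]])
    ultimately show ?thesis
      using h c by (simp add: tangent_map_def coord_vec_apply[OF M smooth_funs_compose[OF h]]
          coord_vec_apply[OF N] chart_inv_chart[OF M c(1)])
  qed (simp add: tangent_map_def coord_vec_def)
qed

lemma tangent_map_in:
  assumes X: "X \<in> tangent_space M p"
  shows "tangent_map M N f X \<in> tangent_space N (f p)"
proof -
  obtain c v where c: "c \<in> atlas M" "p \<in> fst c" and v: "v \<in> model_space M" and X: "X = coord_vec M c p v"
    using X by (rule tangent_spaceE[OF M])
  have "p \<in> points M" using c chart_subset_points[OF M c(1)] by auto
  then obtain d where d: "d \<in> atlas N" "f p \<in> fst d"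
    using premanifold_chart_at[OF N smooth_map_in[OF M N f]] by blast
  show ?thesis
    unfolding X tangent_map_coord_vec[OF c d v]
    by (rule coord_vec_in_tangent_space[OF d chart_derivative_in_model_space[OF c d v]])
qed

lemma tangent_map_compose:
  "tangent_map N P g (tangent_map M N f X) = tangent_map M P (\<lambda>x. g (f x)) X"
  if g: "smooth_map N P g" and P: "premanifold P"
proof
  fix h
  have "compose (points N) h g \<in> smooth_funs N" if "h \<in> smooth_funs P"
  proof -
    have "smooth_map N euclidean_mfd (compose (points N) h g)"
      by (rule smooth_map_cong[OF N premanifold_euclidean_mfd smooth_map_compose[OF N P premanifold_euclidean_mfd g, of h]])
        (use that in \<open>auto simp: smooth_maps_def compose_def\<close>)
    then show ?thesis by (auto simp: smooth_maps_def compose_def euclidean_mfd_def)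
  qed
  moreover have "compose (points M) (compose (points N) h g) f = compose (points M) h (\<lambda>x. g (f x))"
    using smooth_map_in[OF M N f] by (auto simp: compose_def)
  ultimately show "tangent_map N P g (tangent_map M N f X) h = tangent_map M P (\<lambda>x. g (f x)) X h"
    by (auto simp: tangent_map_def)
qed

end

text \<open>This is \<open>tangent_map_coord_vec\<close> for the identity map, whose coordinate
  expression is the transition map.\<close>

lemma coord_vec_change_chart:
  assumes M: "premanifold M" and c: "c \<in> atlas M" "p \<in> fst c" and d: "d \<in> atlas M" "p \<in> fst d"
    and v: "v \<in> model_space M"
  shows "coord_vec M c p v = coord_vec M d p (dir_deriv (\<lambda>y. snd d (chart_inv c y)) (snd c p) v)"
    and "dir_deriv (\<lambda>y. snd d (chart_inv c y)) (snd c p) v \<in> model_space M"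
proof -
  have "coord_vec M c p v \<in> tangent_space M p" by (rule coord_vec_in_tangent_space[OF c v])
  then show "coord_vec M c p v = coord_vec M d p (dir_deriv (\<lambda>y. snd d (chart_inv c y)) (snd c p) v)"
    using tangent_map_coord_vec[OF M M smooth_map_ident[OF M] c d v] tangent_map_ident[OF M] by metis
  show "dir_deriv (\<lambda>y. snd d (chart_inv c y)) (snd c p) v \<in> model_space M"
    using chart_derivative_in_model_space[OF M M smooth_map_ident[OF M] c d v] .
qed

lemma tangent_space_eq:
  assumes M: "premanifold M" and c: "c \<in> atlas M" "p \<in> fst c"
  shows "tangent_space M p = coord_vec M c p ` model_space M"
proof
  show "tangent_space M p \<subseteq> coord_vec M c p ` model_space M"
    using coord_vec_change_chart[OF M _ _ c] by (auto simp: tangent_space_def)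
  show "coord_vec M c p ` model_space M \<subseteq> tangent_space M p"
    using coord_vec_in_tangent_space[OF c] by blast
qed

section \<open>Reparametrizations of embeddings and cotangent bundles\<close>

text \<open>For \<open>B\<close> contained in the standard basis this is the orthogonal projection
  onto \<open>span B\<close>. Composing with it extends a function on the span to the ambient space,
  where full-dimensional theorems apply.\<close>

definition coord_proj :: "'e::euclidean_space set \<Rightarrow> 'e \<Rightarrow> 'e" where
  "coord_proj B y = (\<Sum>b\<in>B. (y \<bullet> b) *\<^sub>R b)"

lemma bounded_linear_coord_proj: "bounded_linear (coord_proj B)"
  unfolding coord_proj_def
  by (intro bounded_linear_sum bounded_linear_scaleR_const bounded_linear_inner_left)

lemma coord_proj_in_span: "coord_proj B y \<in> span B"
  unfolding coord_proj_def by (intro span_sum span_scale span_base)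

context
  fixes B :: "'e::euclidean_space set"
  assumes B: "B \<subseteq> Basis"
begin

lemma coord_proj_inner: "b \<in> Basis \<Longrightarrow> coord_proj B y \<bullet> b = (if b \<in> B then y \<bullet> b else 0)"
proof -
  assume b: "b \<in> Basis"
  have "coord_proj B y \<bullet> b = (\<Sum>c\<in>B. if c = b then y \<bullet> b else 0)"
    unfolding coord_proj_def inner_sum_left
    by (intro sum.cong) (use B b in \<open>auto simp: inner_Basis subset_iff\<close>)
  then show ?thesis using finite_subset[OF B finite_Basis] by simp
qed

lemma coord_proj_span:
  assumes "y \<in> span B"
  shows "coord_proj B y = y"
proof -
  have "\<forall>b\<in>Basis. b \<notin> B \<longrightarrow> y \<bullet> b = 0" using assms unfolding span_substd_basis[OF B] by blast
  then have "coord_proj B y \<bullet> b = y \<bullet> b" if "b \<in> Basis" for b using that by (simp add: coord_proj_inner)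
  then show ?thesis by (rule euclidean_eqI)
qed

end

text \<open>Continuity of \<Phi> holds because \<open>f1\<close> is a homeomorphism onto its image,
  and smoothness because \<open>f1\<close>, being an immersion, has local smooth left inverses. In a
  chart, a linear left inverse \<open>A\<close> of the derivative of \<open>f1\<close>, followed by
  completion in the directions outside the model space, produces a map to which the inverse function
  theorem applies.\<close>

lemma smooth_map_between_embeddings:
  fixes M :: "('a, 'e::euclidean_space) mfd" and N :: "('b, 'f::euclidean_space) mfd"
  assumes M: "premanifold M" and H: "Hausdorff_space (mtop M)" and N: "premanifold N"
    and f1: "f1 \<in> embeddings M N" and f2: "f2 \<in> embeddings M N"
    and \<Phi>: "\<And>x. x \<in> points M \<Longrightarrow> \<Phi> x \<in> points M" "\<And>x. x \<in> points M \<Longrightarrow> f1 (\<Phi> x) = f2 x"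
  shows "smooth_map M M \<Phi>"
proof -
  have sm: "smooth_map M N f1" "smooth_map M N f2"
    and emb: "embedding_map (mtop M) (mtop N) f1"
    and imm: "\<And>p. p \<in> points M \<Longrightarrow> inj_on (tangent_map M N f1) (tangent_space M p)"
    using f1 f2 by (auto simp: embeddings_def smooth_maps_def)
  have "continuous_map (mtop M) (mtop M) \<Phi>"
  proof -
    obtain g where g: "continuous_map (subtopology (mtop N) (f1 ` points M)) (mtop M) g"
      "\<And>x. x \<in> points M \<Longrightarrow> g (f1 x) = x"
      using emb unfolding embedding_map_def homeomorphic_map_maps homeomorphic_maps_def
      by (auto simp: topspace_mtop[OF M])
    have "f2 ` points M \<subseteq> f1 ` points M" using \<Phi> by (metis image_eqI image_subsetI)
    then have "continuous_map (mtop M) (subtopology (mtop N) (f1 ` points M)) f2"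
      using sm(2) by (auto simp: continuous_map_in_subtopology smooth_map_def topspace_mtop[OF M])
    from continuous_map_compose[OF this g(1)] show ?thesis
    proof (rule continuous_map_eq)
      fix x assume "x \<in> topspace (mtop M)"
      then have "x \<in> points M" by (simp add: topspace_mtop[OF M])
      then show "(g \<circ> f2) x = \<Phi> x" using g(2)[OF \<Phi>(1)] \<Phi>(2) by simp
    qed
  qed
  note cont = this
  show ?thesis
  proof (rule smooth_mapI[OF M M])
    fix p assume p: "p \<in> points M"
    let ?q = "\<Phi> p"
    have q: "?q \<in> points M" and fq: "f1 ?q = f2 p" using \<Phi> p by auto
    obtain c where c: "c \<in> atlas M" "p \<in> fst c" using premanifold_chart_at[OF M p] .
    obtain c' where c': "c' \<in> atlas M" "?q \<in> fst c'" using premanifold_chart_at[OF M q] .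
    obtain d where d: "d \<in> atlas N" "f1 ?q \<in> fst d"
      using premanifold_chart_at[OF N smooth_map_in[OF M N sm(1) q]] .
    let ?X1 = "{x \<in> fst c'. f1 x \<in> fst d}" and ?X2 = "{x \<in> fst c. f2 x \<in> fst d}"
    let ?F1 = "\<lambda>y. snd d (f1 (chart_inv c' y))" and ?F2 = "\<lambda>y. snd d (f2 (chart_inv c y))"
    let ?B = "model_basis M" and ?z = "snd c' ?q"
    let ?\<pi> = "coord_proj ?B"
    note B = premanifold_model_basis[OF M]
    note F1 = smooth_map_on_charts[OF M N sm(1) c'(1) d(1)]
    note F2 = smooth_map_on_charts[OF M N sm(2) c(1) d(1)]
    have zX: "?z \<in> snd c' ` ?X1" using c' d by auto
    obtain U g where U: "open U" "?z \<in> U" "Cinf_on U g" "\<forall>y\<in>snd c' ` ?X1 \<inter> U. g y = ?F1 y"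
      by (rule smooth_onE[OF F1(3) zX]) blast
    let ?D = "frechet_derivative g (at ?z)"
    have "Ck_on (Suc 0) U g" using U(3) by blast
    note Dg = Ck_on_SucD(1)[OF this U(2)]
    have linD: "linear ?D" by (rule has_derivative_linear[OF Dg])
    have D: "dir_deriv ?F1 ?z v = ?D v" if v: "v \<in> model_space M" for v
    proof -
      have o: "openin (top_of_set (model_space M)) (snd c' ` ?X1 \<inter> U)"
        by (rule openin_Int_open[OF F1(2) U(1)])
      have zo: "?z \<in> snd c' ` ?X1 \<inter> U" using zX U(2) by blast
      have "dir_deriv ?F1 ?z v = dir_deriv g ?z v"
        by (rule dir_deriv_cong[OF o smooth_on_subset[OF F1(3)] zo v]) (use U(4) in auto)
      also have "\<dots> = ?D v"
        by (rule dir_deriv_eq[OF o zo v has_derivative_at_withinI[OF Dg]])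
      finally show ?thesis .
    qed
    \<comment> \<open>Immersivity is a statement about tangent operators;
      \<open>coord_vec_inject\<close> brings it back to coordinate vectors.\<close>
    have "inj_on ?D (model_space M)"
    proof (subst linear_inj_on_iff_eq_0[OF linD subspace_span], intro ballI impI)
      fix v assume v: "v \<in> model_space M" and v0: "?D v = 0"
      have 0: "0 \<in> model_space M" by (rule span_zero)
      have "tangent_map M N f1 (coord_vec M c' ?q v) = tangent_map M N f1 (coord_vec M c' ?q 0)"
        using tangent_map_coord_vec[OF M N sm(1) c' d v] tangent_map_coord_vec[OF M N sm(1) c' d 0]
          D[OF v] D[OF 0] v0 linear_0[OF linD] by simp
      then have "coord_vec M c' ?q v = coord_vec M c' ?q 0"
        using imm[OF q] coord_vec_in_tangent_space[OF c' v] coord_vec_in_tangent_space[OF c' 0]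
        by (auto dest: inj_onD)
      then show "v = 0" by (rule coord_vec_inject[OF M H c' v 0])
    qed
    then obtain A where A: "linear A" "\<And>v. v \<in> model_space M \<Longrightarrow> A (?D v) = v"
      using linear_inj_on_left_inverse[OF linD] by blast
    note blA = A(1)[unfolded linear_conv_bounded_linear]
    \<comment> \<open>On the model space this is \<open>A \<circ> g\<close>, and the identity is
      added in the orthogonal directions. By the choice of \<open>A\<close> the derivative at
      \<open>?z\<close> is the identity of the ambient space.\<close>
    let ?H = "\<lambda>y. A (g (?\<pi> y)) + (y + - ?\<pi> y)"
    have \<pi>z: "?\<pi> ?z = ?z" using chart_image_subset[OF M c'(1)] c' coord_proj_span[OF B] by blast
    have oU: "open (?\<pi> -` U)"
      by (rule open_vimage[OF U(1) linear_continuous_on[OF bounded_linear_coord_proj]])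
    have CH: "Cinf_on (?\<pi> -` U) ?H"
      by (intro allI Ck_on_add[OF oU] Ck_on_bounded_linear_comp[OF oU blA]
          Ck_on_compose[OF oU U(1) Ck_on_bounded_linear[OF oU bounded_linear_coord_proj]] spec[OF U(3)]
          Ck_on_bounded_linear[OF oU] bounded_linear_ident bounded_linear_minus bounded_linear_coord_proj) auto
    have "(?H has_derivative (\<lambda>w. A (?D (?\<pi> w)) + (w + - ?\<pi> w))) (at ?z)"
    proof (intro has_derivative_add has_derivative_minus bounded_linear.has_derivative[OF blA]
        bounded_linear_imp_has_derivative[OF bounded_linear_coord_proj] has_derivative_ident)
      show "((\<lambda>y. g (?\<pi> y)) has_derivative (\<lambda>w. ?D (?\<pi> w))) (at ?z)"
        using has_derivative_compose[OF bounded_linear_imp_has_derivative[OF bounded_linear_coord_proj, of _ "at ?z"]]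
          Dg \<pi>z by metis
    qed
    then have "(?H has_derivative (\<lambda>w. w)) (at ?z)"
      by (simp add: A(2)[OF coord_proj_in_span])
    then have "frechet_derivative ?H (at ?z) = (\<lambda>w. w)" using frechet_derivative_at by metis
    then have injH: "inj (frechet_derivative ?H (at ?z))" by simp
    have zU: "?z \<in> ?\<pi> -` U" using \<pi>z U(2) by simp
    obtain U' V G where G: "open U'" "U' \<subseteq> ?\<pi> -` U" "?z \<in> U'" "open V" "homeomorphism U' V ?H G" "Cinf_on V G"
      using smooth_inverse_function_theorem[OF oU CH zU injH] .
    \<comment> \<open>For \<open>x\<close> in \<open>?W\<close> the coordinates of
      \<open>\<Phi> x\<close> lie in \<open>U'\<close>, where \<open>G\<close> inverts
      \<open>?H\<close>. Openness of \<open>?W\<close> rests on the continuity of \<Phi> established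
      above.\<close>
    let ?W = "?X2 \<inter> {x \<in> topspace (mtop M). \<Phi> x \<in> ?X1 \<inter> {x \<in> fst c'. snd c' x \<in> model_space M \<inter> U'}}"
    have "openin (mtop M) ?W"
      by (intro openin_Int F2(1) openin_continuous_map_preimage[OF cont] F1(1)
          openin_chart_vimage[OF M openin_open_Int[OF G(1)] c'(1)])
    moreover have "p \<in> ?W"
      using c c' d p fq G(3) chart_image_subset[OF M c'(1)] by (auto simp: topspace_mtop[OF M])
    \<comment> \<open>In coordinates \<Phi> is \<open>G \<circ> A \<circ> ?F2\<close>: as
      \<open>f1 (\<Phi> x) = f2 x\<close>, the value of \<open>A \<circ> ?F2\<close> at
      \<open>x\<close> is the value of \<open>?H\<close> at \<open>\<Phi> x\<close>.\<close>
    moreover have "smooth_on (snd c ` ?W) (\<lambda>y. snd c' (\<Phi> (chart_inv c y)))"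
    proof (rule smooth_on_cong)
      have key: "A (?F2 (snd c x)) = ?H (snd c' (\<Phi> x))" if x: "x \<in> ?W" for x
      proof -
        let ?y = "snd c' (\<Phi> x)"
        have xM: "x \<in> points M" using x by (simp add: topspace_mtop[OF M])
        have y: "?y \<in> model_space M" "?y \<in> U'" "\<Phi> x \<in> ?X1" using x by auto
        have \<pi>: "?\<pi> ?y = ?y" using y(1) coord_proj_span[OF B] by blast
        then have "?y \<in> U" using y(2) G(2) by auto
        then have "g ?y = ?F1 ?y" using U(4) y(3) by blast
        then show ?thesis
          using \<pi> x y(3) \<Phi>(2)[OF xM] chart_inv_chart[OF M c(1)] chart_inv_chart[OF M c'(1)] by simp
      qed
      have s: "smooth_on (snd c ` ?W) (\<lambda>y. A (?F2 y))"
        by (intro smooth_on_bounded_linear_comp[OF blA] smooth_on_subset[OF F2(3)]) auto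
      show "smooth_on (snd c ` ?W) (\<lambda>y. G (A (?F2 y)))"
        by (rule smooth_on_compose[OF s smooth_on_Cinf[OF G(4,6) subset_refl]])
          (use key G(5) in \<open>auto simp: homeomorphism_def\<close>)
      fix y assume "y \<in> snd c ` ?W"
      then obtain x where x: "x \<in> ?W" "y = snd c x" by (rule imageE)
      have "G (?H (snd c' (\<Phi> x))) = snd c' (\<Phi> x)"
        using G(5) x(1) by (simp add: homeomorphism_def)
      then show "G (A (?F2 y)) = snd c' (\<Phi> (chart_inv c y))"
        using key[OF x(1)] x chart_inv_chart[OF M c(1)] by simp
    qed
    moreover have "?W \<subseteq> fst c" "\<Phi> ` ?W \<subseteq> fst c'" by auto
    ultimately show "\<exists>c\<in>atlas M. \<exists>c'\<in>atlas M. \<exists>W. openin (mtop M) W \<and> p \<in> W \<and>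
        W \<subseteq> fst c \<and> \<Phi> ` W \<subseteq> fst c' \<and> smooth_on (snd c ` W) (\<lambda>y. snd c' (\<Phi> (chart_inv c y)))"
      using c(1) c'(1) by (intro bexI[of _ c] bexI[of _ c'] exI[of _ ?W] conjI)
  qed
qed

section \<open>Diffeomorphisms, and those induced by embeddings with the same image\<close>

lemma diffeosI:
  assumes "\<phi> \<in> smooth_maps M M" "\<psi> \<in> smooth_maps M M"
    and "\<And>x. x \<in> points M \<Longrightarrow> \<psi> (\<phi> x) = x" "\<And>x. x \<in> points M \<Longrightarrow> \<phi> (\<psi> x) = x"
  shows "\<phi> \<in> diffeos M"
proof -
  have in': "\<phi> x \<in> points M" "\<psi> x \<in> points M" if "x \<in> points M" for x
    using assms(1,2) that by (auto simp: smooth_maps_def)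
  then have bij: "bij_betw \<phi> (points M) (points M)"
    using assms(3,4) by (intro bij_betw_byWitness[where f' = \<psi>]) auto
  have "restrict (inv_into (points M) \<phi>) (points M) = \<psi>"
  proof
    fix x
    show "restrict (inv_into (points M) \<phi>) (points M) x = \<psi> x"
      using bij assms(2,4) in' by (auto simp: restrict_def smooth_maps_def PiE_def extensional_def
          bij_betw_def intro!: inv_into_f_eq)
  qed
  then show ?thesis using assms bij by (simp add: diffeos_def)
qed

lemma diffeosE:
  assumes "\<phi> \<in> diffeos M"
  obtains \<psi> where "\<phi> \<in> smooth_maps M M" "\<psi> \<in> smooth_maps M M" "\<psi> \<in> diffeos M"
    "\<And>x. x \<in> points M \<Longrightarrow> \<psi> (\<phi> x) = x" "\<And>x. x \<in> points M \<Longrightarrow> \<phi> (\<psi> x) = x"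
proof -
  let ?\<psi> = "restrict (inv_into (points M) \<phi>) (points M)"
  have \<phi>: "\<phi> \<in> smooth_maps M M" "?\<psi> \<in> smooth_maps M M" and bij: "bij_betw \<phi> (points M) (points M)"
    using assms by (auto simp: diffeos_def)
  have i: "?\<psi> (\<phi> x) = x" "\<phi> (?\<psi> x) = x" if "x \<in> points M" for x
    using bij that by (auto simp: bij_betw_def inv_into_f_f f_inv_into_f)
  show thesis
    by (rule that[OF \<phi> diffeosI[OF \<phi>(2,1) i(2,1)] i])
qed

lemma diffeos_in: "\<phi> \<in> diffeos M \<Longrightarrow> x \<in> points M \<Longrightarrow> \<phi> x \<in> points M"
  and diffeos_smooth_map: "\<phi> \<in> diffeos M \<Longrightarrow> smooth_map M M \<phi>"
  by (auto simp: diffeos_def smooth_maps_def)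

lemma diffeos_compose:
  assumes M: "premanifold M" and "\<phi> \<in> diffeos M" "\<psi> \<in> diffeos M"
  shows "compose (points M) \<phi> \<psi> \<in> diffeos M"
proof -
  obtain \<phi>' where \<phi>: "\<phi> \<in> smooth_maps M M" "\<phi>' \<in> smooth_maps M M" "\<phi>' \<in> diffeos M"
    "\<And>x. x \<in> points M \<Longrightarrow> \<phi>' (\<phi> x) = x" "\<And>x. x \<in> points M \<Longrightarrow> \<phi> (\<phi>' x) = x"
    using assms(2) by (rule diffeosE) blast
  obtain \<psi>' where \<psi>: "\<psi> \<in> smooth_maps M M" "\<psi>' \<in> smooth_maps M M" "\<psi>' \<in> diffeos M"
    "\<And>x. x \<in> points M \<Longrightarrow> \<psi>' (\<psi> x) = x" "\<And>x. x \<in> points M \<Longrightarrow> \<psi> (\<psi>' x) = x"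
    using assms(3) by (rule diffeosE) blast
  show ?thesis
    by (rule diffeosI[OF smooth_maps_compose[OF M M M \<psi>(1) \<phi>(1)] smooth_maps_compose[OF M M M \<phi>(2) \<psi>(2)]])
      (use \<phi> \<psi> assms diffeos_in[of _ M] in \<open>auto simp: compose_def\<close>)
qed

text \<open>The construction is symmetric in the two embeddings, so it yields smooth maps in both
  directions; injectivity of the embeddings makes them inverse to each other.\<close>

lemma diffeo_between_embeddings:
  assumes M: "premanifold M" and H: "Hausdorff_space (mtop M)" and N: "premanifold N"
    and f1: "f1 \<in> embeddings M N" and f2: "f2 \<in> embeddings M N" and im: "f1 ` points M = f2 ` points M"
  obtains \<Phi> where "\<Phi> \<in> diffeos M" "\<And>x. x \<in> points M \<Longrightarrow> f1 (\<Phi> x) = f2 x"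
proof -
  have *: "\<exists>\<Phi>. \<Phi> \<in> smooth_maps M M \<and> (\<forall>x\<in>points M. f (\<Phi> x) = g x)"
    if f: "f \<in> embeddings M N" and g: "g \<in> embeddings M N" and im: "g ` points M = f ` points M" for f g
  proof -
    let ?\<Phi> = "\<lambda>x\<in>points M. inv_into (points M) f (g x)"
    have 1: "?\<Phi> x \<in> points M" "f (?\<Phi> x) = g x" if "x \<in> points M" for x
    proof -
      have "g x \<in> f ` points M" using that im by blast
      then show "?\<Phi> x \<in> points M" "f (?\<Phi> x) = g x"
        using that by (simp_all add: inv_into_into f_inv_into_f)
    qed
    have "smooth_map M M ?\<Phi>"
      by (rule smooth_map_between_embeddings[OF M H N f g 1])
    then show ?thesis using 1 by (intro exI[of _ ?\<Phi>]) (auto simp: smooth_maps_def)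
  qed
  have inj: "inj_on f (points M)" if "f \<in> embeddings M N" for f
    using that by (auto simp: embeddings_def embedding_map_def homeomorphic_eq_everything_map topspace_mtop[OF M])
  obtain \<Phi> where \<Phi>: "\<Phi> \<in> smooth_maps M M" "\<forall>x\<in>points M. f1 (\<Phi> x) = f2 x"
    using *[OF f1 f2 im[symmetric]] by blast
  obtain \<Psi> where \<Psi>: "\<Psi> \<in> smooth_maps M M" "\<forall>x\<in>points M. f2 (\<Psi> x) = f1 x"
    using *[OF f2 f1 im] by blast
  have in': "\<Phi> x \<in> points M" "\<Psi> x \<in> points M" if "x \<in> points M" for x
    using \<Phi>(1) \<Psi>(1) that by (auto simp: smooth_maps_def)
  have "\<Phi> \<in> diffeos M"
  proof (rule diffeosI[OF \<Phi>(1) \<Psi>(1)])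
    fix x assume x: "x \<in> points M"
    show "\<Psi> (\<Phi> x) = x"
      by (rule inj_onD[OF inj[OF f2]]) (use x in' \<Phi>(2) \<Psi>(2) in auto)
    show "\<Phi> (\<Psi> x) = x"
      by (rule inj_onD[OF inj[OF f1]]) (use x in' \<Phi>(2) \<Psi>(2) in auto)
  qed
  then show thesis using that \<Phi>(2) by blast
qed

section \<open>The cotangent bundle as a Hausdorff premanifold\<close>

lemma smooth_on_inner:
  assumes "smooth_on X f" "smooth_on X g"
  shows "smooth_on X (\<lambda>x. f x \<bullet> g x)"
proof -
  have "smooth_on X (\<lambda>x. \<Sum>b\<in>Basis. (f x \<bullet> b) *\<^sub>R (g x \<bullet> b))"
    by (intro smooth_on_sum smooth_on_scaleR finite_Basis assms
        smooth_on_bounded_linear_comp[OF bounded_linear_inner_left])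
  then show ?thesis by (rule smooth_on_cong) (simp add: euclidean_inner[symmetric])
qed

lemma covec_coords_in_model_space: "covec_coords M c p \<alpha> \<in> model_space M"
  unfolding covec_coords_def by (intro span_sum span_scale span_base)

text \<open>Points in a common chart are separated by disjoint Euclidean neighbourhoods, so a global
  argument is called for only if they share no chart.\<close>

lemma Hausdorff_mtopI:
  assumes N: "premanifold N"
    and sep: "\<And>x y. x \<in> points N \<Longrightarrow> y \<in> points N \<Longrightarrow> x \<noteq> y \<Longrightarrow>
      (\<exists>c\<in>atlas N. x \<in> fst c \<and> y \<in> fst c) \<or> (\<exists>U V. openin (mtop N) U \<and> openin (mtop N) V \<and> x \<in> U \<and> y \<in> V \<and> disjnt U V)"
  shows "Hausdorff_space (mtop N)"
  unfolding Hausdorff_space_def topspace_mtop[OF N]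
proof (intro allI impI)
  fix x y assume xy: "x \<in> points N \<and> y \<in> points N \<and> x \<noteq> y"
  show "\<exists>U V. openin (mtop N) U \<and> openin (mtop N) V \<and> x \<in> U \<and> y \<in> V \<and> disjnt U V"
  proof (cases "\<exists>c\<in>atlas N. x \<in> fst c \<and> y \<in> fst c")
    case True
    then obtain c where c: "c \<in> atlas N" "x \<in> fst c" "y \<in> fst c" by blast
    have "snd c x \<noteq> snd c y" using chart_inj[OF N c(1)] c xy by (auto dest: inj_onD)
    then obtain U V where UV: "open U" "open V" "snd c x \<in> U" "snd c y \<in> V" "U \<inter> V = {}"
      using hausdorff by metis
    let ?W = "\<lambda>U. {p \<in> fst c. snd c p \<in> model_space N \<inter> U}"
    have "openin (mtop N) (?W U)" "openin (mtop N) (?W V)"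
      by (rule openin_chart_vimage[OF N openin_open_Int[OF UV(1)] c(1)],
          rule openin_chart_vimage[OF N openin_open_Int[OF UV(2)] c(1)])
    moreover have "x \<in> ?W U" "y \<in> ?W V" "disjnt (?W U) (?W V)"
      using c UV chart_image_subset[OF N c(1)] by (auto simp: disjnt_def)
    ultimately show ?thesis by blast
  next
    case False
    then show ?thesis using sep[of x y] xy by blast
  qed
qed

context
  fixes M :: "('a, 'e::euclidean_space) mfd"
  assumes M: "premanifold M" and H: "Hausdorff_space (mtop M)"
begin

text \<open>Through \<open>coord_vec_linear_combination\<close> a covector becomes linear in
  \<open>v\<close>, and its values on the basis vectors are its coordinates by definition.\<close>

lemma covector_coord_vec:
  assumes \<alpha>: "\<alpha> \<in> cotangent_space M p" and c: "c \<in> atlas M" "p \<in> fst c" and v: "v \<in> model_space M"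
  shows "\<alpha> (coord_vec M c p v) = covec_coords M c p \<alpha> \<bullet> v"
proof -
  note B = premanifold_model_basis[OF M]
  have fin: "finite (model_basis M)" using B finite_Basis finite_subset by blast
  have lin: "\<alpha> (coord_vec M c p (a *\<^sub>R v + b *\<^sub>R w)) = a * \<alpha> (coord_vec M c p v) + b * \<alpha> (coord_vec M c p w)"
    if "v \<in> model_space M" "w \<in> model_space M" for a b v w
    using \<alpha> coord_vec_in_tangent_space[OF c that(1)] coord_vec_in_tangent_space[OF c that(2)]
    unfolding coord_vec_linear_combination[OF M c that] cotangent_space_def by blast
  have "v \<in> model_space M \<and> \<alpha> (coord_vec M c p v) = covec_coords M c p \<alpha> \<bullet> v"
    using v
  proof (induction rule: span_induct_alt)
    case base
    show ?case using lin[of 0 0 0 0] by (simp add: span_zero)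
  next
    case (step r b w)
    have "covec_coords M c p \<alpha> \<bullet> b = (\<Sum>b'\<in>model_basis M. if b' = b then \<alpha> (coord_vec M c p b) else 0)"
      unfolding covec_coords_def inner_sum_left
      by (intro sum.cong) (use B step in \<open>auto simp: inner_Basis subset_iff\<close>)
    then have "covec_coords M c p \<alpha> \<bullet> b = \<alpha> (coord_vec M c p b)"
      using step fin by simp
    then show ?case
      using step lin[of b w r 1] by (simp add: span_base span_add span_scale inner_add_right)
  qed
  then show ?thesis by simp
qed

lemma covec_coords_inject:
  assumes \<alpha>: "\<alpha> \<in> cotangent_space M p" and \<beta>: "\<beta> \<in> cotangent_space M p" and c: "c \<in> atlas M" "p \<in> fst c"
    and eq: "covec_coords M c p \<alpha> = covec_coords M c p \<beta>"
  shows "\<alpha> = \<beta>"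
proof
  fix X
  show "\<alpha> X = \<beta> X"
  proof (cases "X \<in> tangent_space M p")
    case True
    then obtain v where "v \<in> model_space M" "X = coord_vec M c p v"
      unfolding tangent_space_eq[OF M c] by blast
    then show ?thesis using covector_coord_vec[OF \<alpha> c] covector_coord_vec[OF \<beta> c] eq by simp
  next
    case False
    then show ?thesis using \<alpha> \<beta> by (simp add: cotangent_space_def extensional_def)
  qed
qed

text \<open>The covector is the inner product with \<open>a\<close>, transported from coordinates to
  tangent operators. The transport is well defined by \<open>coord_vec_inject\<close>, which is how
  the Hausdorff property enters the charts of the cotangent bundle.\<close>

lemma covec_coords_surj:
  assumes c: "c \<in> atlas M" "p \<in> fst c" and a: "a \<in> model_space M"
  obtains \<alpha> where "\<alpha> \<in> cotangent_space M p" "covec_coords M c p \<alpha> = a"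
proof -
  have inj: "inj_on (coord_vec M c p) (model_space M)"
    by (rule inj_onI) (rule coord_vec_inject[OF M H c])
  let ?\<alpha> = "\<lambda>X\<in>tangent_space M p. a \<bullet> inv_into (model_space M) (coord_vec M c p) X"
  have \<alpha>: "?\<alpha> (coord_vec M c p v) = a \<bullet> v" if "v \<in> model_space M" for v
    using coord_vec_in_tangent_space[OF c that] inv_into_f_f[OF inj that] by simp
  have "?\<alpha> \<in> cotangent_space M p"
    unfolding cotangent_space_def
  proof (intro CollectI conjI ballI allI)
    fix X Y r s assume "X \<in> tangent_space M p" "Y \<in> tangent_space M p"
    then obtain v w where v: "v \<in> model_space M" "X = coord_vec M c p v" and w: "w \<in> model_space M" "Y = coord_vec M c p w"
      unfolding tangent_space_eq[OF M c] by blast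
    have "r *\<^sub>R v + s *\<^sub>R w \<in> model_space M" using v w by (intro span_add span_scale)
    then show "?\<alpha> (\<lambda>h\<in>smooth_funs M. r * X h + s * Y h) = r * ?\<alpha> X + s * ?\<alpha> Y"
      unfolding v(2) w(2) coord_vec_linear_combination[OF M c v(1) w(1), symmetric]
      using \<alpha> v w by (simp only: \<alpha> inner_add_right inner_scaleR_right)
  qed simp
  moreover have "covec_coords M c p ?\<alpha> = coord_proj (model_basis M) a"
    unfolding covec_coords_def coord_proj_def by (intro sum.cong refl) (simp only: \<alpha>[OF span_base])
  ultimately show thesis
    using that coord_proj_span[OF premanifold_model_basis[OF M] a] by simp
qed

text \<open>Components of covectors transform by the transposed Jacobian of the opposite transition,
  from \<open>d\<close> to \<open>c\<close>. The formula is smooth jointly in base point and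
  covector, which makes the bundle charts compatible.\<close>

lemma covec_coords_change_chart:
  assumes \<alpha>: "\<alpha> \<in> cotangent_space M p" and c: "c \<in> atlas M" "p \<in> fst c" and d: "d \<in> atlas M" "p \<in> fst d"
  shows "covec_coords M d p \<alpha> =
    (\<Sum>b\<in>model_basis M. (covec_coords M c p \<alpha> \<bullet> dir_deriv (\<lambda>y. snd c (chart_inv d y)) (snd d p) b) *\<^sub>R b)"
  unfolding covec_coords_def[of M d]
  using covector_coord_vec[OF \<alpha> c] coord_vec_change_chart[OF M d c]
  by (intro sum.cong) (simp_all add: span_base)

abbreviation (input) cotangent_chart :: "('a, 'e) chart \<Rightarrow> ('a \<times> ('a tvec \<Rightarrow> real), 'e \<times> 'e) chart" where
  "cotangent_chart c \<equiv> (Sigma (fst c) (cotangent_space M), \<lambda>(p, \<alpha>). (snd c p, covec_coords M c p \<alpha>))"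

lemma points_cotangent_bundle[simp]: "points (cotangent_bundle M) = Sigma (points M) (cotangent_space M)"
  by (simp add: cotangent_bundle_def)

lemma atlas_cotangent_bundle: "e \<in> atlas (cotangent_bundle M) \<longleftrightarrow> (\<exists>c\<in>atlas M. e = cotangent_chart c)"
  unfolding cotangent_bundle_def mfd.select_convs mem_Collect_eq by blast

lemma model_space_cotangent_bundle: "model_space (cotangent_bundle M) = model_space M \<times> model_space M"
  by (simp add: cotangent_bundle_def span_prod_basis premanifold_model_basis[OF M])

lemma cotangent_chart_image:
  assumes c: "c \<in> atlas M" and A: "A \<subseteq> fst c"
  shows "snd (cotangent_chart c) ` Sigma A (cotangent_space M) = (snd c ` A) \<times> model_space M"
proof (intro equalityI subsetI)
  fix z assume "z \<in> (snd c ` A) \<times> model_space M"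
  then obtain p where p: "p \<in> A" "fst z = snd c p" "snd z \<in> model_space M" by auto
  obtain \<alpha> where "\<alpha> \<in> cotangent_space M p" "covec_coords M c p \<alpha> = snd z"
    using covec_coords_surj[OF c _ p(3)] p(1) A by blast
  then show "z \<in> snd (cotangent_chart c) ` Sigma A (cotangent_space M)"
    using p by (intro image_eqI[of _ _ "(p, \<alpha>)"]) (auto simp: prod_eq_iff)
qed (auto simp: covec_coords_in_model_space)

lemma cotangent_chart_inj:
  assumes c: "c \<in> atlas M"
  shows "inj_on (snd (cotangent_chart c)) (fst (cotangent_chart c))"
proof (rule inj_onI, clarsimp)
  fix p \<alpha> q \<beta> assume *: "p \<in> fst c" "\<alpha> \<in> cotangent_space M p" "q \<in> fst c" "\<beta> \<in> cotangent_space M q"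
    "snd c p = snd c q" "covec_coords M c p \<alpha> = covec_coords M c q \<beta>"
  then have "p = q" using chart_inj[OF M c] by (auto dest: inj_onD)
  then show "p = q \<and> \<alpha> = \<beta>" using covec_coords_inject[OF _ _ c] * by blast
qed

lemma premanifold_cotangent_bundle: "premanifold (cotangent_bundle M)"
  unfolding premanifold_def model_space_cotangent_bundle
proof (intro conjI ballI)
  show "model_basis (cotangent_bundle M) \<subseteq> Basis"
    using premanifold_model_basis[OF M] by (auto simp: cotangent_bundle_def Basis_prod_def)
  show "\<Union> (fst ` atlas (cotangent_bundle M)) = points (cotangent_bundle M)"
  proof (intro equalityI subsetI)
    fix z assume "z \<in> \<Union> (fst ` atlas (cotangent_bundle M))"
    then obtain e where "e \<in> atlas (cotangent_bundle M)" "z \<in> fst e" by blast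
    then show "z \<in> points (cotangent_bundle M)"
      using chart_subset_points[OF M] by (fastforce simp: atlas_cotangent_bundle)
  next
    fix z assume z: "z \<in> points (cotangent_bundle M)"
    then have "fst z \<in> points M" by auto
    then obtain c where c: "c \<in> atlas M" "fst z \<in> fst c" using premanifold_chart_at[OF M] by blast
    have "cotangent_chart c \<in> atlas (cotangent_bundle M)" using c(1) atlas_cotangent_bundle by blast
    then show "z \<in> \<Union> (fst ` atlas (cotangent_bundle M))"
      by (rule UN_I) (use c z in auto)
  qed
next
  fix e assume "e \<in> atlas (cotangent_bundle M)"
  then obtain c where c: "c \<in> atlas M" and e: "e = cotangent_chart c" by (auto simp: atlas_cotangent_bundle)
  show inj: "inj_on (snd e) (fst e)" unfolding e by (rule cotangent_chart_inj[OF c])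
  show "openin (top_of_set (model_space M \<times> model_space M)) (snd e ` fst e)"
    unfolding e fst_conv cotangent_chart_image[OF c subset_refl]
    by (intro openin_Times chart_image_openin[OF M c] openin_subtopology_self)
  fix e' assume "e' \<in> atlas (cotangent_bundle M)"
  then obtain c' where c': "c' \<in> atlas M" and e': "e' = cotangent_chart c'" by (auto simp: atlas_cotangent_bundle)
  have ii: "fst e \<inter> fst e' = Sigma (fst c \<inter> fst c') (cotangent_space M)" by (auto simp: e e')
  have i: "snd e ` (fst e \<inter> fst e') = (snd c ` (fst c \<inter> fst c')) \<times> model_space M"
    unfolding ii unfolding e by (rule cotangent_chart_image[OF c]) simp
  show "openin (top_of_set (model_space M \<times> model_space M)) (snd e ` (fst e \<inter> fst e'))"
    unfolding i by (intro openin_Times transition_openin[OF M c c'] openin_subtopology_self)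
  let ?X = "(snd c ` (fst c \<inter> fst c')) \<times> model_space M"
  let ?\<tau> = "\<lambda>y. snd c' (chart_inv c y)"
  have \<tau>: "smooth_on ?X (\<lambda>y. ?\<tau> (fst y))"
    by (rule smooth_on_compose[OF smooth_on_fst[OF smooth_on_ident] transition_smooth[OF M c c']]) auto
  have "smooth_on ?X (\<lambda>y. dir_deriv (\<lambda>y. snd c (chart_inv c' y)) (?\<tau> (fst y)) b)" if "b \<in> model_basis M" for b
    by (rule smooth_on_compose[OF \<tau> smooth_on_dir_deriv[OF transition_openin[OF M c' c] transition_smooth[OF M c' c] span_base[OF that]]])
      (use chart_inv_chart[OF M c] in auto)
  then have "smooth_on ?X (\<lambda>y. (?\<tau> (fst y), \<Sum>b\<in>model_basis M.
      (snd y \<bullet> dir_deriv (\<lambda>y. snd c (chart_inv c' y)) (?\<tau> (fst y)) b) *\<^sub>R b))"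
    using finite_subset[OF premanifold_model_basis[OF M] finite_Basis]
    by (intro smooth_on_Pair \<tau> smooth_on_sum smooth_on_scaleR smooth_on_inner smooth_on_const
        smooth_on_snd smooth_on_ident)
  then show "smooth_on (snd e ` (fst e \<inter> fst e')) (snd e' \<circ> chart_inv e)"
    unfolding i[symmetric]
  proof (rule smooth_on_cong)
    fix y assume "y \<in> snd e ` (fst e \<inter> fst e')"
    then obtain p \<alpha> where p: "p \<in> fst c" "p \<in> fst c'" "\<alpha> \<in> cotangent_space M p" and y: "y = snd e (p, \<alpha>)"
      unfolding ii by auto
    have "chart_inv e y = (p, \<alpha>)" unfolding y by (rule inv_into_f_f[OF inj]) (use p e in auto)
    then show "(?\<tau> (fst y), \<Sum>b\<in>model_basis M.
      (snd y \<bullet> dir_deriv (\<lambda>y. snd c (chart_inv c' y)) (?\<tau> (fst y)) b) *\<^sub>R b) = (snd e' \<circ> chart_inv e) y"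
      using p covec_coords_change_chart[OF p(3) c p(1) c' p(2)] chart_inv_chart[OF M c]
      by (simp add: e' y) (simp add: e)
  qed
qed

lemma openin_cotangent_bundle_Sigma:
  assumes U: "openin (mtop M) U"
  shows "openin (mtop (cotangent_bundle M)) (Sigma U (cotangent_space M))"
  unfolding openin_mtop[OF premanifold_cotangent_bundle] model_space_cotangent_bundle
proof (intro conjI ballI)
  show "Sigma U (cotangent_space M) \<subseteq> points (cotangent_bundle M)" using U openin_mtop[OF M] by auto
  fix e assume "e \<in> atlas (cotangent_bundle M)"
  then obtain c where c: "c \<in> atlas M" and e: "e = cotangent_chart c" by (auto simp: atlas_cotangent_bundle)
  have i: "Sigma U (cotangent_space M) \<inter> fst e = Sigma (U \<inter> fst c) (cotangent_space M)" by (auto simp: e)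
  show "openin (top_of_set (model_space M \<times> model_space M)) (snd e ` (Sigma U (cotangent_space M) \<inter> fst e))"
    unfolding i unfolding e cotangent_chart_image[OF c Int_lower2]
    by (intro openin_Times openin_chart_image[OF M U c] openin_subtopology_self)
qed

lemma continuous_map_cotangent_bundle_fst: "continuous_map (mtop (cotangent_bundle M)) (mtop M) fst"
  unfolding continuous_map_def topspace_mtop[OF premanifold_cotangent_bundle] topspace_mtop[OF M]
proof (intro conjI allI impI)
  fix U assume U: "openin (mtop M) U"
  then have "U \<subseteq> points M" using openin_mtop[OF M] by auto
  then have "{z \<in> points (cotangent_bundle M). fst z \<in> U} = Sigma U (cotangent_space M)" by auto
  then show "openin (mtop (cotangent_bundle M)) {z \<in> points (cotangent_bundle M). fst z \<in> U}"
    using openin_cotangent_bundle_Sigma[OF U] by simp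
qed auto

text \<open>Covectors at the same point lie in one bundle chart; covectors at different points are
  separated by the parts of the bundle over disjoint open sets.\<close>

lemma Hausdorff_cotangent_bundle: "Hausdorff_space (mtop (cotangent_bundle M))"
proof (rule Hausdorff_mtopI[OF premanifold_cotangent_bundle])
  let ?S = "\<lambda>U. Sigma U (cotangent_space M)"
  note S = openin_cotangent_bundle_Sigma
  fix x y assume x: "x \<in> points (cotangent_bundle M)" and y: "y \<in> points (cotangent_bundle M)" and "x \<noteq> y"
  show "(\<exists>c\<in>atlas (cotangent_bundle M). x \<in> fst c \<and> y \<in> fst c) \<or>
    (\<exists>U V. openin (mtop (cotangent_bundle M)) U \<and> openin (mtop (cotangent_bundle M)) V \<and> x \<in> U \<and> y \<in> V \<and> disjnt U V)"
  proof (cases "fst x = fst y")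
    case True
    have "fst x \<in> points M" using x by auto
    then obtain c where c: "c \<in> atlas M" "fst x \<in> fst c" using premanifold_chart_at[OF M] by blast
    have "cotangent_chart c \<in> atlas (cotangent_bundle M)" using c atlas_cotangent_bundle by blast
    moreover have "x \<in> fst (cotangent_chart c)" "y \<in> fst (cotangent_chart c)"
      using x y c True by auto
    ultimately show ?thesis by blast
  next
    case False
    then obtain U V where UV: "openin (mtop M) U" "openin (mtop M) V" "fst x \<in> U" "fst y \<in> V" "disjnt U V"
      using H x y topspace_mtop[OF M] unfolding Hausdorff_space_def by (metis SigmaE fst_conv points_cotangent_bundle)
    then have "x \<in> ?S U" "y \<in> ?S V" "disjnt (?S U) (?S V)" using x y by (auto simp: disjnt_def)
    then show ?thesis using S[OF UV(1)] S[OF UV(2)] by blast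
  qed
qed

section \<open>A single cotangent space as a manifold\<close>

context
  fixes p assumes p: "p \<in> points M"
begin

lemma points_cotangent_space_mfd[simp]: "points (cotangent_space_mfd M p) = cotangent_space M p"
  by (simp add: cotangent_space_mfd_def)

lemma atlas_cotangent_space_mfd:
  "e \<in> atlas (cotangent_space_mfd M p) \<longleftrightarrow> (\<exists>c\<in>atlas M. p \<in> fst c \<and> e = (cotangent_space M p, covec_coords M c p))"
  unfolding cotangent_space_mfd_def mfd.select_convs mem_Collect_eq by blast

lemma model_space_cotangent_space_mfd: "model_space (cotangent_space_mfd M p) = model_space M"
  by (simp add: cotangent_space_mfd_def)

lemma covec_coords_image:
  assumes c: "c \<in> atlas M" "p \<in> fst c"
  shows "covec_coords M c p ` cotangent_space M p = model_space M"
proof (intro equalityI subsetI)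
  fix a assume "a \<in> model_space M"
  then obtain \<alpha> where "\<alpha> \<in> cotangent_space M p" "covec_coords M c p \<alpha> = a" by (rule covec_coords_surj[OF c])
  then show "a \<in> covec_coords M c p ` cotangent_space M p" by blast
qed (auto simp: covec_coords_in_model_space)

lemma premanifold_cotangent_space_mfd: "premanifold (cotangent_space_mfd M p)"
  unfolding premanifold_def model_space_cotangent_space_mfd
proof (intro conjI ballI)
  show "model_basis (cotangent_space_mfd M p) \<subseteq> Basis"
    using premanifold_model_basis[OF M] by (simp add: cotangent_space_mfd_def)
  obtain c where "c \<in> atlas M" "p \<in> fst c" using premanifold_chart_at[OF M p] .
  then have "(cotangent_space M p, covec_coords M c p) \<in> atlas (cotangent_space_mfd M p)"
    using atlas_cotangent_space_mfd by blast
  moreover have "fst e = cotangent_space M p" if "e \<in> atlas (cotangent_space_mfd M p)" for e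
    using that by (auto simp: atlas_cotangent_space_mfd)
  ultimately show "\<Union> (fst ` atlas (cotangent_space_mfd M p)) = points (cotangent_space_mfd M p)"
    unfolding points_cotangent_space_mfd by (intro SUP_eq_const) auto
next
  fix e assume "e \<in> atlas (cotangent_space_mfd M p)"
  then obtain c where c: "c \<in> atlas M" "p \<in> fst c" and e: "e = (cotangent_space M p, covec_coords M c p)"
    by (auto simp: atlas_cotangent_space_mfd)
  show inj: "inj_on (snd e) (fst e)" unfolding e by (auto intro: inj_onI covec_coords_inject[OF _ _ c])
  show "openin (top_of_set (model_space M)) (snd e ` fst e)"
    by (simp add: e covec_coords_image[OF c])
  fix e' assume "e' \<in> atlas (cotangent_space_mfd M p)"
  then obtain c' where c': "c' \<in> atlas M" "p \<in> fst c'" and e': "e' = (cotangent_space M p, covec_coords M c' p)"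
    by (auto simp: atlas_cotangent_space_mfd)
  show "openin (top_of_set (model_space M)) (snd e ` (fst e \<inter> fst e'))"
    by (simp add: e e' covec_coords_image[OF c])
  have "smooth_on (snd e ` (fst e \<inter> fst e')) (\<lambda>a. \<Sum>b\<in>model_basis M.
      (a \<bullet> dir_deriv (\<lambda>y. snd c (chart_inv c' y)) (snd c' p) b) *\<^sub>R b)"
    using finite_subset[OF premanifold_model_basis[OF M] finite_Basis]
    by (intro smooth_on_sum smooth_on_scaleR smooth_on_inner smooth_on_const smooth_on_ident)
  then show "smooth_on (snd e ` (fst e \<inter> fst e')) (snd e' \<circ> chart_inv e)"
  proof (rule smooth_on_cong)
    fix y assume "y \<in> snd e ` (fst e \<inter> fst e')"
    then obtain \<alpha> where \<alpha>: "\<alpha> \<in> cotangent_space M p" and y: "y = snd e \<alpha>" by (auto simp: e e')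
    have "chart_inv e y = \<alpha>" unfolding y by (rule inv_into_f_f[OF inj]) (use \<alpha> e in auto)
    then show "(\<Sum>b\<in>model_basis M. (y \<bullet> dir_deriv (\<lambda>y. snd c (chart_inv c' y)) (snd c' p) b) *\<^sub>R b) = (snd e' \<circ> chart_inv e) y"
      using covec_coords_change_chart[OF \<alpha> c c'] by (simp add: e' y) (simp add: e)
  qed
qed

lemma Hausdorff_cotangent_space_mfd: "Hausdorff_space (mtop (cotangent_space_mfd M p))"
proof (rule Hausdorff_mtopI[OF premanifold_cotangent_space_mfd], rule disjI1)
  obtain c where "c \<in> atlas M" "p \<in> fst c" using premanifold_chart_at[OF M p] .
  then have "(cotangent_space M p, covec_coords M c p) \<in> atlas (cotangent_space_mfd M p)"
    using atlas_cotangent_space_mfd by blast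
  then show "\<exists>c\<in>atlas (cotangent_space_mfd M p). x \<in> fst c \<and> y \<in> fst c"
    if "x \<in> points (cotangent_space_mfd M p)" "y \<in> points (cotangent_space_mfd M p)" for x y
    using that by (intro bexI) auto
qed

text \<open>The fibre has its own charts, but each of its open sets is the trace of an open set of
  the bundle, namely the product of the model space with its coordinate image. For the fibre over
  the unit of the group this gives continuity of the body momentum.\<close>

lemma continuous_map_into_fiber:
  assumes g: "continuous_map X (mtop (cotangent_bundle M)) g" and gp: "\<And>x. x \<in> topspace X \<Longrightarrow> fst (g x) = p"
  shows "continuous_map X (mtop (cotangent_space_mfd M p)) (\<lambda>x. snd (g x))"
  unfolding continuous_map_def topspace_mtop[OF premanifold_cotangent_space_mfd]
proof (intro conjI allI impI)
  have gT: "g x \<in> Sigma (points M) (cotangent_space M)" if "x \<in> topspace X" for x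
    using g that topspace_mtop[OF premanifold_cotangent_bundle] by (auto simp: continuous_map_def)
  have gin: "snd (g x) \<in> cotangent_space M p" if "x \<in> topspace X" for x
    using gT[OF that] gp[OF that] by auto
  then show "(\<lambda>x. snd (g x)) \<in> topspace X \<rightarrow> points (cotangent_space_mfd M p)" by simp
  fix U assume U: "openin (mtop (cotangent_space_mfd M p)) U"
  obtain c where c: "c \<in> atlas M" "p \<in> fst c" using premanifold_chart_at[OF M p] .
  have e: "(cotangent_space M p, covec_coords M c p) \<in> atlas (cotangent_space_mfd M p)"
    using atlas_cotangent_space_mfd c by blast
  have Usub: "U \<subseteq> cotangent_space M p" using U openin_mtop[OF premanifold_cotangent_space_mfd] by auto
  have "openin (top_of_set (model_space M)) (covec_coords M c p ` (U \<inter> cotangent_space M p))"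
    using openin_chart_image[OF premanifold_cotangent_space_mfd U e] by (simp add: model_space_cotangent_space_mfd)
  then have "openin (top_of_set (model_space M \<times> model_space M)) (model_space M \<times> covec_coords M c p ` (U \<inter> cotangent_space M p))"
    by (intro openin_Times openin_subtopology_self)
  moreover have "cotangent_chart c \<in> atlas (cotangent_bundle M)" using c atlas_cotangent_bundle by blast
  ultimately have o: "openin (mtop (cotangent_bundle M)) {z \<in> fst (cotangent_chart c). snd (cotangent_chart c) z \<in>
      model_space M \<times> covec_coords M c p ` (U \<inter> cotangent_space M p)}"
    using openin_chart_vimage[OF premanifold_cotangent_bundle] by (simp only: model_space_cotangent_bundle)
  have "{x \<in> topspace X. snd (g x) \<in> U} = {x \<in> topspace X. g x \<in> {z \<in> fst (cotangent_chart c). snd (cotangent_chart c) z \<in>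
      model_space M \<times> covec_coords M c p ` (U \<inter> cotangent_space M p)}}" (is "_ = {x \<in> topspace X. g x \<in> ?V}")
  proof -
    have *: "snd (g x) \<in> U \<longleftrightarrow> g x \<in> ?V" if x: "x \<in> topspace X" for x
    proof -
      obtain \<alpha> where gx: "g x = (p, \<alpha>)" "\<alpha> \<in> cotangent_space M p"
        using gp[OF x] gin[OF x] by (cases "g x") auto
      have "snd c p \<in> model_space M" using chart_image_subset[OF M c(1)] c(2) by blast
      moreover have "covec_coords M c p \<alpha> \<in> covec_coords M c p ` (U \<inter> cotangent_space M p) \<longleftrightarrow> \<alpha> \<in> U"
      proof
        assume "covec_coords M c p \<alpha> \<in> covec_coords M c p ` (U \<inter> cotangent_space M p)"
        then obtain \<beta> where \<beta>: "covec_coords M c p \<alpha> = covec_coords M c p \<beta>" "\<beta> \<in> U \<inter> cotangent_space M p"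
          by (rule imageE)
        have "\<alpha> = \<beta>" by (rule covec_coords_inject[OF gx(2) _ c \<beta>(1)]) (use \<beta>(2) in simp)
        then show "\<alpha> \<in> U" using \<beta>(2) by simp
      qed (use gx(2) in simp)
      ultimately show ?thesis
        by (simp only: gx mem_Collect_eq fst_conv snd_conv mem_Sigma_iff mem_Times_iff prod.case c simp_thms)
    qed
    show ?thesis by (rule Collect_cong, rule conj_cong[OF refl *])
  qed
  then show "openin X {x \<in> topspace X. snd (g x) \<in> U}"
    using openin_continuous_map_preimage[OF g o] by (simp only:)
qed

end

end

section \<open>Lebesgue measure on coordinate subspaces\<close>

text \<open>Lebesgue measure on the span of \<open>B\<close> is made accessible to the full-dimensional change of variables
  theorem by taking the product with the unit cube in the remaining directions.\<close>

definition complement_cube :: "'e::euclidean_space set \<Rightarrow> 'e set" where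
  "complement_cube B = {y. \<forall>b\<in>Basis - B. 0 \<le> y \<bullet> b \<and> y \<bullet> b \<le> 1}"

lemma borel_complement_cube[measurable]: "complement_cube B \<in> sets borel"
proof -
  have "complement_cube B = (\<Inter>b\<in>Basis - B. {y. 0 \<le> y \<bullet> b} \<inter> {y. y \<bullet> b \<le> 1})"
    by (auto simp: complement_cube_def)
  then have "closed (complement_cube B)"
    by (auto intro!: closed_INT closed_Collect_le continuous_intros)
  then show ?thesis by simp
qed

lemma borel_measurable_coord_proj[measurable]: "coord_proj B \<in> borel_measurable borel"
  by (intro borel_measurable_continuous_onI linear_continuous_on bounded_linear_coord_proj)

lemma sets_lborel_span[measurable_cong, simp]: "sets (lborel_span B) = sets borel"
  and space_lborel_span[simp]: "space (lborel_span B) = UNIV"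
  by (simp_all add: lborel_span_def)

text \<open>Fubini for the splitting of \<open>Basis\<close> into \<open>B\<close> and the rest: the
  remaining coordinates integrate the unit cube to 1.\<close>

lemma nn_integral_lborel_span:
  fixes f :: "'e::euclidean_space \<Rightarrow> ennreal"
  assumes B: "B \<subseteq> Basis" and f[measurable]: "f \<in> borel_measurable borel"
  shows "(\<integral>\<^sup>+ y. f y \<partial>lborel_span B) = (\<integral>\<^sup>+ y. f (coord_proj B y) * indicator (complement_cube B) y \<partial>lborel)"
proof -
  interpret product_sigma_finite "\<lambda>_::'e. lborel :: real measure" ..
  let ?J = "Basis - B" and ?s = "\<lambda>x. \<Sum>b\<in>Basis. x b *\<^sub>R b :: 'e"
  let ?g = "\<lambda>y. f (coord_proj B y) * indicator (complement_cube B) y"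
  have finB: "finite B" using B finite_subset finite_Basis by blast
  have [measurable]: "?s \<in> borel_measurable (\<Pi>\<^sub>M b\<in>Basis. lborel)"
    "(\<lambda>x. \<Sum>b\<in>B. x b *\<^sub>R b) \<in> borel_measurable (\<Pi>\<^sub>M b\<in>B. lborel)"
    by simp_all
  have inner: "?s x \<bullet> b = x b" if "b \<in> Basis" for x b
    using that by (simp add: inner_sum_left inner_Basis if_distrib sum.delta cong: if_cong)
  have eq: "?g (?s (merge B ?J (x, y))) = f (\<Sum>b\<in>B. x b *\<^sub>R b) * (\<Prod>b\<in>?J. indicator {0..1::real} (y b))" for x y
  proof -
    let ?m = "merge B ?J (x, y)"
    have "coord_proj B (?s ?m) = (\<Sum>b\<in>B. x b *\<^sub>R b)"
      unfolding coord_proj_def by (intro sum.cong) (use B inner in \<open>auto simp: merge_def subset_iff\<close>)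
    moreover have "indicator (complement_cube B) (?s ?m) = (\<Prod>b\<in>?J. indicator {0..1::real} (y b) :: ennreal)"
    proof (cases "\<forall>b\<in>?J. y b \<in> {0..1}")
      case True
      then have "?s ?m \<in> complement_cube B" using inner by (auto simp: complement_cube_def merge_def)
      then show ?thesis using True by simp
    next
      case False
      then obtain b where b: "b \<in> ?J" "y b \<notin> {0..1}" by blast
      then have "?s ?m \<notin> complement_cube B" using inner[of b ?m] by (auto simp: complement_cube_def merge_def)
      moreover have "(\<Prod>b\<in>?J. indicator {0..1::real} (y b) :: ennreal) = 0"
        by (rule prod_zero) (use b in \<open>auto intro!: bexI[of _ b]\<close>)
      ultimately show ?thesis by simp
    qed
    ultimately show ?thesis by simp
  qed
  have 1: "(\<integral>\<^sup>+ y. (\<Prod>b\<in>?J. indicator {0..1::real} (y b) :: ennreal) \<partial>(\<Pi>\<^sub>M b\<in>?J. lborel)) = 1"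
    using product_nn_integral_prod[of ?J "\<lambda>_. indicator {0..1::real}"] by simp
  have BJ: "B \<union> ?J = Basis" using B by auto
  have "(\<integral>\<^sup>+ y. ?g y \<partial>lborel) = (\<integral>\<^sup>+ x. ?g (?s x) \<partial>(\<Pi>\<^sub>M b\<in>Basis. lborel))"
    by (subst lborel_eq, subst nn_integral_distr) simp_all
  also have "\<dots> = (\<integral>\<^sup>+ x. (\<integral>\<^sup>+ y. ?g (?s (merge B ?J (x, y))) \<partial>(\<Pi>\<^sub>M b\<in>?J. lborel)) \<partial>(\<Pi>\<^sub>M b\<in>B. lborel))"
    using product_nn_integral_fold[of B ?J "\<lambda>x. ?g (?s x)", unfolded BJ] finB by simp
  also have "\<dots> = (\<integral>\<^sup>+ x. f (\<Sum>b\<in>B. x b *\<^sub>R b) \<partial>(\<Pi>\<^sub>M b\<in>B. lborel))"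
    unfolding eq by (subst nn_integral_cmult) (simp_all add: 1)
  also have "\<dots> = (\<integral>\<^sup>+ y. f y \<partial>lborel_span B)"
    unfolding lborel_span_def by (subst nn_integral_distr) simp_all
  finally show ?thesis ..
qed

lemma emeasure_lborel_span:
  assumes B: "B \<subseteq> Basis" and A[measurable]: "A \<in> sets borel"
  shows "emeasure (lborel_span B) A = emeasure lborel {y \<in> complement_cube B. coord_proj B y \<in> A}"
proof -
  have "emeasure (lborel_span B) A = (\<integral>\<^sup>+ y. indicator A y \<partial>lborel_span B)" by simp
  also have "\<dots> = (\<integral>\<^sup>+ y. indicator A (coord_proj B y) * indicator (complement_cube B) y \<partial>lborel)"
    by (rule nn_integral_lborel_span[OF B]) simp
  also have "\<dots> = (\<integral>\<^sup>+ y. indicator {y \<in> complement_cube B. coord_proj B y \<in> A} y \<partial>lborel)"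
    by (intro nn_integral_cong) (auto split: split_indicator)
  also have "\<dots> = emeasure lborel {y \<in> complement_cube B. coord_proj B y \<in> A}"
    by (rule nn_integral_indicator) simp
  finally show ?thesis .
qed

lemma emeasure_lborel_span_ball_finite:
  fixes x :: "'e::euclidean_space"
  assumes B: "B \<subseteq> Basis"
  shows "emeasure (lborel_span B) (ball x r) < \<infinity>"
proof -
  have "bounded {y \<in> complement_cube B. coord_proj B y \<in> ball x r}"
  proof (rule bounded_subset[OF bounded_cbox])
    let ?l = "\<Sum>b\<in>Basis. (- (norm x + \<bar>r\<bar>)) *\<^sub>R b :: 'e" and ?u = "\<Sum>b\<in>Basis. (norm x + \<bar>r\<bar> + 1) *\<^sub>R b :: 'e"
    show "{y \<in> complement_cube B. coord_proj B y \<in> ball x r} \<subseteq> cbox ?l ?u"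
    proof (clarsimp simp: mem_box)
      fix y b :: 'e assume y: "y \<in> complement_cube B" "dist x (coord_proj B y) < r" and b: "b \<in> Basis"
      show "- norm x - \<bar>r\<bar> \<le> y \<bullet> b \<and> y \<bullet> b \<le> norm x + \<bar>r\<bar> + 1"
      proof (cases "b \<in> B")
        case True
        then have "\<bar>y \<bullet> b\<bar> \<le> norm (coord_proj B y)"
          using Basis_le_norm[OF b, of "coord_proj B y"] coord_proj_inner[OF B b, of y] by simp
        also have "\<dots> \<le> norm x + dist x (coord_proj B y)"
          using norm_triangle_ineq2[of "coord_proj B y" x] by (simp add: dist_norm norm_minus_commute)
        finally show ?thesis using y by linarith
      next
        case False
        then have "0 \<le> y \<bullet> b" "y \<bullet> b \<le> 1" using y(1) b by (auto simp: complement_cube_def)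
        moreover have "0 \<le> norm x" by simp
        ultimately show ?thesis by linarith
      qed
    qed
  qed
  then show ?thesis
    using emeasure_bounded_finite by (simp add: emeasure_lborel_span[OF B])
qed

lemma emeasure_lborel_span_pos:
  fixes x :: "'e::euclidean_space"
  assumes B: "B \<subseteq> Basis" and X: "openin (top_of_set (span B)) X" and x: "x \<in> X" and [measurable]: "X \<in> sets borel"
  shows "emeasure (lborel_span B) X > 0"
proof -
  obtain T where T: "open T" "X = span B \<inter> T" using X by (meson openin_open)
  \<comment> \<open>Replacing the closed cube by its interior gives an open set. The point
    \<open>x\<close>, moved to the centre of the cube by the coordinates 1/2, shows that it is
    nonempty.\<close>
  let ?W = "(coord_proj B -` T) \<inter> (\<Inter>b\<in>Basis - B. {y. 0 < y \<bullet> b} \<inter> {y. y \<bullet> b < 1})"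
  have "open ?W"
    by (intro open_Int open_INT open_vimage[OF T(1) linear_continuous_on[OF bounded_linear_coord_proj]]
        ballI open_Collect_less continuous_intros) simp
  moreover have "x + (\<Sum>b\<in>Basis - B. (1/2) *\<^sub>R b) \<in> ?W"
  proof -
    let ?c = "\<Sum>b\<in>Basis - B. (1/2) *\<^sub>R b :: 'e"
    have xB: "x \<in> span B" using x T by auto
    have c: "?c \<bullet> b = (if b \<in> B then 0 else 1/2)" if "b \<in> Basis" for b
    proof -
      have "?c \<bullet> b = (\<Sum>b'\<in>Basis - B. if b' = b then 1/2 else 0)"
        unfolding inner_sum_left by (intro sum.cong) (use that in \<open>auto simp: inner_Basis\<close>)
      then show ?thesis using that by simp
    qed
    have "coord_proj B (x + ?c) = x"
    proof (rule euclidean_eqI)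
      fix b :: 'e assume b: "b \<in> Basis"
      then show "coord_proj B (x + ?c) \<bullet> b = x \<bullet> b"
        using coord_proj_inner[OF B b] c[OF b] coord_proj_span[OF B xB] by (metis add.right_neutral inner_add_left)
    qed
    moreover have "x \<bullet> b = 0" if "b \<in> Basis - B" for b
      using coord_proj_inner[OF B, of b x] coord_proj_span[OF B xB] that by auto
    ultimately show ?thesis
      using x T by (auto simp: inner_add_left c)
  qed
  ultimately have W: "open ?W" "\<not> negligible ?W" using open_not_negligible[of ?W] by blast+
  have "emeasure lborel ?W > 0"
  proof (rule ccontr)
    assume "\<not> emeasure lborel ?W > 0"
    then have "?W \<in> null_sets lborel" using borel_open[OF W(1)] by (simp add: null_sets_def)
    then show False using W(2) null_sets_completionI negligible_iff_null_sets by blast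
  qed
  also have "emeasure lborel ?W \<le> emeasure lborel {y \<in> complement_cube B. coord_proj B y \<in> X}"
  proof (rule emeasure_mono)
    show "{y \<in> complement_cube B. coord_proj B y \<in> X} \<in> sets lborel" by measurable
  qed (use coord_proj_in_span in \<open>auto simp: complement_cube_def T(2) intro: less_imp_le\<close>)
  finally show ?thesis by (simp add: emeasure_lborel_span[OF B])
qed

text \<open>This identifies the Leibniz sum in \<open>abs_jacobian\<close> with an ordinary
  determinant. After transposition the rows with index outside \<open>I\<close> are those of the
  identity matrix, so only permutations fixing all these indices contribute.\<close>

lemma det_span_extension:
  fixes H :: "real^'n \<Rightarrow> real^'n"
  assumes B: "B \<subseteq> Basis" and H: "\<And>v. v \<in> span B \<Longrightarrow> H v \<in> span B" and H0: "H 0 = 0"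
  shows "det (matrix (\<lambda>w. H (coord_proj B w) + (w - coord_proj B w))) =
    (\<Sum>\<pi> | \<pi> permutes B. of_int (sign \<pi>) * (\<Prod>b\<in>B. H b \<bullet> \<pi> b))"
proof -
  let ?G = "\<lambda>w. H (coord_proj B w) + (w - coord_proj B w)" and ?e = "\<lambda>i::'n. axis i (1::real)"
  let ?A = "\<lambda>i j. ?G (?e i) \<bullet> ?e j"
  define I where "I = {i. ?e i \<in> B}"
  have e: "?e i \<in> Basis" for i by (simp add: axis_in_Basis_iff)
  have inj: "inj_on ?e I" by (auto simp: inj_on_def axis_eq_axis)
  have eI: "?e ` I = B"
  proof
    show "B \<subseteq> ?e ` I"
    proof
      fix b assume b: "b \<in> B"
      then obtain i where "b = ?e i" using B by (auto simp: Basis_vec_def)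
      then show "b \<in> ?e ` I" using b by (auto simp: I_def)
    qed
  qed (auto simp: I_def)
  have bij: "bij_betw ?e I B" using inj eI by (simp add: bij_betw_def)
  have GI: "?G (?e i) = H (?e i)" if "i \<in> I" for i
    using that coord_proj_span[OF B span_base] by (simp add: I_def)
  have GnI: "?A i j = (if i = j then 1 else 0)" if "i \<notin> I" for i j
  proof -
    have "coord_proj B (?e i) = 0"
      by (rule euclidean_eqI, subst coord_proj_inner[OF B])
        (use that e in \<open>auto simp: I_def inner_Basis\<close>)
    then show ?thesis by (simp add: H0 inner_axis_axis)
  qed
  have "det (matrix ?G) = det (transpose (matrix ?G))" by (simp add: det_transpose)
  also have "\<dots> = (\<Sum>p | p permutes UNIV. of_int (sign p) * (\<Prod>i\<in>UNIV. ?A i (p i)))"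
    unfolding det_def by (simp add: transpose_def matrix_def inner_axis)
  also have "\<dots> = (\<Sum>p | p permutes I. of_int (sign p) * (\<Prod>i\<in>UNIV. ?A i (p i)))"
  proof (rule sum.mono_neutral_right)
    show "finite {p::'n \<Rightarrow> 'n. p permutes UNIV}" by (simp add: finite_permutations)
    show "{p. p permutes I} \<subseteq> {p. p permutes UNIV}" using permutes_subset by blast
    show "\<forall>p\<in>{p. p permutes UNIV} - {p. p permutes I}. of_int (sign p) * (\<Prod>i\<in>UNIV. ?A i (p i)) = 0"
    proof
      fix p assume p: "p \<in> {p. p permutes UNIV} - {p. p permutes I}"
      then have "\<exists>i. i \<notin> I \<and> p i \<noteq> i" using permutes_superset[of p UNIV I] by auto
      then obtain i where "i \<notin> I" "p i \<noteq> i" by blast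
      then have "?A i (p i) = 0" using GnI[of i "p i"] by simp
      then have "(\<Prod>i\<in>UNIV. ?A i (p i)) = 0" by (intro prod_zero bexI[of _ i]) simp_all
      then show "of_int (sign p) * (\<Prod>i\<in>UNIV. ?A i (p i)) = 0" by simp
    qed
  qed
  also have "\<dots> = (\<Sum>p | p permutes I. of_int (sign p) * (\<Prod>i\<in>I. H (?e i) \<bullet> ?e (p i)))"
  proof (intro sum.cong refl arg_cong2[of _ _ _ _ "(*)"])
    fix p assume "p \<in> {p. p permutes I}"
    then have p: "p permutes I" by simp
    have "(\<Prod>i\<in>UNIV. ?A i (p i)) = (\<Prod>i\<in>I. ?A i (p i))"
      by (rule prod.mono_neutral_right) (use GnI permutes_not_in[OF p] in auto)
    also have "\<dots> = (\<Prod>i\<in>I. H (?e i) \<bullet> ?e (p i))" by (intro prod.cong) (simp_all add: GI)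
    finally show "(\<Prod>i\<in>UNIV. ?A i (p i)) = (\<Prod>i\<in>I. H (?e i) \<bullet> ?e (p i))" .
  qed
  \<comment> \<open>Conjugation with \<open>axis\<close> turns permutations of the index set
    \<open>I\<close> into permutations of the basis vectors in \<open>B\<close> and keeps the
    sign.\<close>
  also have "\<dots> = (\<Sum>\<pi> | \<pi> permutes B. of_int (sign \<pi>) * (\<Prod>b\<in>B. H b \<bullet> \<pi> b))"
  proof (rule sum.reindex_bij_witness[where j = "map_permutation I ?e" and i = "map_permutation B (inv_into I ?e)"])
    fix p assume "p \<in> {p. p permutes I}"
    then have p: "p permutes I" by simp
    show "map_permutation B (inv_into I ?e) (map_permutation I ?e p) = p"
      by (rule map_permutation_compose_inv[OF bij p]) (rule inv_into_f_f[OF inj])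
    show "map_permutation I ?e p \<in> {\<pi>. \<pi> permutes B}"
      using map_permutation_permutes[OF bij p] by simp
    have "(\<Prod>b\<in>B. H b \<bullet> map_permutation I ?e p b) = (\<Prod>i\<in>I. H (?e i) \<bullet> map_permutation I ?e p (?e i))"
      using prod.reindex[OF inj, of "\<lambda>b. H b \<bullet> map_permutation I ?e p b"] by (simp add: eI)
    also have "\<dots> = (\<Prod>i\<in>I. H (?e i) \<bullet> ?e (p i))"
      by (intro prod.cong refl) (simp add: map_permutation_apply[OF inj])
    finally show "of_int (sign (map_permutation I ?e p)) * (\<Prod>b\<in>B. H b \<bullet> map_permutation I ?e p b) =
        of_int (sign p) * (\<Prod>i\<in>I. H (?e i) \<bullet> ?e (p i))"
      by (simp add: sign_map_permutation[OF inj p])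
  next
    fix \<pi> assume "\<pi> \<in> {\<pi>. \<pi> permutes B}"
    then have \<pi>: "\<pi> permutes B" by simp
    have bij': "bij_betw (inv_into I ?e) B I" using bij by (rule bij_betw_inv_into)
    show "map_permutation I ?e (map_permutation B (inv_into I ?e) \<pi>) = \<pi>"
      by (rule map_permutation_compose_inv[OF bij' \<pi>]) (use eI inv_into_f_f[OF inj] in auto)
    show "map_permutation B (inv_into I ?e) \<pi> \<in> {p. p permutes I}"
      using map_permutation_permutes[OF bij' \<pi>] by simp
  qed
  finally show ?thesis .
qed

section \<open>Change of variables on coordinate subspaces\<close>

lemma nn_integral_eq_absolute_integral:
  fixes w :: "'e::euclidean_space \<Rightarrow> real"
  assumes "S \<in> sets borel" and m: "(\<lambda>x. indicator S x * w x) \<in> borel_measurable borel"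
    and w: "\<And>x. x \<in> S \<Longrightarrow> w x \<ge> 0"
  shows "(\<integral>\<^sup>+ x. ennreal (indicator S x * w x) \<partial>lborel) =
    (if w absolutely_integrable_on S then ennreal (integral S w) else \<infinity>)"
proof (cases "w absolutely_integrable_on S")
  case True
  then have "integrable lborel (\<lambda>x. indicator S x * w x)"
    using m by (simp add: set_integrable_def integrable_completion)
  then have "(\<integral>\<^sup>+ x. ennreal (indicator S x * w x) \<partial>lborel) = ennreal (\<integral>x. indicator S x * w x \<partial>lborel)"
    by (rule nn_integral_eq_integral) (auto simp: w indicator_def)
  also have "(\<integral>x. indicator S x * w x \<partial>lborel) = (LINT x:S|lebesgue. w x)"
    using m by (simp add: set_lebesgue_integral_def integral_completion)
  also have "\<dots> = integral S w" using True by (rule set_lebesgue_integral_eq_integral)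
  finally show ?thesis using True by simp
next
  case False
  have "integrable lborel (\<lambda>x. indicator S x * w x)"
    if "(\<integral>\<^sup>+ x. ennreal (indicator S x * w x) \<partial>lborel) < \<infinity>"
    using that m by (intro integrableI_nonneg) (auto simp: w indicator_def)
  then show ?thesis
    using False m by (auto simp: set_integrable_def integrable_completion less_top[symmetric])
qed

text \<open>The formula for absolutely integrable functions is transferred to nonnegative integrals:
  integrability of the two sides is equivalent, and a side that is not integrable has the value
  infinity. The scalar integrand enters as a function into \<open>real^1\<close>.\<close>

lemma nn_integral_change_of_variables:
  fixes g :: "real^'n::{finite,wellorder} \<Rightarrow> real^'n::_" and u :: "real^'n::_ \<Rightarrow> real"
  assumes S: "S \<in> sets borel" and gS: "g ` S \<in> sets borel"
    and g': "\<And>x. x \<in> S \<Longrightarrow> (g has_derivative g' x) (at x within S)" and inj: "inj_on g S"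
    and m: "(\<lambda>y. indicator (g ` S) y * u y) \<in> borel_measurable borel"
    and m': "(\<lambda>x. indicator S x * (\<bar>det (matrix (g' x))\<bar> * u (g x))) \<in> borel_measurable borel"
    and u: "\<And>y. y \<in> g ` S \<Longrightarrow> u y \<ge> 0"
  shows "(\<integral>\<^sup>+ y. ennreal (indicator (g ` S) y * u y) \<partial>lborel) =
    (\<integral>\<^sup>+ x. ennreal (indicator S x * (\<bar>det (matrix (g' x))\<bar> * u (g x))) \<partial>lborel)"
proof -
  have S': "S \<in> sets lebesgue" using S by simp
  let ?u = "\<lambda>y. vec (u y) :: real^1" and ?w = "\<lambda>x. \<bar>det (matrix (g' x))\<bar> * u (g x)"
  have "?w absolutely_integrable_on S \<and> integral S ?w = b \<longleftrightarrow> u absolutely_integrable_on (g ` S) \<and> integral (g ` S) u = b" for b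
    using has_absolute_integral_change_of_variables[OF S' g' inj, of ?u "vec b"]
    unfolding absolutely_integrable_on_1_iff integral_on_1_eq by (simp add: vec_eq_iff)
  then have "?w absolutely_integrable_on S \<longleftrightarrow> u absolutely_integrable_on (g ` S)"
    "u absolutely_integrable_on (g ` S) \<Longrightarrow> integral S ?w = integral (g ` S) u"
    by blast+
  then show ?thesis
    using u by (subst nn_integral_eq_absolute_integral[OF gS m]; (subst nn_integral_eq_absolute_integral[OF S m'])?) auto
qed

lemma continuous_on_abs_jacobian:
  fixes F :: "'e::euclidean_space \<Rightarrow> 'e"
  assumes B: "B \<subseteq> Basis" and X: "openin (top_of_set (span B)) X" and F: "smooth_on X F"
  shows "continuous_on X (abs_jacobian B F)"
proof -
  have "continuous_on X (\<lambda>x. dir_deriv F x b)" if "b \<in> B" for b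
    by (rule smooth_on_continuous_on[OF smooth_on_dir_deriv[OF X F span_base[OF that]]])
  then show ?thesis
    unfolding abs_jacobian_def[abs_def] by (intro continuous_intros) auto
qed

text \<open>Nothing is known about \<open>u\<close> off the image of \<open>A\<close>, so
  measurability is proved for the restriction of the Borel sets to \<open>A\<close>, where
  \<open>F\<close> is continuous, and then extended by zero.\<close>

lemma borel_measurable_abs_jacobian_times:
  fixes F :: "'e::euclidean_space \<Rightarrow> 'e" and u :: "'e \<Rightarrow> real"
  assumes B: "B \<subseteq> Basis" and X: "openin (top_of_set (span B)) X" and F: "smooth_on X F"
    and A: "A \<in> sets borel" "A \<subseteq> X"
    and m: "(\<lambda>y. indicator (F ` A) y * u y) \<in> borel_measurable borel"
  shows "(\<lambda>y. indicator A y * (abs_jacobian B F y * u (F y))) \<in> borel_measurable borel"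
proof -
  have "continuous_on A F" using smooth_on_continuous_on[OF F] A(2) continuous_on_subset by blast
  then have "F \<in> borel_measurable (restrict_space borel A)" by (rule borel_measurable_continuous_on_restrict)
  then have "(\<lambda>y. indicator (F ` A) (F y) * u (F y)) \<in> borel_measurable (restrict_space borel A)"
    using m by (rule measurable_compose)
  then have "(\<lambda>y. indicator A y *\<^sub>R (indicator (F ` A) (F y) * u (F y))) \<in> borel_measurable borel"
    using A(1) by (simp add: borel_measurable_restrict_space_iff)
  moreover have "(\<lambda>y. indicator A y *\<^sub>R abs_jacobian B F y) \<in> borel_measurable borel"
    using A continuous_on_subset[OF continuous_on_abs_jacobian[OF B X F]]
    by (intro borel_measurable_continuous_on_indicator)
  ultimately have "(\<lambda>y. (indicator A y *\<^sub>R abs_jacobian B F y) * (indicator A y *\<^sub>R (indicator (F ` A) (F y) * u (F y)))) \<in> borel_measurable borel"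
    by (rule borel_measurable_times[rotated])
  then show ?thesis by (rule subst[of _ _ "\<lambda>f. f \<in> borel_measurable borel", rotated]) (auto simp: fun_eq_iff indicator_def)
qed

text \<open>The map \<open>?g\<close> is \<open>F\<close> in the coordinates from \<open>B\<close>
  and the identity in the others. It carries the cube over \<open>A\<close> bijectively to the cube
  over the image of \<open>A\<close>, and its Jacobian determinant has absolute value
  \<open>abs_jacobian\<close>.\<close>

lemma nn_integral_lborel_span_change_of_variables:
  fixes F :: "real^'n::{finite,wellorder} \<Rightarrow> real^'n::_" and u :: "real^'n::_ \<Rightarrow> real"
  assumes B: "B \<subseteq> Basis" and X: "openin (top_of_set (span B)) X" and F: "smooth_on X F"
    and inj: "inj_on F X" and FX: "F ` X \<subseteq> span B"
    and A: "A \<in> sets borel" "A \<subseteq> X" and FA: "F ` A \<in> sets borel"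
    and m: "(\<lambda>y. indicator (F ` A) y * u y) \<in> borel_measurable borel"
    and u: "\<And>y. y \<in> F ` A \<Longrightarrow> u y \<ge> 0"
  shows "(\<integral>\<^sup>+ y. ennreal (indicator (F ` A) y * u y) \<partial>lborel_span B) =
    (\<integral>\<^sup>+ y. ennreal (indicator A y * (abs_jacobian B F y * u (F y))) \<partial>lborel_span B)"
proof -
  let ?\<pi> = "coord_proj B"
  let ?S = "{y \<in> complement_cube B. ?\<pi> y \<in> A}"
  let ?g = "\<lambda>y. F (?\<pi> y) + (y - ?\<pi> y)"
  note m' = borel_measurable_abs_jacobian_times[OF B X F A m]
  have S: "?S \<in> sets borel" using A(1) by measurable
  have \<pi>\<pi>: "?\<pi> v = v" if "v \<in> span B" for v using coord_proj_span[OF B that] .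
  have blp: "linear ?\<pi>" using bounded_linear_coord_proj bounded_linear.linear by blast
  have \<pi>g: "?\<pi> (?g y) = F (?\<pi> y)" if "y \<in> ?S" for y
  proof -
    have "F (?\<pi> y) \<in> span B" using that A(2) FX by blast
    then show ?thesis
      using blp by (simp add: linear_add linear_diff \<pi>\<pi> coord_proj_in_span)
  qed
  have gcube: "?g y \<in> complement_cube B \<longleftrightarrow> y \<in> complement_cube B" if "F (?\<pi> y) \<in> span B" for y
  proof -
    have "?g y \<bullet> b = y \<bullet> b" if "b \<in> Basis - B" for b
      using coord_proj_inner[OF B, of b y] coord_proj_inner[OF B, of b "F (?\<pi> y)"] \<pi>\<pi>[OF \<open>F (?\<pi> y) \<in> span B\<close>] that
      by (simp add: inner_add_left inner_diff_left)
    then show ?thesis by (simp add: complement_cube_def)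
  qed
  have gS: "?g ` ?S = {z \<in> complement_cube B. ?\<pi> z \<in> F ` A}"
  proof (intro equalityI subsetI)
    fix z assume "z \<in> ?g ` ?S"
    then obtain y where y: "y \<in> ?S" "z = ?g y" by (rule imageE)
    have "F (?\<pi> y) \<in> span B" using y(1) A(2) FX by blast
    then show "z \<in> {z \<in> complement_cube B. ?\<pi> z \<in> F ` A}"
      using y(1) gcube[of y] \<pi>g[OF y(1)] unfolding y(2) by auto
  next
    fix z assume "z \<in> {z \<in> complement_cube B. ?\<pi> z \<in> F ` A}"
    then obtain a where z: "z \<in> complement_cube B" "?\<pi> z = F a" "a \<in> A" by auto
    have a: "a \<in> span B" using z(3) A(2) X openin_imp_subset by blast
    let ?y = "a + (z - ?\<pi> z)"
    have \<pi>y: "?\<pi> ?y = a" using blp a by (simp add: linear_add linear_diff \<pi>\<pi> coord_proj_in_span)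
    have gy: "?g ?y = z" unfolding \<pi>y using z(2) by simp
    have "F (?\<pi> ?y) \<in> span B" unfolding \<pi>y using z(3) A(2) FX by blast
    from gcube[OF this] have "?y \<in> ?S" unfolding gy using z \<pi>y by simp
    then show "z \<in> ?g ` ?S" using gy by (metis (no_types, lifting) image_eqI)
  qed
  have injg: "inj_on ?g ?S"
  proof (rule inj_onI)
    fix x y assume x: "x \<in> ?S" and y: "y \<in> ?S" and eq: "?g x = ?g y"
    have "F (?\<pi> x) = F (?\<pi> y)" using \<pi>g[OF x] \<pi>g[OF y] eq by metis
    then have "?\<pi> x = ?\<pi> y" using inj x y A(2) by (auto dest: inj_onD)
    then show "x = y" using eq by simp
  qed
  \<comment> \<open>Derivatives of \<open>F\<close> within \<open>X\<close> are not determined off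
    the span. Any choice serves, since only its values on the span enter \<open>?g'\<close>.\<close>
  let ?F' = "\<lambda>y. SOME f'. (F has_derivative f') (at (?\<pi> y) within X)"
  have F': "(F has_derivative ?F' y) (at (?\<pi> y) within X)" if "y \<in> ?S" for y
  proof -
    have "?\<pi> y \<in> X" using that A(2) by blast
    then obtain f' where "(F has_derivative f') (at (?\<pi> y) within X)" by (rule smooth_on_has_derivative[OF F])
    then show ?thesis using someI[of "\<lambda>f'. (F has_derivative f') (at (?\<pi> y) within X)"] by blast
  qed
  let ?g' = "\<lambda>y w. ?F' y (?\<pi> w) + (w - ?\<pi> w)"
  have g': "(?g has_derivative ?g' y) (at y within ?S)" if y: "y \<in> ?S" for y
  proof -
    have p: "(?\<pi> has_derivative ?\<pi>) (at y within ?S)"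
      by (rule bounded_linear_imp_has_derivative[OF bounded_linear_coord_proj])
    have "((\<lambda>y. F (?\<pi> y)) has_derivative (\<lambda>w. ?F' y (?\<pi> w))) (at y within ?S)"
      by (rule has_derivative_in_compose[OF p has_derivative_subset[OF F'[OF y]]]) (use A(2) in blast)
    then show ?thesis by (intro has_derivative_add has_derivative_diff has_derivative_ident p)
  qed
  have det: "\<bar>det (matrix (?g' y))\<bar> = abs_jacobian B F (?\<pi> y)" if y: "y \<in> ?S" for y
  proof -
    have yX: "?\<pi> y \<in> X" using y A(2) by blast
    note dd = dir_deriv_eq[OF X yX _ F'[OF y]]
    have lin: "linear (?F' y)" by (rule has_derivative_linear[OF F'[OF y]])
    have "det (matrix (?g' y)) = (\<Sum>\<pi> | \<pi> permutes B. of_int (sign \<pi>) * (\<Prod>b\<in>B. ?F' y b \<bullet> \<pi> b))"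
    proof (rule det_span_extension[OF B])
      show "?F' y v \<in> span B" if "v \<in> span B" for v
        using dir_deriv_in_span[OF X F yX that B FX] dd[OF that] by simp
      show "?F' y 0 = 0" using lin by (rule linear_0)
    qed
    also have "\<dots> = (\<Sum>\<pi> | \<pi> permutes B. of_int (sign \<pi>) * (\<Prod>b\<in>B. dir_deriv F (?\<pi> y) b \<bullet> \<pi> b))"
      by (intro sum.cong refl arg_cong2[of _ _ _ _ "(*)"] prod.cong) (simp add: dd span_base)
    finally show ?thesis by (simp add: abs_jacobian_def)
  qed
  let ?u = "\<lambda>z. u (?\<pi> z)"
  have i1: "indicator (?g ` ?S) z * ?u z = indicator (F ` A) (?\<pi> z) * u (?\<pi> z) * indicator (complement_cube B) z" for z
    unfolding gS by (auto simp: indicator_def)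
  have i2: "indicator ?S y * (\<bar>det (matrix (?g' y))\<bar> * ?u (?g y)) =
      indicator A (?\<pi> y) * (abs_jacobian B F (?\<pi> y) * u (F (?\<pi> y))) * indicator (complement_cube B) y" for y
  proof (cases "y \<in> ?S")
    case True
    then show ?thesis using det[OF True] \<pi>g[OF True] by simp
  qed (auto simp: indicator_def)
  have "(\<integral>\<^sup>+ y. ennreal (indicator (F ` A) y * u y) \<partial>lborel_span B) =
      (\<integral>\<^sup>+ z. ennreal (indicator (F ` A) (?\<pi> z) * u (?\<pi> z)) * indicator (complement_cube B) z \<partial>lborel)"
    using m by (intro nn_integral_lborel_span[OF B]) simp
  also have "\<dots> = (\<integral>\<^sup>+ z. ennreal (indicator (?g ` ?S) z * ?u z) \<partial>lborel)"
    unfolding i1 by (intro nn_integral_cong) (auto split: split_indicator)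
  also have "\<dots> = (\<integral>\<^sup>+ y. ennreal (indicator ?S y * (\<bar>det (matrix (?g' y))\<bar> * ?u (?g y))) \<partial>lborel)"
  proof (rule nn_integral_change_of_variables[OF S _ g' injg])
    show "?g ` ?S \<in> sets borel" unfolding gS using FA by measurable
    show "(\<lambda>z. indicator (?g ` ?S) z * ?u z) \<in> borel_measurable borel"
      unfolding i1 using measurable_compose[OF borel_measurable_coord_proj m] by measurable
    show "(\<lambda>y. indicator ?S y * (\<bar>det (matrix (?g' y))\<bar> * ?u (?g y))) \<in> borel_measurable borel"
      unfolding i2 using measurable_compose[OF borel_measurable_coord_proj m'] by measurable
    show "?u z \<ge> 0" if "z \<in> ?g ` ?S" for z using that u unfolding gS by blast
  qed
  also have "\<dots> = (\<integral>\<^sup>+ y. ennreal (indicator A (?\<pi> y) * (abs_jacobian B F (?\<pi> y) * u (F (?\<pi> y)))) *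
      indicator (complement_cube B) y \<partial>lborel)"
    unfolding i2 by (intro nn_integral_cong) (auto split: split_indicator)
  also have "\<dots> = (\<integral>\<^sup>+ y. ennreal (indicator A y * (abs_jacobian B F y * u (F y))) \<partial>lborel_span B)"
    using m' by (intro nn_integral_lborel_span[OF B, symmetric]) simp
  finally show ?thesis .
qed

section \<open>The volume measure\<close>

definition mfd_borel :: "('a, 'e::euclidean_space) mfd \<Rightarrow> 'a measure" where
  "mfd_borel M = sigma (points M) {U. openin (mtop M) U}"

lemma openin_span_borel:
  assumes "openin (top_of_set (span B)) W"
  shows "(W::'e::euclidean_space set) \<in> sets borel"
proof -
  obtain T where "open T" "W = span B \<inter> T" using assms by (meson openin_open)
  then show ?thesis using closed_subspace[OF subspace_span, of B] by auto
qed

context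
  fixes M :: "('a, 'e::euclidean_space) mfd"
  assumes M: "premanifold M"
begin

lemma openin_subset_Pow: "{U. openin (mtop M) U} \<subseteq> Pow (points M)"
  using openin_mtop[OF M] by auto

lemma space_mfd_borel[simp]: "space (mfd_borel M) = points M"
  and sets_mfd_borel: "sets (mfd_borel M) = sigma_sets (points M) {U. openin (mtop M) U}"
  using openin_subset_Pow by (auto simp: mfd_borel_def space_measure_of_conv)

lemma openin_sets_mfd_borel: "openin (mtop M) U \<Longrightarrow> U \<in> sets (mfd_borel M)"
  by (simp add: sets_mfd_borel sigma_sets.Basic)

lemma measurable_mfd_borelI:
  assumes "f \<in> space N \<rightarrow> points M" "\<And>U. openin (mtop M) U \<Longrightarrow> f -` U \<inter> space N \<in> sets N"
  shows "f \<in> measurable N (mfd_borel M)"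
  using assms by (intro measurable_sigma_sets[OF sets_mfd_borel openin_subset_Pow]) auto

lemma borel_measurable_continuous_map:
  fixes f :: "'a \<Rightarrow> 'b::topological_space"
  assumes "continuous_map (mtop M) euclidean f"
  shows "f \<in> borel_measurable (mfd_borel M)"
proof (rule borel_measurableI)
  fix T :: "'b set" assume "open T"
  then have "openin (mtop M) {x \<in> topspace (mtop M). f x \<in> T}"
    by (intro openin_continuous_map_preimage[OF assms]) simp
  moreover have "f -` T \<inter> space (mfd_borel M) = {x \<in> topspace (mtop M). f x \<in> T}"
    by (auto simp: topspace_mtop[OF M])
  ultimately show "f -` T \<inter> space (mfd_borel M) \<in> sets (mfd_borel M)"
    by (simp add: openin_sets_mfd_borel)
qed

lemma measurable_continuous_map:
  assumes "continuous_map (mtop M) (mtop M) f"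
  shows "f \<in> measurable (mfd_borel M) (mfd_borel M)"
proof (rule measurable_mfd_borelI)
  show "f \<in> space (mfd_borel M) \<rightarrow> points M"
    using assms by (auto simp: continuous_map_def topspace_mtop[OF M])
  fix U assume "openin (mtop M) U"
  then have "openin (mtop M) {x \<in> topspace (mtop M). f x \<in> U}"
    by (rule openin_continuous_map_preimage[OF assms])
  moreover have "f -` U \<inter> space (mfd_borel M) = {x \<in> topspace (mtop M). f x \<in> U}"
    by (auto simp: topspace_mtop[OF M])
  ultimately show "f -` U \<inter> space (mfd_borel M) \<in> sets (mfd_borel M)"
    by (simp add: openin_sets_mfd_borel)
qed

text \<open>The inverse chart is Borel measurable on the image of the chart, and the set in question
  is its preimage of \<open>A\<close>.\<close>

lemma chart_image_borel:
  assumes c: "c \<in> atlas M" and A: "A \<in> sets (mfd_borel M)" "A \<subseteq> fst c"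
  shows "snd c ` A \<in> sets borel"
proof -
  let ?R = "restrict_space borel (snd c ` fst c)"
  have cb: "snd c ` fst c \<in> sets borel" by (rule openin_span_borel[OF chart_image_openin[OF M c]])
  have im: "chart_inv c -` U \<inter> space ?R = snd c ` (U \<inter> fst c)" for U
    using chart_inv_chart[OF M c] by (auto simp: space_restrict_space)
  have "chart_inv c \<in> measurable ?R (mfd_borel M)"
  proof (rule measurable_mfd_borelI)
    show "chart_inv c \<in> space ?R \<rightarrow> points M"
      using chart_subset_points[OF M c] chart_inv_chart[OF M c] by (auto simp: space_restrict_space)
    fix U assume U: "openin (mtop M) U"
    show "chart_inv c -` U \<inter> space ?R \<in> sets ?R"
      unfolding im using openin_span_borel[OF openin_chart_image[OF M U c]] cb
      by (subst sets_restrict_space_iff) auto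
  qed
  from measurable_sets[OF this A(1)] have "snd c ` A \<in> sets ?R"
    using A(2) unfolding im by (simp add: inf_absorb1)
  then show ?thesis using cb by (subst (asm) sets_restrict_space_iff) auto
qed

end

text \<open>The value that the volume measure has to take on subsets of the domain of
  \<open>c\<close>. The indicator stands inside \<open>ennreal\<close>, as in the change of
  variables formula.\<close>

definition chart_volume :: "('a, 'e::euclidean_space) mfd \<Rightarrow> ('a, 'e) volume \<Rightarrow> ('a, 'e) chart \<Rightarrow> 'a set \<Rightarrow> ennreal" where
  "chart_volume M \<mu> c A = (\<integral>\<^sup>+ y. ennreal (indicator (snd c ` A) y * \<mu> c (chart_inv c y)) \<partial>lborel_span (model_basis M))"

section \<open>Volumes measured in a single chart\<close>

context
  fixes S :: "('s, real ^ 'n::{finite,wellorder}) mfd" and \<mu> :: "('s, real ^ 'n::_) volume"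
  assumes S: "premanifold S" and vol: "volume_form S \<mu>"
begin

lemma volume_form_pos: "c \<in> atlas S \<Longrightarrow> p \<in> fst c \<Longrightarrow> \<mu> c p > 0"
  using vol unfolding volume_form_def by blast

lemma volume_form_smooth: "c \<in> atlas S \<Longrightarrow> smooth_on (snd c ` fst c) (\<lambda>y. \<mu> c (chart_inv c y))"
  using vol unfolding volume_form_def by (auto simp: o_def)

lemma borel_measurable_chart_density:
  assumes c: "c \<in> atlas S" and A: "A \<in> sets (mfd_borel S)" "A \<subseteq> fst c"
  shows "(\<lambda>y. indicator (snd c ` A) y * \<mu> c (chart_inv c y)) \<in> borel_measurable borel"
proof -
  have "continuous_on (snd c ` A) (\<lambda>y. \<mu> c (chart_inv c y))"
    using smooth_on_continuous_on[OF volume_form_smooth[OF c]] A(2) by (meson continuous_on_subset image_mono)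
  from borel_measurable_continuous_on_indicator[OF chart_image_borel[OF S c A] this] show ?thesis by simp
qed

lemma chart_volume_empty[simp]: "chart_volume S \<mu> c {} = 0"
  by (simp add: chart_volume_def)

lemma chart_volume_UN:
  assumes c: "c \<in> atlas S" and A: "range A \<subseteq> sets (mfd_borel S)" "\<And>i::nat. A i \<subseteq> fst c" and "disjoint_family A"
  shows "(\<Sum>i. chart_volume S \<mu> c (A i)) = chart_volume S \<mu> c (\<Union>i. A i)"
proof -
  have "disjoint_family (\<lambda>i. snd c ` A i)"
    unfolding disjoint_family_on_def
  proof (intro ballI impI)
    fix i j :: nat assume "i \<noteq> j"
    then have "A i \<inter> A j = {}" using assms(4) by (auto simp: disjoint_family_on_def)
    then show "snd c ` A i \<inter> snd c ` A j = {}"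
      using inj_on_image_Int[OF chart_inj[OF S c] A(2) A(2), of i j] by simp
  qed
  then have ind: "(\<Sum>i. indicator (snd c ` A i) y) = (indicator (snd c ` (\<Union>i. A i)) y :: ennreal)" for y
    by (simp add: suminf_indicator image_UN)
  have e: "ennreal (indicator X y * r) = indicator X y * ennreal r" for X y r
    by (simp split: split_indicator)
  have m: "(\<lambda>y. ennreal (indicator (snd c ` A i) y * \<mu> c (chart_inv c y))) \<in> borel_measurable (lborel_span (model_basis S))" for i
    using borel_measurable_chart_density[OF c _ A(2)] A(1) by (auto cong: measurable_cong_sets)
  show ?thesis
    unfolding chart_volume_def nn_integral_suminf[OF m, symmetric]
    by (intro nn_integral_cong) (simp add: e ind[symmetric])
qed

text \<open>In the charts, \<psi> is an injective smooth map between subsets of the model space, so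
  the change of variables formula expresses the volume of the image as an integral over
  \<open>A\<close>.\<close>

lemma chart_volume_image:
  assumes \<psi>: "smooth_map S S \<psi>" "inj_on \<psi> (points S)" and c: "c \<in> atlas S" and d: "d \<in> atlas S"
    and A: "A \<in> sets (mfd_borel S)" "A \<subseteq> {x \<in> fst c. \<psi> x \<in> fst d}" and \<psi>A: "\<psi> ` A \<in> sets (mfd_borel S)"
  shows "chart_volume S \<mu> d (\<psi> ` A) = (\<integral>\<^sup>+ y. ennreal (indicator (snd c ` A) y *
      (abs_jacobian (model_basis S) (snd d \<circ> \<psi> \<circ> chart_inv c) y * \<mu> d (\<psi> (chart_inv c y)))) \<partial>lborel_span (model_basis S))"
    and "(\<lambda>y. indicator (snd c ` A) y *
      (abs_jacobian (model_basis S) (snd d \<circ> \<psi> \<circ> chart_inv c) y * \<mu> d (\<psi> (chart_inv c y)))) \<in> borel_measurable borel"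
proof -
  let ?X = "snd c ` {x \<in> fst c. \<psi> x \<in> fst d}" and ?F = "snd d \<circ> \<psi> \<circ> chart_inv c" and ?B = "model_basis S"
  let ?u = "\<lambda>y. \<mu> d (chart_inv d y)"
  note B = premanifold_model_basis[OF S]
  note X = smooth_map_on_charts(2)[OF S S \<psi>(1) c d]
  have F: "smooth_on ?X ?F" using smooth_map_on_charts(3)[OF S S \<psi>(1) c d] by (simp add: o_def)
  have Fc: "?F (snd c x) = snd d (\<psi> x)" if "x \<in> fst c" for x using chart_inv_chart[OF S c that] by simp
  have inj: "inj_on ?F ?X"
  proof (rule inj_onI)
    fix y z assume "y \<in> ?X" "z \<in> ?X" and eq: "?F y = ?F z"
    then obtain p q where p: "p \<in> fst c" "\<psi> p \<in> fst d" "y = snd c p" and q: "q \<in> fst c" "\<psi> q \<in> fst d" "z = snd c q" by blast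
    have "\<psi> p = \<psi> q" using eq Fc p q chart_inj[OF S d] by (auto dest: inj_onD)
    then have "p = q" using \<psi>(2) p q chart_subset_points[OF S c] by (auto dest: inj_onD)
    then show "y = z" using p q by simp
  qed
  have FX: "?F ` ?X \<subseteq> model_space S" using Fc chart_image_subset[OF S d] by auto
  have Ac: "A \<subseteq> fst c" and \<psi>Ad: "\<psi> ` A \<subseteq> fst d" using A(2) by auto
  have FA: "?F ` (snd c ` A) = snd d ` (\<psi> ` A)" unfolding image_image by (rule image_cong) (use Fc Ac in auto)
  have A': "snd c ` A \<in> sets borel" "snd c ` A \<subseteq> ?X" using chart_image_borel[OF S c A(1) Ac] A(2) by auto
  have m: "(\<lambda>y. indicator (?F ` (snd c ` A)) y * ?u y) \<in> borel_measurable borel"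
    unfolding FA by (rule borel_measurable_chart_density[OF d \<psi>A \<psi>Ad])
  have eq: "indicator (snd c ` A) y * (abs_jacobian ?B ?F y * ?u (?F y)) =
      indicator (snd c ` A) y * (abs_jacobian ?B ?F y * \<mu> d (\<psi> (chart_inv c y)))" for y
  proof (cases "y \<in> snd c ` A")
    case True
    then obtain x where x: "x \<in> A" "y = snd c x" by blast
    then have "x \<in> fst c" "\<psi> x \<in> fst d" using Ac \<psi>Ad by auto
    then show ?thesis using x chart_inv_chart[OF S c, of x] chart_inv_chart[OF S d, of "\<psi> x"] by simp
  qed simp
  have u: "?u y \<ge> 0" if "y \<in> ?F ` (snd c ` A)" for y
  proof -
    have "y \<in> snd d ` (\<psi> ` A)" using that unfolding FA .
    then obtain x where "y = snd d x" "x \<in> \<psi> ` A" by (rule imageE)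
    moreover from this have "x \<in> fst d" using \<psi>Ad by blast
    ultimately have "x \<in> fst d" "y = snd d x" by simp_all
    then show ?thesis using volume_form_pos[OF d, of x] chart_inv_chart[OF S d, of x] by simp
  qed
  show "chart_volume S \<mu> d (\<psi> ` A) = (\<integral>\<^sup>+ y. ennreal (indicator (snd c ` A) y *
      (abs_jacobian ?B ?F y * \<mu> d (\<psi> (chart_inv c y)))) \<partial>lborel_span ?B)"
    unfolding chart_volume_def FA[symmetric] eq[symmetric]
    by (rule nn_integral_lborel_span_change_of_variables[OF B X F inj FX A' _ m u])
      (simp only: FA chart_image_borel[OF S d \<psi>A \<psi>Ad])
  show "(\<lambda>y. indicator (snd c ` A) y * (abs_jacobian ?B ?F y * \<mu> d (\<psi> (chart_inv c y)))) \<in> borel_measurable borel"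
    using borel_measurable_abs_jacobian_times[OF B X F A' m] unfolding eq .
qed

text \<open>Pointwise bounds on the Jacobian factor integrate to bounds on volumes. With
  \<open>r = 1\<close> the two parts together give invariance under chart transitions and volume
  preserving maps; with \<open>r < 1\<close> they measure a failure of invariance.\<close>

lemma chart_volume_image_le:
  assumes \<psi>: "smooth_map S S \<psi>" "inj_on \<psi> (points S)" and c: "c \<in> atlas S" and d: "d \<in> atlas S"
    and A: "A \<in> sets (mfd_borel S)" "A \<subseteq> {x \<in> fst c. \<psi> x \<in> fst d}" and \<psi>A: "\<psi> ` A \<in> sets (mfd_borel S)" and r: "r \<ge> 0"
  shows "(\<And>p. p \<in> A \<Longrightarrow> abs_jacobian (model_basis S) (snd d \<circ> \<psi> \<circ> chart_inv c) (snd c p) * \<mu> d (\<psi> p) \<le> r * \<mu> c p) \<Longrightarrow>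
      chart_volume S \<mu> d (\<psi> ` A) \<le> ennreal r * chart_volume S \<mu> c A"
    and "(\<And>p. p \<in> A \<Longrightarrow> \<mu> c p \<le> r * (abs_jacobian (model_basis S) (snd d \<circ> \<psi> \<circ> chart_inv c) (snd c p) * \<mu> d (\<psi> p))) \<Longrightarrow>
      chart_volume S \<mu> c A \<le> ennreal r * chart_volume S \<mu> d (\<psi> ` A)"
proof -
  let ?J = "\<lambda>y. abs_jacobian (model_basis S) (snd d \<circ> \<psi> \<circ> chart_inv c) y * \<mu> d (\<psi> (chart_inv c y))"
  let ?leb = "lborel_span (model_basis S)"
  note im = chart_volume_image[OF \<psi> c d A \<psi>A]
  have Ac: "A \<subseteq> fst c" using A by auto
  have m: "(\<lambda>y. ennreal (indicator (snd c ` A) y * \<mu> c (chart_inv c y))) \<in> borel_measurable ?leb"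
    "(\<lambda>y. ennreal (indicator (snd c ` A) y * ?J y)) \<in> borel_measurable ?leb"
    using borel_measurable_chart_density[OF c A(1) Ac] im(2) by (simp_all cong: measurable_cong_sets)
  {
    assume le: "\<And>p. p \<in> A \<Longrightarrow> abs_jacobian (model_basis S) (snd d \<circ> \<psi> \<circ> chart_inv c) (snd c p) * \<mu> d (\<psi> p) \<le> r * \<mu> c p"
    have "ennreal (indicator (snd c ` A) y * ?J y) \<le> ennreal r * ennreal (indicator (snd c ` A) y * \<mu> c (chart_inv c y))" for y
    proof (cases "y \<in> snd c ` A")
      case True
      then obtain x where x: "x \<in> A" "y = snd c x" by blast
      then show ?thesis using le[OF x(1)] Ac chart_inv_chart[OF S c, of x] r
        by (auto simp: ennreal_mult'[symmetric] intro!: ennreal_leI)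
    qed simp
    then show "chart_volume S \<mu> d (\<psi> ` A) \<le> ennreal r * chart_volume S \<mu> c A"
      unfolding im(1) chart_volume_def[of S \<mu> c] nn_integral_cmult[OF m(1), symmetric] by (intro nn_integral_mono)
  next
    assume ge: "\<And>p. p \<in> A \<Longrightarrow> \<mu> c p \<le> r * (abs_jacobian (model_basis S) (snd d \<circ> \<psi> \<circ> chart_inv c) (snd c p) * \<mu> d (\<psi> p))"
    have "ennreal (indicator (snd c ` A) y * \<mu> c (chart_inv c y)) \<le> ennreal r * ennreal (indicator (snd c ` A) y * ?J y)" for y
    proof (cases "y \<in> snd c ` A")
      case True
      then obtain x where x: "x \<in> A" "y = snd c x" by blast
      then show ?thesis using ge[OF x(1)] Ac chart_inv_chart[OF S c, of x] r
        by (auto simp: ennreal_mult'[symmetric] intro!: ennreal_leI)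
    qed simp
    then show "chart_volume S \<mu> c A \<le> ennreal r * chart_volume S \<mu> d (\<psi> ` A)"
      unfolding im(1) chart_volume_def[of S \<mu> c] nn_integral_cmult[OF m(2), symmetric] by (intro nn_integral_mono)
  }
qed

text \<open>For the identity map read in \<open>c\<close> and \<open>d\<close>, the Jacobian
  condition is the transformation law in \<open>volume_form\<close>, so the comparison applies with
  \<open>r = 1\<close> in both directions.\<close>

lemma chart_volume_transition:
  assumes c: "c \<in> atlas S" and d: "d \<in> atlas S" and A: "A \<in> sets (mfd_borel S)" "A \<subseteq> fst c" "A \<subseteq> fst d"
  shows "chart_volume S \<mu> d A = chart_volume S \<mu> c A"
proof -
  have eq: "abs_jacobian (model_basis S) (snd d \<circ> (\<lambda>x. x) \<circ> chart_inv c) (snd c p) * \<mu> d p = \<mu> c p" if "p \<in> A" for p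
  proof -
    have "p \<in> fst c \<inter> fst d" using that A by blast
    then have "\<mu> c p = abs_jacobian (model_basis S) (snd d \<circ> chart_inv c) (snd c p) * \<mu> d p"
      using vol c d unfolding volume_form_def by blast
    then show ?thesis by (simp add: o_def)
  qed
  have A': "A \<subseteq> {x \<in> fst c. x \<in> fst d}" "(\<lambda>x. x) ` A \<in> sets (mfd_borel S)" using A by auto
  show ?thesis
    using chart_volume_image_le[OF smooth_map_ident[OF S] inj_on_id2 c d A(1) A'(1) A'(2), of 1] eq
    by (intro antisym) auto
qed

section \<open>The volume measure glued from charts\<close>

context
  assumes comp: "compact_space (mtop S)"
begin

text \<open>Compactness leaves finitely many charts, and removing from each domain the earlier ones
  makes the pieces disjoint while keeping them Borel.\<close>

lemma chart_partition:
  obtains n :: nat and cc E where "\<forall>i<n. cc i \<in> atlas S \<and> E i \<in> sets (mfd_borel S) \<and> E i \<subseteq> fst (cc i)"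
    "disjoint_family_on E {..<n}" "(\<Union>i<n. E i) = points S"
proof -
  obtain F where F: "finite F" "F \<subseteq> fst ` atlas S" "points S \<subseteq> \<Union>F"
    using comp[unfolded compact_space_alt, rule_format, of "fst ` atlas S"]
      openin_chart_domain[OF S] premanifold_points[OF S] by (auto simp: topspace_mtop[OF S])
  obtain C where C: "C \<subseteq> atlas S" "finite C" "F = fst ` C" using finite_subset_image[OF F(1,2)] by blast
  obtain n :: nat and cc where cc: "C = cc ` {i. i < n}" using finite_imp_nat_seg_image_inj_on[OF C(2)] by blast
  define E where "E i = fst (cc i) - (\<Union>j<i. fst (cc j))" for i
  have at: "cc i \<in> atlas S" if "i < n" for i using that C cc by auto
  have dom: "fst (cc i) \<in> sets (mfd_borel S)" if "i < n" for i
    using openin_sets_mfd_borel[OF S openin_chart_domain[OF S at[OF that]]] .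
  show thesis
  proof (rule that[of n cc E])
    have "E i \<in> sets (mfd_borel S)" if "i < n" for i
      unfolding E_def using dom that by (intro sets.Diff sets.finite_UN) auto
    then show "\<forall>i<n. cc i \<in> atlas S \<and> E i \<in> sets (mfd_borel S) \<and> E i \<subseteq> fst (cc i)"
      using at by (auto simp: E_def)
    show "disjoint_family_on E {..<n}"
      unfolding disjoint_family_on_def
    proof (intro ballI impI)
      fix i j :: nat assume "i \<noteq> j"
      then show "E i \<inter> E j = {}" by (cases "i < j") (auto simp: E_def)
    qed
    show "(\<Union>i<n. E i) = points S"
    proof (intro equalityI subsetI)
      fix x assume "x \<in> points S"
      then obtain i where "i < n" "x \<in> fst (cc i)" using F(3) C(3) cc by auto
      then have l: "(LEAST i. x \<in> fst (cc i)) < n" "x \<in> fst (cc (LEAST i. x \<in> fst (cc i)))"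
        by (meson LeastI Least_le le_less_trans)+
      moreover have "x \<notin> fst (cc j)" if "j < (LEAST i. x \<in> fst (cc i))" for j
        using not_less_Least[OF that] .
      ultimately show "x \<in> (\<Union>i<n. E i)" unfolding E_def by blast
    qed (use chart_subset_points[OF S at] in \<open>auto simp: E_def\<close>)
  qed
qed

text \<open>Needed because \<open>volume_measure\<close> is a definite description. Existence: chart
  volumes are summed over a chart partition, and \<open>chart_volume_transition\<close> gives the
  right value in every chart, not only in those used. Uniqueness: a measure of this kind is
  determined by its values on subsets of the pieces.\<close>

lemma volume_measure_unique_existence:
  "\<exists>!N. space N = points S \<and> sets N = sigma_sets (points S) {U. openin (mtop S) U} \<and>
     (\<forall>c\<in>atlas S. \<forall>A\<in>sets N. A \<subseteq> fst c \<longrightarrow> emeasure N A =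
          (\<integral>\<^sup>+ y. ennreal (\<mu> c (chart_inv c y)) * indicator (snd c ` A) y \<partial>lborel_span (model_basis S)))" (is "\<exists>!N. ?P N")
proof -
  have cv: "(\<integral>\<^sup>+ y. ennreal (\<mu> c (chart_inv c y)) * indicator (snd c ` A) y \<partial>lborel_span (model_basis S)) = chart_volume S \<mu> c A" for c A
    unfolding chart_volume_def by (intro nn_integral_cong) (simp split: split_indicator)
  have P: "?P N \<longleftrightarrow> space N = points S \<and> sets N = sets (mfd_borel S) \<and>
     (\<forall>c\<in>atlas S. \<forall>A\<in>sets N. A \<subseteq> fst c \<longrightarrow> emeasure N A = chart_volume S \<mu> c A)" for N
    by (simp only: cv sets_mfd_borel[OF S])
  obtain n :: nat and cc E where E0: "\<forall>i<n. cc i \<in> atlas S \<and> E i \<in> sets (mfd_borel S) \<and> E i \<subseteq> fst (cc i)"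
    and E45: "disjoint_family_on E {..<n}" "(\<Union>i<n. E i) = points S"
    by (rule chart_partition)
  have E123: "cc i \<in> atlas S" "E i \<in> sets (mfd_borel S)" "E i \<subseteq> fst (cc i)" if "i < n" for i
    using E0 that by auto
  note E = E123 E45
  let ?m = "\<lambda>A. \<Sum>i<n. chart_volume S \<mu> (cc i) (A \<inter> E i)"
  let ?N = "measure_of (points S) {U. openin (mtop S) U} ?m"
  have setsN: "sets ?N = sets (mfd_borel S)" and spaceN: "space ?N = points S"
    using openin_subset_Pow[OF S] by (simp_all add: sets_mfd_borel[OF S])
  have emN: "emeasure ?N A = ?m A" if "A \<in> sets (mfd_borel S)" for A
  proof (rule emeasure_measure_of[OF refl openin_subset_Pow[OF S]])
    show "positive (sets ?N) ?m" by (simp add: positive_def)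
    show "countably_additive (sets ?N) ?m"
    proof (rule countably_additiveI)
      fix A :: "nat \<Rightarrow> 's set" assume A: "range A \<subseteq> sets ?N" "disjoint_family A"
      have "(\<Sum>k. chart_volume S \<mu> (cc i) (A k \<inter> E i)) = chart_volume S \<mu> (cc i) (\<Union>(range A) \<inter> E i)" if i: "i < n" for i
      proof -
        have "(\<Sum>k. chart_volume S \<mu> (cc i) (A k \<inter> E i)) = chart_volume S \<mu> (cc i) (\<Union>k. A k \<inter> E i)"
          by (rule chart_volume_UN[OF E(1)[OF i]])
            (use A E(2,3)[OF i] setsN in \<open>auto simp: disjoint_family_on_def\<close>)
        also have "(\<Union>k. A k \<inter> E i) = \<Union>(range A) \<inter> E i" by blast
        finally show ?thesis .
      qed
      then show "(\<Sum>k. ?m (A k)) = ?m (\<Union>(range A))" by (simp add: suminf_sum)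
    qed
    show "A \<in> sets ?N" using that setsN by simp
  qed
  have N: "?P ?N"
    unfolding P
  proof (intro conjI ballI impI setsN spaceN)
    fix c A assume c: "c \<in> atlas S" and "A \<in> sets ?N" and Ac: "A \<subseteq> fst c"
    then have A: "A \<in> sets (mfd_borel S)" using setsN by simp
    have AE: "A \<inter> E i \<in> sets (mfd_borel S)" if "i < n" for i using A E(2)[OF that] by auto
    \<comment> \<open>Padding with empty sets turns the finite sum into a series, so that countable
      additivity in the chart \<open>c\<close> applies.\<close>
    let ?A = "\<lambda>i. if i < n then A \<inter> E i else {}"
    have "emeasure ?N A = (\<Sum>i<n. chart_volume S \<mu> c (A \<inter> E i))"
      unfolding emN[OF A]
    proof (rule sum.cong[OF refl])
      fix i assume "i \<in> {..<n}"
      then have i: "i < n" by simp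
      show "chart_volume S \<mu> (cc i) (A \<inter> E i) = chart_volume S \<mu> c (A \<inter> E i)"
        by (rule chart_volume_transition[OF c E(1)[OF i] AE[OF i]]) (use Ac E(3)[OF i] in auto)
    qed
    also have "\<dots> = (\<Sum>i. chart_volume S \<mu> c (?A i))"
      by (subst suminf_finite[of "{..<n}"]) auto
    also have "\<dots> = chart_volume S \<mu> c (\<Union>i. ?A i)"
    proof (rule chart_volume_UN[OF c])
      show "range ?A \<subseteq> sets (mfd_borel S)" using AE by auto
      show "?A i \<subseteq> fst c" for i using Ac by auto
      show "disjoint_family ?A" using E(4) by (fastforce simp: disjoint_family_on_def)
    qed
    also have "(\<Union>i. ?A i) = A"
    proof -
      have "A \<subseteq> points S" using Ac chart_subset_points[OF S c] by blast
      then show ?thesis unfolding E(5)[symmetric] by (auto split: if_splits)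
    qed
    finally show "emeasure ?N A = chart_volume S \<mu> c A" .
  qed
  have uniq: "N1 = N2" if "?P N1" "?P N2" for N1 N2
  proof (rule measure_eqI)
    show "sets N1 = sets N2" using that by simp
    have *: "emeasure N A = ?m A" if N: "?P N" and A: "A \<in> sets (mfd_borel S)" for N A
    proof -
      have s: "sets N = sets (mfd_borel S)" using N unfolding P by blast
      have "emeasure N A = (\<Sum>i<n. emeasure N (A \<inter> E i))"
        by (rule sum_emeasure_cover) (use A E(2,4,5) s sets.sets_into_space[OF A] S in auto)
      also have "\<dots> = ?m A"
      proof (rule sum.cong[OF refl])
        fix i assume "i \<in> {..<n}"
        then have i: "i < n" by simp
        have "A \<inter> E i \<in> sets N" "A \<inter> E i \<subseteq> fst (cc i)" using A E(2,3)[OF i] s by auto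
        then show "emeasure N (A \<inter> E i) = chart_volume S \<mu> (cc i) (A \<inter> E i)"
          using N E(1)[OF i] unfolding P by blast
      qed
      finally show ?thesis .
    qed
    fix A assume "A \<in> sets N1"
    then have "A \<in> sets (mfd_borel S)" using that(1) unfolding P by simp
    then show "emeasure N1 A = emeasure N2 A" using *[OF that(1)] *[OF that(2)] by simp
  qed
  show ?thesis by (rule ex1I[of ?P, OF N uniq[OF _ N]])
qed

abbreviation (input) "\<N> \<equiv> volume_measure S \<mu>"

lemma space_volume_measure: "space \<N> = points S"
  and sets_volume_measure: "sets \<N> = sets (mfd_borel S)"
  and emeasure_volume_measure: "c \<in> atlas S \<Longrightarrow> A \<in> sets (mfd_borel S) \<Longrightarrow> A \<subseteq> fst c \<Longrightarrow> emeasure \<N> A = chart_volume S \<mu> c A"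
proof -
  note * = theI'[OF volume_measure_unique_existence, folded volume_measure_def]
  show "space \<N> = points S" "sets \<N> = sets (mfd_borel S)" using * by (auto simp: sets_mfd_borel[OF S])
  assume "c \<in> atlas S" "A \<in> sets (mfd_borel S)" "A \<subseteq> fst c"
  then have "emeasure \<N> A = (\<integral>\<^sup>+ y. ennreal (\<mu> c (chart_inv c y)) * indicator (snd c ` A) y \<partial>lborel_span (model_basis S))"
    using * by (simp add: sets_mfd_borel[OF S])
  also have "\<dots> = chart_volume S \<mu> c A"
    unfolding chart_volume_def by (intro nn_integral_cong) (simp split: split_indicator)
  finally show "emeasure \<N> A = chart_volume S \<mu> c A" .
qed

lemma measurable_volume_measure: "measurable \<N> N = measurable (mfd_borel S) N"
  by (rule measurable_cong_sets) (simp_all add: sets_volume_measure)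

text \<open>On a small coordinate ball the density is at most its value at the centre plus 1, so the
  measure is locally finite; compactness does the rest.\<close>

lemma emeasure_volume_measure_finite: "emeasure \<N> (points S) < \<infinity>"
proof -
  have "\<exists>W. openin (mtop S) W \<and> p \<in> W \<and> emeasure \<N> W < \<infinity>" if p: "p \<in> points S" for p
  proof -
    obtain c where c: "c \<in> atlas S" "p \<in> fst c" using premanifold_chart_at[OF S p] .
    let ?g = "\<lambda>y. \<mu> c (chart_inv c y)"
    have "continuous_on (snd c ` fst c) ?g" by (rule smooth_on_continuous_on[OF volume_form_smooth[OF c(1)]])
    then obtain r where r: "r > 0" "\<And>y. y \<in> snd c ` fst c \<Longrightarrow> dist y (snd c p) < r \<Longrightarrow> dist (?g y) (?g (snd c p)) < 1"
      unfolding continuous_on_iff using c(2) by (metis imageI zero_less_one)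
    let ?W = "{x \<in> fst c. snd c x \<in> model_space S \<inter> ball (snd c p) r}" and ?K = "?g (snd c p) + 1"
    have W: "openin (mtop S) ?W" by (rule openin_chart_vimage[OF S openin_open_Int[OF open_ball] c(1)])
    have "emeasure \<N> ?W = chart_volume S \<mu> c ?W"
      by (rule emeasure_volume_measure[OF c(1) openin_sets_mfd_borel[OF S W]]) auto
    also have "\<dots> \<le> (\<integral>\<^sup>+ y. ennreal ?K * indicator (ball (snd c p) r) y \<partial>lborel_span (model_basis S))"
      unfolding chart_volume_def
    proof (rule nn_integral_mono)
      fix y
      show "ennreal (indicator (snd c ` ?W) y * ?g y) \<le> ennreal ?K * indicator (ball (snd c p) r) y"
      proof (cases "y \<in> snd c ` ?W")
        case True
        then have "y \<in> snd c ` fst c" "y \<in> ball (snd c p) r" by auto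
        moreover from this have "?g y \<le> ?K" using r(2)[of y] by (auto simp: dist_commute dist_real_def)
        ultimately show ?thesis using True by (simp add: ennreal_leI)
      qed simp
    qed
    also have "\<dots> = ennreal ?K * emeasure (lborel_span (model_basis S)) (ball (snd c p) r)"
      by (rule nn_integral_cmult_indicator) simp
    also have "\<dots> < \<infinity>"
      using emeasure_lborel_span_ball_finite[OF premanifold_model_basis[OF S]] by (simp add: ennreal_mult_less_top)
    finally have "emeasure \<N> ?W < \<infinity>" .
    moreover have "p \<in> ?W" using c r(1) chart_image_subset[OF S c(1)] by auto
    ultimately show ?thesis using W by blast
  qed
  then have "points S \<subseteq> \<Union>{W. openin (mtop S) W \<and> emeasure \<N> W < \<infinity>}" by blast
  then obtain F where F: "finite F" "F \<subseteq> {W. openin (mtop S) W \<and> emeasure \<N> W < \<infinity>}" "points S \<subseteq> \<Union>F"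
    using comp[unfolded compact_space_alt, rule_format, of "{W. openin (mtop S) W \<and> emeasure \<N> W < \<infinity>}"]
    by (auto simp: topspace_mtop[OF S])
  have Fs: "F \<subseteq> sets \<N>" using F(2) openin_sets_mfd_borel[OF S] sets_volume_measure by blast
  have "emeasure \<N> (points S) \<le> emeasure \<N> (\<Union>F)"
    using F Fs by (intro emeasure_mono) (auto intro: sets.finite_Union)
  also have "\<dots> \<le> (\<Sum>W\<in>F. emeasure \<N> W)"
    using emeasure_subadditive_finite[of F id \<N>] F(1) Fs by simp
  also have "\<dots> < \<infinity>" using F(1,2) by (auto simp: ennreal_sum_less_top)
  finally show ?thesis .
qed

text \<open>In a chart, a positive density is integrated over a nonempty relatively open set, which
  is not a null set. This is why the integral of a bump function detects its support.\<close>

lemma emeasure_volume_measure_pos: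
  assumes U: "openin (mtop S) U" and p: "p \<in> U"
  shows "emeasure \<N> U > 0"
proof -
  have "p \<in> points S" using U p openin_mtop[OF S] by auto
  then obtain c where c: "c \<in> atlas S" "p \<in> fst c" using premanifold_chart_at[OF S] by blast
  let ?A = "U \<inter> fst c" and ?leb = "lborel_span (model_basis S)"
  have A: "openin (mtop S) ?A" using U openin_chart_domain[OF S c(1)] by blast
  note As = openin_sets_mfd_borel[OF S A]
  have cA: "snd c ` ?A \<in> sets borel" by (rule chart_image_borel[OF S c(1) As]) simp
  let ?f = "\<lambda>y. ennreal (indicator (snd c ` ?A) y * \<mu> c (chart_inv c y))"
  have m: "?f \<in> borel_measurable ?leb"
    using borel_measurable_chart_density[OF c(1) As Int_lower2] by (simp cong: measurable_cong_sets)
  have "?f y \<noteq> 0 \<longleftrightarrow> y \<in> snd c ` ?A" for y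
  proof (cases "y \<in> snd c ` ?A")
    case True
    then obtain x where "x \<in> fst c" "y = snd c x" by blast
    then show ?thesis using True volume_form_pos[OF c(1), of x] chart_inv_chart[OF S c(1), of x] by simp
  qed simp
  then have "{y \<in> space ?leb. ?f y \<noteq> 0} = snd c ` ?A" by simp
  moreover have "emeasure ?leb (snd c ` ?A) > 0"
    by (rule emeasure_lborel_span_pos[OF premanifold_model_basis[OF S] openin_chart_image[OF S U c(1)] _ cA])
      (use p c in blast)
  ultimately have "chart_volume S \<mu> c ?A \<noteq> 0"
    unfolding chart_volume_def using nn_integral_0_iff[OF m] by simp
  then have "0 < emeasure \<N> ?A"
    using emeasure_volume_measure[OF c(1) As] by (simp add: zero_less_iff_neq_zero)
  also have "\<dots> \<le> emeasure \<N> U"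
    using openin_sets_mfd_borel[OF S U] by (intro emeasure_mono) (auto simp: sets_volume_measure)
  finally show ?thesis .
qed

section \<open>Volume preservation in terms of the measure\<close>

lemma diffeos_image_measurable:
  assumes "\<psi> \<in> diffeos S" "A \<in> sets (mfd_borel S)"
  shows "\<psi> ` A \<in> sets (mfd_borel S)"
proof -
  obtain \<psi>' where \<psi>': "\<psi>' \<in> diffeos S" "\<And>x. x \<in> points S \<Longrightarrow> \<psi>' (\<psi> x) = x" "\<And>x. x \<in> points S \<Longrightarrow> \<psi> (\<psi>' x) = x"
    using assms(1) by (rule diffeosE) blast
  have As: "A \<subseteq> points S" using sets.sets_into_space[OF assms(2)] by (simp add: S)
  have "\<psi>' \<in> measurable (mfd_borel S) (mfd_borel S)"
    using diffeos_smooth_map[OF \<psi>'(1)] by (intro measurable_continuous_map[OF S]) (simp add: smooth_map_def)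
  from measurable_sets[OF this assms(2)] have "\<psi>' -` A \<inter> points S \<in> sets (mfd_borel S)" by (simp add: S)
  moreover have "\<psi>' -` A \<inter> points S = \<psi> ` A"
  proof (intro equalityI subsetI)
    fix x assume "x \<in> \<psi>' -` A \<inter> points S"
    then show "x \<in> \<psi> ` A" using \<psi>'(3)[of x] by (metis IntE image_eqI vimageD)
  next
    fix x assume "x \<in> \<psi> ` A"
    then show "x \<in> \<psi>' -` A \<inter> points S" using \<psi>'(2) As diffeos_in[OF assms(1)] by auto
  qed
  ultimately show ?thesis by simp
qed

text \<open>The Jacobian condition concerns one pair of charts at a time. Therefore \<open>A\<close>
  is cut by a chart partition of the source, and each piece by the preimages of a chart partition of
  the target, until a single pair of charts suffices.\<close>

lemma preserves_volume_emeasure: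
  assumes \<psi>: "\<psi> \<in> diffeos S" and pres: "preserves_volume S \<mu> \<psi>" and A: "A \<in> sets (mfd_borel S)"
  shows "emeasure \<N> (\<psi> ` A) = emeasure \<N> A"
proof -
  note sm = diffeos_smooth_map[OF \<psi>]
  have inj: "inj_on \<psi> (points S)" using \<psi> by (auto simp: diffeos_def bij_betw_def)
  have \<psi>m: "\<psi> \<in> measurable (mfd_borel S) (mfd_borel S)"
    using sm by (intro measurable_continuous_map[OF S]) (simp add: smooth_map_def)
  obtain n :: nat and cc E where E0: "\<forall>i<n. cc i \<in> atlas S \<and> E i \<in> sets (mfd_borel S) \<and> E i \<subseteq> fst (cc i)"
    and E45: "disjoint_family_on E {..<n}" "(\<Union>i<n. E i) = points S"
    by (rule chart_partition)
  have E123: "cc i \<in> atlas S" "E i \<in> sets (mfd_borel S)" "E i \<subseteq> fst (cc i)" if "i < n" for i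
    using E0 that by auto
  note E = E123 E45
  have sub: "A \<subseteq> points S" if "A \<in> sets (mfd_borel S)" for A using sets.sets_into_space[OF that] by (simp add: S)
  have small: "emeasure \<N> (\<psi> ` A) = emeasure \<N> A"
    if c: "c \<in> atlas S" and d: "d \<in> atlas S" and A: "A \<in> sets (mfd_borel S)" "A \<subseteq> {x \<in> fst c. \<psi> x \<in> fst d}" for c d A
  proof -
    have eq: "abs_jacobian (model_basis S) (snd d \<circ> \<psi> \<circ> chart_inv c) (snd c p) * \<mu> d (\<psi> p) = \<mu> c p" if "p \<in> A" for p
    proof -
      have "p \<in> fst c" "\<psi> p \<in> fst d" using that A(2) by auto
      then show ?thesis using pres c d unfolding preserves_volume_def by blast
    qed
    note \<psi>A = diffeos_image_measurable[OF \<psi> A(1)]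
    have "chart_volume S \<mu> d (\<psi> ` A) = chart_volume S \<mu> c A"
      using chart_volume_image_le[OF sm inj c d A \<psi>A, of 1] eq by (intro antisym) auto
    moreover have "A \<subseteq> fst c" "\<psi> ` A \<subseteq> fst d" using A(2) by auto
    ultimately show ?thesis
      using emeasure_volume_measure[OF c A(1)] emeasure_volume_measure[OF d \<psi>A] by simp
  qed
  have medium: "emeasure \<N> (\<psi> ` A) = emeasure \<N> A"
    if c: "c \<in> atlas S" and A: "A \<in> sets (mfd_borel S)" "A \<subseteq> fst c" for c A
  proof -
    let ?D = "\<lambda>j. \<psi> -` E j \<inter> points S"
    have D: "?D j \<in> sets (mfd_borel S)" if "j < n" for j
      using measurable_sets[OF \<psi>m E(2)[OF that]] by (simp add: S)
    have Dd: "disjoint_family_on ?D {..<n}" using E(4) by (fastforce simp: disjoint_family_on_def)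
    have "emeasure \<N> (\<psi> ` A) = (\<Sum>j<n. emeasure \<N> (\<psi> ` A \<inter> E j))"
      using diffeos_image_measurable[OF \<psi> A(1)] sub E
      by (intro sum_emeasure_cover) (auto simp: sets_volume_measure)
    also have "\<dots> = (\<Sum>j<n. emeasure \<N> (A \<inter> ?D j))"
    proof (rule sum.cong[OF refl])
      fix j assume "j \<in> {..<n}"
      then have j: "j < n" by simp
      have "\<psi> ` A \<inter> E j = \<psi> ` (A \<inter> ?D j)" using sub[OF A(1)] by auto
      moreover have "emeasure \<N> (\<psi> ` (A \<inter> ?D j)) = emeasure \<N> (A \<inter> ?D j)"
        by (rule small[OF c E(1)[OF j]]) (use A D[OF j] E(3)[OF j] in auto)
      ultimately show "emeasure \<N> (\<psi> ` A \<inter> E j) = emeasure \<N> (A \<inter> ?D j)" by simp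
    qed
    also have "\<dots> = emeasure \<N> A"
    proof (rule sum_emeasure_cover[symmetric])
      show "A \<subseteq> (\<Union>j\<in>{..<n}. ?D j)"
      proof
        fix x assume "x \<in> A"
        then have x: "x \<in> points S" using sub[OF A(1)] by blast
        then have "\<psi> x \<in> (\<Union>i<n. E i)" unfolding E(5) by (rule diffeos_in[OF \<psi>])
        then show "x \<in> (\<Union>j\<in>{..<n}. ?D j)" using x by blast
      qed
    qed (use A D Dd in \<open>auto simp: sets_volume_measure\<close>)
    finally show ?thesis .
  qed
  have "emeasure \<N> (\<psi> ` A) = (\<Sum>i<n. emeasure \<N> (\<psi> ` A \<inter> \<psi> ` E i))"
  proof (rule sum_emeasure_cover)
    show "\<psi> ` A \<subseteq> (\<Union>i\<in>{..<n}. \<psi> ` E i)" using sub[OF A] E(5) by blast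
    show "disjoint_family_on (\<lambda>i. \<psi> ` E i) {..<n}"
      unfolding disjoint_family_on_def
    proof (intro ballI impI)
      fix i j assume ij: "i \<in> {..<n}" "j \<in> {..<n}" "i \<noteq> j"
      have "E i \<inter> E j = {}" using E(4) ij by (auto simp: disjoint_family_on_def)
      then show "\<psi> ` E i \<inter> \<psi> ` E j = {}"
        using inj_on_image_Int[OF inj sub[OF E(2)] sub[OF E(2)], of i j] ij by simp
    qed
  qed (use A E(2) diffeos_image_measurable[OF \<psi>] in \<open>auto simp: sets_volume_measure\<close>)
  also have "\<dots> = (\<Sum>i<n. emeasure \<N> (A \<inter> E i))"
  proof (rule sum.cong[OF refl])
    fix i assume "i \<in> {..<n}"
    then have i: "i < n" by simp
    have "\<psi> ` A \<inter> \<psi> ` E i = \<psi> ` (A \<inter> E i)"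
      using inj_on_image_Int[OF inj sub[OF A] sub[OF E(2)[OF i]]] by simp
    moreover have "emeasure \<N> (\<psi> ` (A \<inter> E i)) = emeasure \<N> (A \<inter> E i)"
      by (rule medium[OF E(1)[OF i]]) (use A E(2,3)[OF i] in auto)
    ultimately show "emeasure \<N> (\<psi> ` A \<inter> \<psi> ` E i) = emeasure \<N> (A \<inter> E i)" by simp
  qed
  also have "\<dots> = emeasure \<N> A"
    by (rule sum_emeasure_cover[symmetric]) (use A E sub[OF A] in \<open>auto simp: sets_volume_measure\<close>)
  finally show ?thesis .
qed

lemma preserves_volume_integral:
  fixes h :: "'s \<Rightarrow> real"
  assumes \<psi>: "\<psi> \<in> diffeos S" and pres: "preserves_volume S \<mu> \<psi>" and h: "h \<in> borel_measurable (mfd_borel S)"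
  shows "(LINT x|\<N>. h (\<psi> x)) = (LINT x|\<N>. h x)"
proof -
  have \<psi>m: "\<psi> \<in> measurable \<N> \<N>"
    using measurable_continuous_map[OF S, of \<psi>] diffeos_smooth_map[OF \<psi>]
    by (simp add: smooth_map_def sets_volume_measure cong: measurable_cong_sets)
  have bij: "bij_betw \<psi> (points S) (points S)" using \<psi> by (simp add: diffeos_def)
  have "distr \<N> \<N> \<psi> = \<N>"
  proof (rule measure_eqI)
    fix A assume "A \<in> sets (distr \<N> \<N> \<psi>)"
    then have A: "A \<in> sets \<N>" by simp
    let ?A = "\<psi> -` A \<inter> space \<N>"
    have "A \<subseteq> \<psi> ` points S" using sets.sets_into_space[OF A] bij by (simp add: bij_betw_def space_volume_measure)
    then have "\<psi> ` ?A = A" by (auto simp: space_volume_measure)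
    moreover have "?A \<in> sets (mfd_borel S)" using measurable_sets[OF \<psi>m A] by (simp add: sets_volume_measure)
    ultimately show "emeasure (distr \<N> \<N> \<psi>) A = emeasure \<N> A"
      using preserves_volume_emeasure[OF \<psi> pres, of ?A] by (simp add: emeasure_distr[OF \<psi>m A])
  qed simp
  moreover have "(LINT x|distr \<N> \<N> \<psi>. h x) = (LINT x|\<N>. h (\<psi> x))"
    by (rule integral_distr[OF \<psi>m]) (use h in \<open>simp add: measurable_volume_measure\<close>)
  ultimately show ?thesis by simp
qed

text \<open>Where the Jacobian identity fails, one side lies strictly below \<open>r\<close> times
  the other for some \<open>r < 1\<close>. By continuity this persists on an open set, and
  integration over its Borel subsets compares the measures.\<close>

lemma not_preserves_volumeE:
  assumes \<psi>: "\<psi> \<in> diffeos S" and npres: "\<not> preserves_volume S \<mu> \<psi>"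
  obtains U r where "openin (mtop S) U" "U \<noteq> {}" "0 \<le> r" "r < 1"
    "(\<forall>A\<in>sets (mfd_borel S). A \<subseteq> U \<longrightarrow> emeasure \<N> (\<psi> ` A) \<le> ennreal r * emeasure \<N> A) \<or>
     (\<forall>A\<in>sets (mfd_borel S). A \<subseteq> U \<longrightarrow> emeasure \<N> A \<le> ennreal r * emeasure \<N> (\<psi> ` A))"
proof -
  note sm = diffeos_smooth_map[OF \<psi>]
  have inj: "inj_on \<psi> (points S)" using \<psi> by (auto simp: diffeos_def bij_betw_def)
  obtain c d p where c: "c \<in> atlas S" "p \<in> fst c" and d: "d \<in> atlas S" "\<psi> p \<in> fst d"
    and ne: "abs_jacobian (model_basis S) (snd d \<circ> \<psi> \<circ> chart_inv c) (snd c p) * \<mu> d (\<psi> p) \<noteq> \<mu> c p"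
    using npres unfolding preserves_volume_def by blast
  let ?W = "{x \<in> fst c. \<psi> x \<in> fst d}"
  let ?X = "snd c ` ?W" and ?F = "snd d \<circ> \<psi> \<circ> chart_inv c"
  let ?a = "\<lambda>y. abs_jacobian (model_basis S) ?F y * \<mu> d (\<psi> (chart_inv c y))" and ?b = "\<lambda>y. \<mu> c (chart_inv c y)"
  note B = premanifold_model_basis[OF S]
  note X = smooth_map_on_charts(2)[OF S S sm c(1) d(1)]
  have F: "smooth_on ?X ?F" using smooth_map_on_charts(3)[OF S S sm c(1) d(1)] by (simp add: o_def)
  have pX: "snd c p \<in> ?X" using c d by auto
  have "smooth_on ?X (\<lambda>y. \<mu> d (chart_inv d (?F y)))"
    by (rule smooth_on_compose[OF F volume_form_smooth[OF d(1)]]) (use chart_inv_chart[OF S c(1)] in auto)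
  then have "smooth_on ?X (\<lambda>y. \<mu> d (\<psi> (chart_inv c y)))"
    by (rule smooth_on_cong) (use chart_inv_chart[OF S c(1)] chart_inv_chart[OF S d(1)] in auto)
  then have ca: "continuous_on ?X ?a"
    by (intro continuous_on_mult continuous_on_abs_jacobian[OF B X F] smooth_on_continuous_on)
  have cb: "continuous_on ?X ?b"
    by (rule smooth_on_continuous_on[OF smooth_on_subset[OF volume_form_smooth[OF c(1)]]]) auto
  have pos: "?a y \<ge> 0 \<and> ?b y > 0" if "y \<in> ?X" for y
  proof -
    from \<open>y \<in> ?X\<close> obtain x where "x \<in> fst c" "\<psi> x \<in> fst d" "y = snd c x" by blast
    then show ?thesis
      using volume_form_pos[OF c(1), of x] volume_form_pos[OF d(1), of "\<psi> x"] chart_inv_chart[OF S c(1), of x]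
      by (simp add: abs_jacobian_def)
  qed
  have open_less: "openin (mtop S) {x \<in> ?W. f (snd c x) < r * g (snd c x)}"
    if "continuous_on ?X f" "continuous_on ?X g" for f g :: "real^'n::_ \<Rightarrow> real" and r
  proof (rule openin_mtop_chart[OF S c(1)])
    have "continuous_on ?X (\<lambda>y. f y - r * g y)" using that by (intro continuous_intros)
    from continuous_openin_preimage_gen[OF this, of "{..<0}"]
    have "openin (top_of_set ?X) (?X \<inter> (\<lambda>y. f y - r * g y) -` {..<0})" by simp
    moreover have "snd c ` {x \<in> ?W. f (snd c x) < r * g (snd c x)} = ?X \<inter> (\<lambda>y. f y - r * g y) -` {..<0}" by auto
    ultimately show "openin (top_of_set (model_space S)) (snd c ` {x \<in> ?W. f (snd c x) < r * g (snd c x)})"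
      using openin_trans[OF _ X] by simp
  qed auto
  \<comment> \<open>The witness is the midpoint between \<open>s / t\<close> and 1.\<close>
  have ratio: "\<exists>r\<ge>0. r < 1 \<and> s < r * t" if "0 \<le> s" "s < t" for s t :: real
    using that by (intro exI[of _ "(s / t + 1) / 2"]) (auto simp: field_simps)
  have cp: "chart_inv c (snd c x) = x" if "x \<in> fst c" for x using chart_inv_chart[OF S c(1) that] .
  have meas: "emeasure \<N> A = chart_volume S \<mu> c A" "emeasure \<N> (\<psi> ` A) = chart_volume S \<mu> d (\<psi> ` A)" "\<psi> ` A \<in> sets (mfd_borel S)"
    if "A \<in> sets (mfd_borel S)" "A \<subseteq> ?W" for A
    using emeasure_volume_measure[OF c(1) that(1)] emeasure_volume_measure[OF d(1) diffeos_image_measurable[OF \<psi> that(1)]]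
      diffeos_image_measurable[OF \<psi> that(1)] that(2) by auto
  consider "?a (snd c p) < ?b (snd c p)" | "?b (snd c p) < ?a (snd c p)" using ne cp[OF c(2)] by fastforce
  then show thesis
  proof cases
    case 1
    obtain r where r: "r \<ge> 0" "r < 1" "?a (snd c p) < r * ?b (snd c p)" using ratio[OF _ 1] pos[OF pX] by auto
    let ?U = "{x \<in> ?W. ?a (snd c x) < r * ?b (snd c x)}"
    have "emeasure \<N> (\<psi> ` A) \<le> ennreal r * emeasure \<N> A" if A: "A \<in> sets (mfd_borel S)" "A \<subseteq> ?U" for A
    proof -
      have AW: "A \<subseteq> ?W" using A(2) by blast
      show ?thesis
        unfolding meas(1,2)[OF A(1) AW]
        by (rule chart_volume_image_le(1)[OF sm inj c(1) d(1) A(1) AW meas(3)[OF A(1) AW] r(1)])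
          (use A(2) cp in auto)
    qed
    moreover have "p \<in> ?U" using c(2) d(2) r(3) by simp
    ultimately show ?thesis using that[OF open_less[OF ca cb] _ r(1,2)] by blast
  next
    case 2
    obtain r where r: "r \<ge> 0" "r < 1" "?b (snd c p) < r * ?a (snd c p)" using ratio[OF _ 2] pos[OF pX] by auto
    let ?U = "{x \<in> ?W. ?b (snd c x) < r * ?a (snd c x)}"
    have "emeasure \<N> A \<le> ennreal r * emeasure \<N> (\<psi> ` A)" if A: "A \<in> sets (mfd_borel S)" "A \<subseteq> ?U" for A
    proof -
      have AW: "A \<subseteq> ?W" using A(2) by blast
      show ?thesis
        unfolding meas(1,2)[OF A(1) AW]
        by (rule chart_volume_image_le(2)[OF sm inj c(1) d(1) A(1) AW meas(3)[OF A(1) AW] r(1)])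
          (use A(2) cp in auto)
    qed
    moreover have "p \<in> ?U" using c(2) d(2) r(3) by simp
    ultimately show ?thesis using that[OF open_less[OF cb ca] _ r(1,2)] by blast
  qed
qed

end

end

text \<open>Restricted to \<open>U\<close>, the measure \<open>N'\<close> is dominated by
  \<open>r\<close> times \<open>N\<close>, and \<open>k\<close> does not see the complement of
  \<open>U\<close>. Densities by \<open>indicator U\<close> express the restriction on an unchanged
  space, so monotonicity of the integral in the measure applies.\<close>

lemma nn_integral_le_of_emeasure_le:
  assumes s: "sets N' = sets N" and U: "U \<in> sets N" and k[measurable]: "k \<in> borel_measurable N"
    and k0: "\<And>x. x \<in> space N - U \<Longrightarrow> k x = 0"
    and le: "\<And>A. A \<in> sets N \<Longrightarrow> A \<subseteq> U \<Longrightarrow> emeasure N' A \<le> r * emeasure N A"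
  shows "(\<integral>\<^sup>+ x. k x \<partial>N') \<le> r * (\<integral>\<^sup>+ x. k x \<partial>N)"
proof -
  note sp = sets_eq_imp_space_eq[OF s]
  have k'[measurable]: "k \<in> borel_measurable N'" using k by (simp add: measurable_cong_sets[OF s refl])
  have iU: "indicator U \<in> borel_measurable N" "indicator U \<in> borel_measurable N'" using U s by auto
  let ?P' = "density N' (indicator U)" and ?P = "scale_measure r (density N (indicator U))"
  have "?P' \<le> ?P"
  proof (subst le_measure)
    show "\<forall>A\<in>sets ?P'. emeasure ?P' A \<le> emeasure ?P A"
    proof
      fix A assume "A \<in> sets ?P'"
      then have A: "A \<in> sets N" "A \<in> sets N'" using s by auto
      have "emeasure ?P' A = emeasure N' (U \<inter> A)" "emeasure ?P A = r * emeasure N (U \<inter> A)"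
        using A U s by (simp_all add: emeasure_density iU flip: indicator_inter_arith)
      then show "emeasure ?P' A \<le> emeasure ?P A" using le[of "U \<inter> A"] U A by auto
    qed
  qed (simp add: s)
  then have "(\<integral>\<^sup>+ x. k x \<partial>?P') \<le> (\<integral>\<^sup>+ x. k x \<partial>?P)" by (intro nn_integral_mono_measure) (simp_all add: s)
  moreover have "(\<integral>\<^sup>+ x. k x \<partial>?P') = (\<integral>\<^sup>+ x. k x \<partial>N')"
    using k0 by (subst nn_integral_density[OF iU(2) k']) (auto intro!: nn_integral_cong simp: sp indicator_def)
  moreover have "(\<integral>\<^sup>+ x. k x \<partial>?P) = r * (\<integral>\<^sup>+ x. k x \<partial>N)"
    using k0 by (subst nn_integral_scale_measure, simp, subst nn_integral_density[OF iU(1) k])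
      (auto intro!: arg_cong[of _ _ "(*) r"] nn_integral_cong simp: indicator_def)
  ultimately show ?thesis by simp
qed

text \<open>If the volume were not preserved, \<open>\<psi>\<close> would contract or expand it on some open set by a definite
  factor, which a function \<open>g\<close> supported there detects.\<close>

lemma preserves_volumeI:
  fixes S :: "('s, real ^ 'n::{finite,wellorder}) mfd" and \<mu> :: "('s, real ^ 'n::_) volume"
  assumes S: "premanifold S" and vol: "volume_form S \<mu>" and comp: "compact_space (mtop S)"
    and \<psi>: "\<psi> \<in> diffeos S"
    and test: "\<And>U. openin (mtop S) U \<Longrightarrow> U \<noteq> {} \<Longrightarrow> \<exists>g\<in>borel_measurable (mfd_borel S).
        (\<forall>x\<in>points S - U. g (\<psi> x) = 0) \<and> 0 < (\<integral>\<^sup>+ x. g x \<partial>volume_measure S \<mu>) \<and> (\<integral>\<^sup>+ x. g x \<partial>volume_measure S \<mu>) < \<infinity> \<and>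
        (\<integral>\<^sup>+ x. g (\<psi> x) \<partial>volume_measure S \<mu>) = (\<integral>\<^sup>+ x. g x \<partial>volume_measure S \<mu>)"
  shows "preserves_volume S \<mu> \<psi>"
proof (rule ccontr)
  let ?\<nu> = "volume_measure S \<mu>"
  note sets\<nu> = sets_volume_measure[OF S vol comp] and space\<nu> = space_volume_measure[OF S vol comp]
  assume "\<not> preserves_volume S \<mu> \<psi>"
  then obtain U r where U: "openin (mtop S) U" "U \<noteq> {}" and r: "0 \<le> r" "r < 1" and
    le: "(\<forall>A\<in>sets (mfd_borel S). A \<subseteq> U \<longrightarrow> emeasure ?\<nu> (\<psi> ` A) \<le> ennreal r * emeasure ?\<nu> A) \<or>
     (\<forall>A\<in>sets (mfd_borel S). A \<subseteq> U \<longrightarrow> emeasure ?\<nu> A \<le> ennreal r * emeasure ?\<nu> (\<psi> ` A))"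
    by (rule not_preserves_volumeE[OF S vol comp \<psi>])
  obtain g where g: "g \<in> borel_measurable (mfd_borel S)" "\<And>x. x \<in> points S - U \<Longrightarrow> g (\<psi> x) = 0"
    "0 < (\<integral>\<^sup>+ x. g x \<partial>?\<nu>)" "(\<integral>\<^sup>+ x. g x \<partial>?\<nu>) < \<infinity>" "(\<integral>\<^sup>+ x. g (\<psi> x) \<partial>?\<nu>) = (\<integral>\<^sup>+ x. g x \<partial>?\<nu>)"
    using test[OF U] by blast
  obtain \<psi>' where \<psi>': "\<psi>' \<in> diffeos S" "\<And>x. x \<in> points S \<Longrightarrow> \<psi>' (\<psi> x) = x" "\<And>x. x \<in> points S \<Longrightarrow> \<psi> (\<psi>' x) = x"
    using \<psi> by (rule diffeosE) blast
  have meas: "\<phi> \<in> measurable (mfd_borel S) (mfd_borel S)" if "\<phi> \<in> diffeos S" for \<phi>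
    using measurable_continuous_map[OF S, of \<phi>] diffeos_smooth_map[OF that] by (simp add: smooth_map_def)
  have \<psi>'m: "\<psi>' \<in> measurable ?\<nu> ?\<nu>"
    using meas[OF \<psi>'(1)] by (simp add: sets\<nu> cong: measurable_cong_sets)
  \<comment> \<open>The pushforward along the inverse measures a set by the volume of its image
    under \<psi>, so the two alternatives become comparisons of \<open>?\<nu>'\<close> with the
    volume itself.\<close>
  let ?\<nu>' = "distr ?\<nu> ?\<nu> \<psi>'" and ?k = "\<lambda>x. g (\<psi> x)"
  have k: "?k \<in> borel_measurable ?\<nu>"
    using measurable_compose[OF meas[OF \<psi>] g(1)] by (simp add: sets\<nu> cong: measurable_cong_sets)
  have em': "emeasure ?\<nu>' A = emeasure ?\<nu> (\<psi> ` A)" if A: "A \<in> sets ?\<nu>" for A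
  proof -
    have "A \<subseteq> points S" using sets.sets_into_space[OF A] space\<nu> by simp
    then have "\<psi>' -` A \<inter> space ?\<nu> = \<psi> ` A"
      using \<psi>'(2,3) diffeos_in[OF \<psi>] by (force simp: space\<nu>)
    then show ?thesis using A by (simp add: emeasure_distr[OF \<psi>'m])
  qed
  have "(\<integral>\<^sup>+ x. ?k x \<partial>?\<nu>') = (\<integral>\<^sup>+ x. g (\<psi> (\<psi>' x)) \<partial>?\<nu>)"
    by (rule nn_integral_distr[OF \<psi>'m]) (use k in simp)
  also have "\<dots> = (\<integral>\<^sup>+ x. g x \<partial>?\<nu>)" by (intro nn_integral_cong) (simp add: space\<nu> \<psi>'(3))
  finally have I': "(\<integral>\<^sup>+ x. ?k x \<partial>?\<nu>') = (\<integral>\<^sup>+ x. g x \<partial>?\<nu>)" .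
  have Us: "U \<in> sets ?\<nu>" using openin_sets_mfd_borel[OF S U(1)] sets\<nu> by simp
  have "(\<integral>\<^sup>+ x. g x \<partial>?\<nu>) \<le> ennreal r * (\<integral>\<^sup>+ x. g x \<partial>?\<nu>)"
    using le
  proof
    assume *: "\<forall>A\<in>sets (mfd_borel S). A \<subseteq> U \<longrightarrow> emeasure ?\<nu> (\<psi> ` A) \<le> ennreal r * emeasure ?\<nu> A"
    have "(\<integral>\<^sup>+ x. ?k x \<partial>?\<nu>') \<le> ennreal r * (\<integral>\<^sup>+ x. ?k x \<partial>?\<nu>)"
      by (rule nn_integral_le_of_emeasure_le[OF _ Us k]) (use g(2) * em' in \<open>auto simp: space\<nu> sets\<nu>\<close>)
    then show ?thesis using I' g(5) by simp
  next
    assume *: "\<forall>A\<in>sets (mfd_borel S). A \<subseteq> U \<longrightarrow> emeasure ?\<nu> A \<le> ennreal r * emeasure ?\<nu> (\<psi> ` A)"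
    have "(\<integral>\<^sup>+ x. ?k x \<partial>?\<nu>) \<le> ennreal r * (\<integral>\<^sup>+ x. ?k x \<partial>?\<nu>')"
      by (rule nn_integral_le_of_emeasure_le[of _ _ U]) (use Us k g(2) * em' in \<open>auto simp: space\<nu> sets\<nu>\<close>)
    then show ?thesis using I' g(5) by simp
  qed
  \<comment> \<open>By the test equation \<open>?k\<close> has the same integral against both
    measures, that of \<open>g\<close>. In either alternative this positive finite number is at most
    \<open>r < 1\<close> times itself.\<close>
  moreover obtain t where t: "(\<integral>\<^sup>+ x. g x \<partial>?\<nu>) = ennreal t" "t \<ge> 0"
    using g(4) by (cases "\<integral>\<^sup>+ x. g x \<partial>?\<nu>") auto
  ultimately have "t \<le> r * t" using r by (simp add: ennreal_mult'[symmetric])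
  moreover have "t > 0" using g(3) t by simp
  ultimately show False using r by (simp add: mult_le_cancel_right1)
qed

section \<open>Equivariant embeddings\<close>

locale equivariant_embedding_setting =
  fixes S :: "('s, real ^ 'n::{finite,wellorder}) mfd"
    and \<mu> :: "('s, real ^ 'n::{finite,wellorder}) volume"
    and M :: "('m, 'e::euclidean_space) mfd"
    and L :: "('g, 'f::euclidean_space) mfd"
    and G :: "'g monoid" (structure)
  assumes manifold_S: "manifold S" and compact_S: "compact_space (mtop S)" and volume_S: "volume_form S \<mu>"
    and manifold_M: "manifold M" and lie_group: "lie_group L G"
begin

lemma S: "premanifold S" and HS: "Hausdorff_space (mtop S)"
  and M: "premanifold M" and HM: "Hausdorff_space (mtop M)"
  and L: "premanifold L" and HL: "Hausdorff_space (mtop L)"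
  using manifold_S manifold_M lie_group by (auto simp: lie_group_def manifold_premanifold manifold_Hausdorff)

sublocale G: group G using lie_group by (simp add: lie_group_def)

lemma carrier_G[simp]: "carrier G = points L"
  using lie_group by (simp add: lie_group_def)

lemma group_closed[simp, intro]:
  "g \<in> points L \<Longrightarrow> k \<in> points L \<Longrightarrow> g \<otimes> k \<in> points L"
  "g \<in> points L \<Longrightarrow> inv g \<in> points L" "\<one> \<in> points L"
  using G.m_closed G.inv_closed G.one_closed by simp_all

lemma group_simps[simp]:
  "g \<in> points L \<Longrightarrow> \<one> \<otimes> g = g" "g \<in> points L \<Longrightarrow> g \<otimes> \<one> = g"
  "g \<in> points L \<Longrightarrow> inv (inv g) = g"
  "g \<in> points L \<Longrightarrow> inv g \<otimes> g = \<one>" "g \<in> points L \<Longrightarrow> g \<otimes> inv g = \<one>"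
  using G.l_one G.r_one G.inv_inv G.l_inv G.r_inv by simp_all

lemma group_assoc:
  "g \<in> points L \<Longrightarrow> h \<in> points L \<Longrightarrow> k \<in> points L \<Longrightarrow> g \<otimes> h \<otimes> k = g \<otimes> (h \<otimes> k)"
  using G.m_assoc by simp

abbreviation "\<A> \<equiv> S \<times>\<^sub>m L"
abbreviation "\<T> \<equiv> cotangent_bundle M \<times>\<^sub>m cotangent_bundle L"
abbreviation "\<Q> \<equiv> cotangent_bundle M \<times>\<^sub>m lie_dual_mfd L G"
abbreviation "\<nu> \<equiv> volume_measure S \<mu>"
abbreviation "\<eta> \<equiv> emb_eta S L G"
abbreviation "\<J> \<equiv> momentum_L S \<mu> M L G"
abbreviation "\<L> \<equiv> level_set S \<mu> M L G"

lemmas volume_assms = S volume_S compact_S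

lemmas TM = premanifold_cotangent_bundle[OF M HM] and TL = premanifold_cotangent_bundle[OF L HL]

lemma LD: "premanifold (lie_dual_mfd L G)" and HLD: "Hausdorff_space (mtop (lie_dual_mfd L G))"
  unfolding lie_dual_mfd_def
  by (auto intro: premanifold_cotangent_space_mfd[OF L HL] Hausdorff_cotangent_space_mfd[OF L HL])

lemmas A = premanifold_prod[OF S L] and T = premanifold_prod[OF TM TL] and Q = premanifold_prod[OF TM LD]

lemma HA: "Hausdorff_space (mtop \<A>)" and HQ: "Hausdorff_space (mtop \<Q>)"
  using HS HL HLD Hausdorff_cotangent_bundle[OF M HM]
  by (simp_all add: mtop_prod[OF S L] mtop_prod[OF TM LD] Hausdorff_space_prod_topology)

lemma points_A[simp]: "points \<A> = points S \<times> points L"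
  by (simp add: prod_mfd_def)

lemma smooth_right_transl: "k \<in> points L \<Longrightarrow> smooth_map L L (right_transl G k)"
proof -
  assume k: "k \<in> points L"
  have "smooth_map (L \<times>\<^sub>m L) L (\<lambda>(g, k). g \<otimes> k)" using lie_group by (simp add: lie_group_def)
  from smooth_map_compose[OF L premanifold_prod[OF L L] L
      smooth_map_Pair[OF L L L smooth_map_ident[OF L] smooth_map_const[OF L L k]] this]
  show ?thesis by (rule smooth_map_cong[OF L L]) (simp add: right_transl_def)
qed

section \<open>Equivariant diffeomorphisms and the maps they cover\<close>

definition equivariant :: "('s \<times> 'g \<Rightarrow> 's \<times> 'g) \<Rightarrow> bool" where
  "equivariant \<Phi> \<longleftrightarrow> (\<forall>x\<in>points S. \<forall>g\<in>points L. \<forall>k\<in>points L.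
     \<Phi> (x, g \<otimes> k) = (fst (\<Phi> (x, g)), snd (\<Phi> (x, g)) \<otimes> k))"

lemma equivariantD: "equivariant \<Phi> \<Longrightarrow> x \<in> points S \<Longrightarrow> g \<in> points L \<Longrightarrow> k \<in> points L \<Longrightarrow>
     \<Phi> (x, g \<otimes> k) = (fst (\<Phi> (x, g)), snd (\<Phi> (x, g)) \<otimes> k)"
  unfolding equivariant_def by blast

text \<open>Evaluation at the unit exhibits the map as a composite of smooth maps; for equivariant
  \<Phi> every other group element gives the same first component.\<close>

definition base_map :: "('s \<times> 'g \<Rightarrow> 's \<times> 'g) \<Rightarrow> 's \<Rightarrow> 's" where
  "base_map \<Phi> = (\<lambda>x\<in>points S. fst (\<Phi> (x, \<one>)))"

lemma base_map_eq:
  assumes "equivariant \<Phi>" "x \<in> points S" "g \<in> points L"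
  shows "fst (\<Phi> (x, g)) = base_map \<Phi> x"
  using equivariantD[OF assms(1,2) group_closed(3) assms(3)] assms by (simp add: base_map_def)

lemma diffeos_A_in:
  assumes "\<Phi> \<in> diffeos \<A>" "x \<in> points S" "g \<in> points L"
  shows "fst (\<Phi> (x, g)) \<in> points S" "snd (\<Phi> (x, g)) \<in> points L"
  using diffeos_in[OF assms(1), of "(x, g)"] assms(2,3) by auto

lemma equivariant_inverse:
  assumes \<Phi>: "\<Phi> \<in> diffeos \<A>" "equivariant \<Phi>" and \<Psi>: "\<Psi> \<in> diffeos \<A>"
    and inv: "\<And>z. z \<in> points \<A> \<Longrightarrow> \<Psi> (\<Phi> z) = z" "\<And>z. z \<in> points \<A> \<Longrightarrow> \<Phi> (\<Psi> z) = z"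
  shows "equivariant \<Psi>"
  unfolding equivariant_def
proof (intro ballI)
  fix x g k assume x: "x \<in> points S" and g: "g \<in> points L" and k: "k \<in> points L"
  note i = diffeos_A_in[OF \<Psi> x g]
  have "\<Phi> (fst (\<Psi> (x, g)), snd (\<Psi> (x, g)) \<otimes> k) = (x, g \<otimes> k)"
    using equivariantD[OF \<Phi>(2) i k] inv(2)[of "(x, g)"] x g by simp
  then show "\<Psi> (x, g \<otimes> k) = (fst (\<Psi> (x, g)), snd (\<Psi> (x, g)) \<otimes> k)"
    using inv(1)[of "(fst (\<Psi> (x, g)), snd (\<Psi> (x, g)) \<otimes> k)"] i k by simp
qed

lemma base_map_smooth:
  assumes \<Phi>: "\<Phi> \<in> diffeos \<A>"
  shows "base_map \<Phi> \<in> smooth_maps S S"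
proof -
  have "smooth_map S \<A> (\<lambda>x. (x, \<one>))"
    by (rule smooth_map_Pair[OF S L S smooth_map_ident[OF S] smooth_map_const[OF S L]]) simp
  from smooth_map_compose[OF S A S smooth_map_compose[OF S A A this diffeos_smooth_map[OF \<Phi>]] smooth_map_fst[OF S L]]
  have "smooth_map S S (base_map \<Phi>)"
    by (rule smooth_map_cong[OF S S]) (simp add: base_map_def)
  then show ?thesis
    using diffeos_A_in(1)[OF \<Phi>] by (auto simp: smooth_maps_def base_map_def)
qed

lemma base_map_inverse:
  assumes \<Phi>: "\<Phi> \<in> diffeos \<A>" "equivariant \<Phi>" and \<Psi>: "equivariant \<Psi>"
    and inv: "\<And>z. z \<in> points \<A> \<Longrightarrow> \<Psi> (\<Phi> z) = z" and x: "x \<in> points S"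
  shows "base_map \<Psi> (base_map \<Phi> x) = x"
proof -
  let ?z = "\<Phi> (x, \<one>)"
  note i = diffeos_A_in[OF \<Phi>(1) x group_closed(3)]
  have "base_map \<Psi> (base_map \<Phi> x) = fst (\<Psi> (fst ?z, snd ?z))"
    using base_map_eq[OF \<Psi> i] base_map_eq[OF \<Phi>(2) x group_closed(3)] by simp
  then show ?thesis using inv[of "(x, \<one>)"] x by simp
qed

lemma base_map_diffeo:
  assumes \<Phi>: "\<Phi> \<in> diffeos \<A>" "equivariant \<Phi>"
  shows "base_map \<Phi> \<in> diffeos S"
proof -
  obtain \<Psi> where \<Psi>: "\<Psi> \<in> diffeos \<A>" "\<And>z. z \<in> points \<A> \<Longrightarrow> \<Psi> (\<Phi> z) = z" "\<And>z. z \<in> points \<A> \<Longrightarrow> \<Phi> (\<Psi> z) = z"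
    by (rule diffeosE[OF \<Phi>(1)]) blast
  note e = equivariant_inverse[OF \<Phi> \<Psi>]
  show ?thesis
    by (rule diffeosI[OF base_map_smooth[OF \<Phi>(1)] base_map_smooth[OF \<Psi>(1)]])
      (use base_map_inverse[OF \<Phi> e \<Psi>(2)] base_map_inverse[OF \<Psi>(1) e \<Phi>(2) \<Psi>(3)] in auto)
qed

section \<open>The group of volume preserving automorphisms\<close>

abbreviation "\<G> \<equiv> aut_vol S \<mu> L G"

text \<open>The diffeomorphism that the definition asks for can only be
  \<open>base_map \<Phi>\<close>, both being extensional on \<open>points S\<close>. It is a
  diffeomorphism by \<open>base_map_diffeo\<close>, so preservation of the volume is the one
  condition that remains on it.\<close>

lemma carrier_aut_vol:
  "\<Phi> \<in> carrier \<G> \<longleftrightarrow> \<Phi> \<in> diffeos \<A> \<and> equivariant \<Phi> \<and> preserves_volume S \<mu> (base_map \<Phi>)"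
proof
  assume "\<Phi> \<in> carrier \<G>"
  then obtain \<psi> where \<Phi>: "\<Phi> \<in> diffeos \<A>" "equivariant \<Phi>" and \<psi>: "\<psi> \<in> diffeos_vol S \<mu>"
    "\<forall>x\<in>points S. \<forall>g\<in>points L. fst (\<Phi> (x, g)) = \<psi> x"
    by (auto simp: aut_vol_def equivariant_def)
  have "base_map \<Phi> = \<psi>"
  proof
    fix x
    show "base_map \<Phi> x = \<psi> x"
      using \<psi> by (cases "x \<in> points S")
        (auto simp: base_map_def diffeos_vol_def diffeos_def smooth_maps_def PiE_def extensional_def)
  qed
  then show "\<Phi> \<in> diffeos \<A> \<and> equivariant \<Phi> \<and> preserves_volume S \<mu> (base_map \<Phi>)"
    using \<Phi> \<psi> by (simp add: diffeos_vol_def)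
next
  assume *: "\<Phi> \<in> diffeos \<A> \<and> equivariant \<Phi> \<and> preserves_volume S \<mu> (base_map \<Phi>)"
  then have "base_map \<Phi> \<in> diffeos_vol S \<mu>" using base_map_diffeo by (simp add: diffeos_vol_def)
  moreover have "\<forall>x\<in>points S. \<forall>g\<in>points L. fst (\<Phi> (x, g)) = base_map \<Phi> x" using * base_map_eq by blast
  ultimately show "\<Phi> \<in> carrier \<G>"
    using * unfolding aut_vol_def partial_object.select_convs equivariant_def by blast
qed

lemma mult_aut_vol: "\<Phi> \<otimes>\<^bsub>\<G>\<^esub> \<Psi> = compose (points \<A>) \<Phi> \<Psi>"
  and one_aut_vol: "\<one>\<^bsub>\<G>\<^esub> = (\<lambda>z\<in>points \<A>. z)"
  by (simp_all add: aut_vol_def)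

text \<open>The converse of \<open>preserves_volume_emeasure\<close>, with indicators of images of
  open sets as test functions. The closure properties of \<open>aut_vol\<close> follow from it by
  computing measures of images.\<close>

lemma preserves_volumeI_emeasure:
  assumes \<psi>: "\<psi> \<in> diffeos S" and em: "\<And>A. A \<in> sets (mfd_borel S) \<Longrightarrow> emeasure \<nu> (\<psi> ` A) = emeasure \<nu> A"
  shows "preserves_volume S \<mu> \<psi>"
proof (rule preserves_volumeI[OF volume_assms \<psi>])
  fix U assume U: "openin (mtop S) U" "U \<noteq> {}"
  have Us: "U \<in> sets (mfd_borel S)" by (rule openin_sets_mfd_borel[OF S U(1)])
  note \<psi>U = diffeos_image_measurable[OF volume_assms \<psi> Us]
  have sub: "U \<subseteq> points S" using U(1) openin_mtop[OF S] by auto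
  have inj: "inj_on \<psi> (points S)" using \<psi> by (auto simp: diffeos_def bij_betw_def)
  let ?g = "indicator (\<psi> ` U) :: 's \<Rightarrow> ennreal"
  note sets\<nu> = sets_volume_measure[OF volume_assms] and space\<nu> = space_volume_measure[OF volume_assms]
  have ind: "?g (\<psi> x) = indicator U x" if "x \<in> points S" for x
    using that inj sub by (auto simp: indicator_def inj_on_def)
  have 1: "(\<integral>\<^sup>+ x. ?g x \<partial>\<nu>) = emeasure \<nu> U" using \<psi>U em[OF Us] by (simp add: sets\<nu>)
  have "(\<integral>\<^sup>+ x. ?g (\<psi> x) \<partial>\<nu>) = (\<integral>\<^sup>+ x. indicator U x \<partial>\<nu>)"
    by (intro nn_integral_cong) (simp add: space\<nu> ind)
  then have 2: "(\<integral>\<^sup>+ x. ?g (\<psi> x) \<partial>\<nu>) = emeasure \<nu> U" using Us by (simp add: sets\<nu>)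
  have "emeasure \<nu> U \<le> emeasure \<nu> (points S)"
    using emeasure_space[of \<nu> U] by (simp add: space\<nu>)
  then have 3: "emeasure \<nu> U < \<infinity>"
    using emeasure_volume_measure_finite[OF volume_assms] by (rule le_less_trans)
  have 4: "0 < emeasure \<nu> U" using U emeasure_volume_measure_pos[OF volume_assms] by blast
  show "\<exists>g\<in>borel_measurable (mfd_borel S).
        (\<forall>x\<in>points S - U. g (\<psi> x) = 0) \<and> 0 < (\<integral>\<^sup>+ x. g x \<partial>\<nu>) \<and> (\<integral>\<^sup>+ x. g x \<partial>\<nu>) < \<infinity> \<and>
        (\<integral>\<^sup>+ x. g (\<psi> x) \<partial>\<nu>) = (\<integral>\<^sup>+ x. g x \<partial>\<nu>)"
    by (rule bexI[of _ ?g]) (use ind 1 2 3 4 \<psi>U in auto)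
qed

lemma aut_vol_emeasure:
  assumes "\<Phi> \<in> carrier \<G>" "A \<in> sets (mfd_borel S)"
  shows "emeasure \<nu> (base_map \<Phi> ` A) = emeasure \<nu> A" "base_map \<Phi> ` A \<in> sets (mfd_borel S)"
  using assms preserves_volume_emeasure[OF volume_assms base_map_diffeo]
    diffeos_image_measurable[OF volume_assms base_map_diffeo] by (auto simp: carrier_aut_vol)

lemma aut_vol_inverse:
  assumes \<Phi>: "\<Phi> \<in> carrier \<G>"
  obtains \<Psi> where "\<Psi> \<in> carrier \<G>" "\<And>z. z \<in> points \<A> \<Longrightarrow> \<Psi> (\<Phi> z) = z" "\<And>z. z \<in> points \<A> \<Longrightarrow> \<Phi> (\<Psi> z) = z"
proof -
  have \<Phi>': "\<Phi> \<in> diffeos \<A>" "equivariant \<Phi>" using \<Phi> by (auto simp: carrier_aut_vol)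
  obtain \<Psi> where \<Psi>: "\<Psi> \<in> diffeos \<A>" "\<And>z. z \<in> points \<A> \<Longrightarrow> \<Psi> (\<Phi> z) = z" "\<And>z. z \<in> points \<A> \<Longrightarrow> \<Phi> (\<Psi> z) = z"
    by (rule diffeosE[OF \<Phi>'(1)]) blast
  note e = equivariant_inverse[OF \<Phi>' \<Psi>]
  note d = base_map_diffeo[OF \<Psi>(1) e]
  have "preserves_volume S \<mu> (base_map \<Psi>)"
  proof (rule preserves_volumeI_emeasure[OF d])
    fix A assume A: "A \<in> sets (mfd_borel S)"
    note dA = diffeos_image_measurable[OF volume_assms d A]
    have "A \<subseteq> points S" using sets.sets_into_space[OF A] by (simp add: S)
    then have "base_map \<Phi> ` base_map \<Psi> ` A = A"
      using base_map_inverse[OF \<Psi>(1) e \<Phi>'(2) \<Psi>(3)] by (force simp: image_image)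
    then show "emeasure \<nu> (base_map \<Psi> ` A) = emeasure \<nu> A" using aut_vol_emeasure(1)[OF \<Phi> dA] by simp
  qed
  then have "\<Psi> \<in> carrier \<G>" using \<Psi>(1) e by (simp add: carrier_aut_vol)
  then show thesis by (rule that[OF _ \<Psi>(2,3)])
qed

lemma aut_vol_compose:
  assumes \<Phi>: "\<Phi> \<in> carrier \<G>" and \<Psi>: "\<Psi> \<in> carrier \<G>"
  shows "compose (points \<A>) \<Phi> \<Psi> \<in> carrier \<G>"
proof -
  let ?C = "compose (points \<A>) \<Phi> \<Psi>"
  have \<Phi>': "\<Phi> \<in> diffeos \<A>" "equivariant \<Phi>" and \<Psi>': "\<Psi> \<in> diffeos \<A>" "equivariant \<Psi>"
    using \<Phi> \<Psi> by (auto simp: carrier_aut_vol)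
  have C: "?C \<in> diffeos \<A>" by (rule diffeos_compose[OF A \<Phi>'(1) \<Psi>'(1)])
  have e: "equivariant ?C"
    unfolding equivariant_def
  proof (intro ballI)
    fix x g k assume x: "x \<in> points S" and g: "g \<in> points L" and k: "k \<in> points L"
    note i = diffeos_A_in[OF \<Psi>'(1) x g]
    show "?C (x, g \<otimes> k) = (fst (?C (x, g)), snd (?C (x, g)) \<otimes> k)"
      using equivariantD[OF \<Psi>'(2) x g k] equivariantD[OF \<Phi>'(2) i k] x g k by (simp add: compose_def)
  qed
  have b: "base_map ?C x = base_map \<Phi> (base_map \<Psi> x)" if x: "x \<in> points S" for x
    using base_map_eq[OF \<Phi>'(2) diffeos_A_in[OF \<Psi>'(1) x group_closed(3)]] x by (simp add: base_map_def compose_def)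
  have "preserves_volume S \<mu> (base_map ?C)"
  proof (rule preserves_volumeI_emeasure[OF base_map_diffeo[OF C e]])
    fix A assume A: "A \<in> sets (mfd_borel S)"
    have "A \<subseteq> points S" using sets.sets_into_space[OF A] by (simp add: S)
    then have "base_map ?C ` A = base_map \<Phi> ` base_map \<Psi> ` A" unfolding image_image by (intro image_cong refl b) blast
    then show "emeasure \<nu> (base_map ?C ` A) = emeasure \<nu> A"
      using aut_vol_emeasure(1)[OF \<Phi> aut_vol_emeasure(2)[OF \<Psi> A]] aut_vol_emeasure(1)[OF \<Psi> A] by simp
  qed
  then show ?thesis using C e by (simp add: carrier_aut_vol)
qed

lemma aut_vol_one: "(\<lambda>z\<in>points \<A>. z) \<in> carrier \<G>"
proof -
  let ?I = "\<lambda>z\<in>points \<A>. z"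
  have "smooth_map \<A> \<A> ?I" by (rule smooth_map_cong[OF A A smooth_map_ident[OF A]]) simp
  then have sm: "?I \<in> smooth_maps \<A> \<A>" by (auto simp: smooth_maps_def)
  have I: "?I \<in> diffeos \<A>" by (rule diffeosI[OF sm sm]) auto
  have e: "equivariant ?I" by (auto simp: equivariant_def)
  have "preserves_volume S \<mu> (base_map ?I)"
  proof (rule preserves_volumeI_emeasure[OF base_map_diffeo[OF I e]])
    fix A assume A: "A \<in> sets (mfd_borel S)"
    have "A \<subseteq> points S" using sets.sets_into_space[OF A] by (simp add: S)
    then have "base_map ?I ` A = A" by (force simp: base_map_def)
    then show "emeasure \<nu> (base_map ?I ` A) = emeasure \<nu> A" by simp
  qed
  then show ?thesis using I e by (simp add: carrier_aut_vol)
qed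

lemma aut_vol_ext_in:
  assumes "\<Phi> \<in> carrier \<G>"
  shows "\<Phi> \<in> extensional (points \<A>)" "z \<in> points \<A> \<Longrightarrow> \<Phi> z \<in> points \<A>"
  using assms diffeos_in[of \<Phi> \<A> z] by (auto simp: carrier_aut_vol diffeos_def smooth_maps_def PiE_def)

lemma group_aut_vol: "group \<G>"
proof (rule groupI)
  fix \<Phi> \<Psi> \<Theta> assume \<Phi>: "\<Phi> \<in> carrier \<G>" and \<Psi>: "\<Psi> \<in> carrier \<G>" and \<Theta>: "\<Theta> \<in> carrier \<G>"
  show "\<Phi> \<otimes>\<^bsub>\<G>\<^esub> \<Psi> \<otimes>\<^bsub>\<G>\<^esub> \<Theta> = \<Phi> \<otimes>\<^bsub>\<G>\<^esub> (\<Psi> \<otimes>\<^bsub>\<G>\<^esub> \<Theta>)"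
    unfolding mult_aut_vol using aut_vol_ext_in(2)[OF \<Theta>] by (simp add: compose_def restrict_def fun_eq_iff del: points_A)
next
  fix \<Phi> assume \<Phi>: "\<Phi> \<in> carrier \<G>"
  show "\<one>\<^bsub>\<G>\<^esub> \<otimes>\<^bsub>\<G>\<^esub> \<Phi> = \<Phi>"
    unfolding mult_aut_vol one_aut_vol using aut_vol_ext_in[OF \<Phi>]
    by (auto simp: compose_def restrict_def fun_eq_iff extensional_def simp del: points_A)
  obtain \<Psi> where \<Psi>: "\<Psi> \<in> carrier \<G>" "\<And>z. z \<in> points \<A> \<Longrightarrow> \<Psi> (\<Phi> z) = z"
    by (rule aut_vol_inverse[OF \<Phi>]) blast
  then have "\<Psi> \<otimes>\<^bsub>\<G>\<^esub> \<Phi> = \<one>\<^bsub>\<G>\<^esub>"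
    unfolding mult_aut_vol one_aut_vol by (simp add: compose_def restrict_def fun_eq_iff del: points_A)
  then show "\<exists>\<Psi>\<in>carrier \<G>. \<Psi> \<otimes>\<^bsub>\<G>\<^esub> \<Phi> = \<one>\<^bsub>\<G>\<^esub>" using \<Psi>(1) by blast
qed (use aut_vol_compose aut_vol_one in \<open>simp_all add: mult_aut_vol one_aut_vol\<close>)

section \<open>The map \<eta> of an equivariant embedding\<close>

abbreviation "\<E> \<equiv> equiv_embeddings S M L G"

lemma equiv_embeddings_action:
  assumes f: "f \<in> \<E>" and x: "x \<in> points S" and g: "g \<in> points L" and k: "k \<in> points L"
  shows "f (x, g \<otimes> k) = (fst (f (x, g)), cotangent_right L G (snd (f (x, g))) k)"
  using f x g k unfolding equiv_embeddings_def by blast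

lemma equiv_embeddings_embeddings: "f \<in> \<E> \<Longrightarrow> f \<in> embeddings \<A> \<T>"
  by (simp add: equiv_embeddings_def)

lemma equiv_embeddings_smooth: "f \<in> \<E> \<Longrightarrow> smooth_map \<A> \<T> f"
  by (simp add: equiv_embeddings_def embeddings_def smooth_maps_def)

lemma equiv_embeddings_inj: "f \<in> \<E> \<Longrightarrow> inj_on f (points \<A>)"
  by (auto simp: equiv_embeddings_def embeddings_def embedding_map_def homeomorphic_eq_everything_map topspace_mtop[OF A]
      simp del: points_A)

lemma equiv_embeddings_in:
  assumes "f \<in> \<E>" "x \<in> points S" "g \<in> points L"
  shows "fst (snd (f (x, g))) \<in> points L" "snd (snd (f (x, g))) \<in> cotangent_space L (fst (snd (f (x, g))))"
proof -
  have "f (x, g) \<in> points \<T>"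
    using smooth_map_in[OF A T equiv_embeddings_smooth[OF assms(1)], of "(x, g)"] assms(2,3) by simp
  then have "snd (f (x, g)) \<in> points (cotangent_bundle L)" by (auto simp: prod_mfd_def)
  then have "snd (f (x, g)) \<in> Sigma (points L) (cotangent_space L)" by (simp add: cotangent_bundle_def)
  then show "fst (snd (f (x, g))) \<in> points L" "snd (snd (f (x, g))) \<in> cotangent_space L (fst (snd (f (x, g))))"
    by auto
qed

text \<open>The body momentum \<open>\<sigma> x\<close> is the covector part of the unique point of the orbit
  \<open>{f (x, g) | g}\<close> that lies over the unit of the group.\<close>

lemma emb_eta_char:
  assumes f: "f \<in> \<E>" and x: "x \<in> points S" and g: "g \<in> points L" and eq: "f (x, g) = (P, \<one>, \<sigma>)"
  shows "\<eta> f x = (P, \<sigma>)"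
proof -
  let ?T = "\<lambda>k. tangent_map L L (right_transl G k)"
  let ?k = "inv g"
  have k: "?k \<in> points L" using g by blast
  have "\<sigma> \<in> cotangent_space L \<one>" using equiv_embeddings_in(2)[OF f x g] by (simp add: eq)
  then have \<sigma>: "\<sigma> \<in> extensional (tangent_space L \<one>)" by (simp add: cotangent_space_def)
  \<comment> \<open>The value at the unit is the value at \<open>g\<close> moved by
    \<open>inv g\<close>. The right translation in \<open>cotangent_right\<close> and the one in
    \<open>emb_eta\<close> are then inverse to each other.\<close>
  have f1: "f (x, \<one>) = (P, ?k, \<lambda>v\<in>tangent_space L ?k. \<sigma> (?T g v))"
    using equiv_embeddings_action[OF f x g k] g k by (simp add: eq cotangent_right_def)
  have "(\<lambda>v\<in>tangent_space L ?k. \<sigma> (?T g v)) (?T ?k \<xi>) = \<sigma> \<xi>" if \<xi>: "\<xi> \<in> tangent_space L \<one>" for \<xi>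
  proof -
    have "?T ?k \<xi> \<in> tangent_space L (right_transl G ?k \<one>)"
      by (rule tangent_map_in[OF L L smooth_right_transl[OF k] \<xi>])
    then have "?T ?k \<xi> \<in> tangent_space L ?k" using k by (simp add: right_transl_def)
    moreover have "?T g (?T ?k \<xi>) = \<xi>"
    proof -
      have "?T g (?T ?k \<xi>) = tangent_map L L (\<lambda>h. right_transl G g (right_transl G ?k h)) \<xi>"
        by (rule tangent_map_compose[OF L L smooth_right_transl[OF k] smooth_right_transl[OF g] L])
      also have "\<dots> = tangent_map L L (\<lambda>h. h) \<xi>"
        by (rule tangent_map_cong) (use g k in \<open>simp add: right_transl_def group_assoc\<close>)
      also have "\<dots> = \<xi>" by (rule tangent_map_ident[OF L \<xi>])
      finally show ?thesis .
    qed
    ultimately show ?thesis by simp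
  qed
  then have "(\<lambda>\<xi>\<in>tangent_space L \<one>. (\<lambda>v\<in>tangent_space L ?k. \<sigma> (?T g v)) (?T ?k \<xi>)) = (\<lambda>\<xi>\<in>tangent_space L \<one>. \<sigma> \<xi>)"
    by (intro restrict_ext)
  also have "\<dots> = \<sigma>" by (rule extensional_restrict[OF \<sigma>])
  finally show ?thesis using x by (simp only: emb_eta_def restrict_apply' f1 Let_def prod.case)
qed

text \<open>The inverse of the base point \<open>\<gamma> x\<close>. At
  \<open>(x, unit_lift f x)\<close> the embedding lies over the unit of the group, so \<eta> can be
  read off there without translating covectors.\<close>

definition unit_lift :: "('s \<times> 'g \<Rightarrow> ('m \<times> ('m tvec \<Rightarrow> real)) \<times> ('g \<times> ('g tvec \<Rightarrow> real))) \<Rightarrow> 's \<Rightarrow> 'g" where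
  "unit_lift f x = inv (fst (snd (f (x, \<one>))))"

context
  fixes f assumes f: "f \<in> \<E>"
begin

lemma unit_lift_in: "x \<in> points S \<Longrightarrow> unit_lift f x \<in> points L"
  using equiv_embeddings_in(1)[OF f] by (auto simp: unit_lift_def)

lemma fst_snd_unit_lift:
  assumes x: "x \<in> points S"
  shows "fst (snd (f (x, unit_lift f x))) = \<one>"
proof -
  have "f (x, \<one> \<otimes> unit_lift f x) = (fst (f (x, \<one>)), cotangent_right L G (snd (f (x, \<one>))) (unit_lift f x))"
    by (rule equiv_embeddings_action[OF f x group_closed(3) unit_lift_in[OF x]])
  then show ?thesis
    using unit_lift_in[OF x] equiv_embeddings_in(1)[OF f x group_closed(3)]
    by (simp add: cotangent_right_def unit_lift_def split: prod.splits)
qed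

lemma emb_eta_unit_lift:
  assumes x: "x \<in> points S"
  shows "\<eta> f x = (fst (f (x, unit_lift f x)), snd (snd (f (x, unit_lift f x))))"
  by (rule emb_eta_char[OF f x unit_lift_in[OF x]]) (simp add: prod_eq_iff fst_snd_unit_lift[OF x])

lemma emb_eta_unit_lift':
  "x \<in> points S \<Longrightarrow> f (x, unit_lift f x) = (fst (\<eta> f x), \<one>, snd (\<eta> f x))"
  by (simp add: emb_eta_unit_lift prod_eq_iff fst_snd_unit_lift)

text \<open>The value of \<open>f\<close> at the unit lift is determined by
  \<open>\<eta> f x\<close>, so injectivity of \<open>f\<close> is inherited.\<close>

lemma inj_emb_eta: "inj_on (\<eta> f) (points S)"
proof (rule inj_onI)
  fix x y assume x: "x \<in> points S" and y: "y \<in> points S" and "\<eta> f x = \<eta> f y"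
  then have "f (x, unit_lift f x) = f (y, unit_lift f y)" by (simp add: emb_eta_unit_lift')
  then have "(x, unit_lift f x) = (y, unit_lift f y)"
    by (rule inj_onD[OF equiv_embeddings_inj[OF f]]) (simp_all add: x y unit_lift_in)
  then show "x = y" by simp
qed

text \<open>Read off along the unit lift rather than through the translation in
  \<open>emb_eta\<close>, the map is a composite of continuous maps whose covector part stays in the
  fibre over the unit.\<close>

lemma continuous_map_emb_eta: "continuous_map (mtop S) (mtop \<Q>) (\<eta> f)"
proof -
  have cf: "continuous_map (prod_topology (mtop S) (mtop L)) (prod_topology (mtop (cotangent_bundle M)) (mtop (cotangent_bundle L))) f"
    using equiv_embeddings_smooth[OF f] by (simp add: smooth_map_def mtop_prod[OF S L] mtop_prod[OF TM TL])
  have cinv: "continuous_map (mtop L) (mtop L) (\<lambda>g. inv g)"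
    using lie_group by (simp add: lie_group_def smooth_map_def)
  have idS: "continuous_map (mtop S) (mtop S) (\<lambda>x. x)" by simp
  have "continuous_map (mtop S) (mtop L) (\<lambda>x. \<one>)" by (simp add: topspace_mtop[OF L])
  from continuous_map_compose[OF continuous_map_pairedI[OF idS this] cf]
  have "continuous_map (mtop S) (prod_topology (mtop (cotangent_bundle M)) (mtop (cotangent_bundle L))) (\<lambda>x. f (x, \<one>))"
    by (simp add: o_def)
  from continuous_map_compose[OF continuous_map_compose[OF continuous_map_compose[OF this continuous_map_snd]
        continuous_map_cotangent_bundle_fst[OF L HL]] cinv]
  have "continuous_map (mtop S) (mtop L) (unit_lift f)" by (simp add: o_def unit_lift_def[abs_def])
  from continuous_map_compose[OF continuous_map_pairedI[OF idS this] cf]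
  have c: "continuous_map (mtop S) (prod_topology (mtop (cotangent_bundle M)) (mtop (cotangent_bundle L))) (\<lambda>x. f (x, unit_lift f x))"
    by (simp add: o_def)
  have c1: "continuous_map (mtop S) (mtop (cotangent_bundle M)) (\<lambda>x. fst (f (x, unit_lift f x)))"
    and c2: "continuous_map (mtop S) (mtop (cotangent_bundle L)) (\<lambda>x. snd (f (x, unit_lift f x)))"
    using continuous_map_compose[OF c continuous_map_fst] continuous_map_compose[OF c continuous_map_snd] by (simp_all add: o_def)
  have "continuous_map (mtop S) (mtop (lie_dual_mfd L G)) (\<lambda>x. snd (snd (f (x, unit_lift f x))))"
    unfolding lie_dual_mfd_def
    by (rule continuous_map_into_fiber[OF L HL group_closed(3) c2]) (simp add: topspace_mtop[OF S] fst_snd_unit_lift)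
  from continuous_map_pairedI[OF c1 this] show ?thesis
    unfolding mtop_prod[OF TM LD]
    by (rule continuous_map_eq) (simp add: topspace_mtop[OF S] emb_eta_unit_lift)
qed

text \<open>The image of \<open>C\<close> is compact, hence closed in the Hausdorff space
  \<open>\<Q>\<close>, and a bump function at \<open>y\<close> avoids it. With \<open>C\<close> all
  of \<open>S\<close> this separates images; with \<open>C\<close> the complement of an open set it
  yields test functions that pull back to functions vanishing off that set.\<close>

lemma emb_eta_separation:
  assumes C: "closedin (mtop S) C" and y: "y \<in> points \<Q>" "y \<notin> \<eta> f ` C"
  obtains h where "h \<in> smooth_funs \<Q>" "\<And>z. z \<in> points \<Q> \<Longrightarrow> h z \<ge> 0" "h y > 0"
    "\<And>x. x \<in> C \<Longrightarrow> h (\<eta> f x) = 0"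
proof -
  let ?K = "\<eta> f ` C"
  have "compactin (mtop S) C" using closedin_compact_space[OF compact_S C] .
  then have "compactin (mtop \<Q>) ?K" by (rule image_compactin[OF _ continuous_map_emb_eta])
  then have K: "closedin (mtop \<Q>) ?K" using HQ compactin_imp_closedin by blast
  then have "openin (mtop \<Q>) (points \<Q> - ?K)" using openin_diff[OF openin_topspace K] by (simp add: topspace_mtop[OF Q])
  moreover have "y \<in> points \<Q> - ?K" using y by blast
  ultimately obtain h where h: "h \<in> smooth_funs \<Q>" "\<And>z. z \<in> points \<Q> \<Longrightarrow> h z \<ge> 0" "h y > 0"
    "\<And>z. z \<in> points \<Q> - (points \<Q> - ?K) \<Longrightarrow> h z = 0"
    using smooth_bump_function[OF Q HQ] by metis
  have "?K \<subseteq> points \<Q>" using closedin_subset[OF K] by (simp add: topspace_mtop[OF Q])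
  then have h0: "h (\<eta> f x) = 0" if "x \<in> C" for x
    using that by (intro h(4)) auto
  show thesis by (rule that[OF h(1-3) h0])
qed

lemma continuous_map_smooth_fun_emb_eta:
  assumes h: "h \<in> smooth_funs \<Q>"
  shows "continuous_map (mtop S) euclidean (\<lambda>x. h (\<eta> f x))"
  using continuous_map_compose[OF continuous_map_emb_eta smooth_funs_continuous_map[OF Q h]] by (simp add: o_def)

lemma emb_eta_in: "x \<in> points S \<Longrightarrow> \<eta> f x \<in> points \<Q>"
  using continuous_map_emb_eta by (auto simp: continuous_map_def topspace_mtop[OF S] topspace_mtop[OF Q])

lemma equiv_embeddings_compose_aut_vol:
  assumes \<Phi>: "\<Phi> \<in> carrier \<G>"
  shows "compose (points \<A>) f \<Phi> \<in> \<E>"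
    and "x \<in> points S \<Longrightarrow> \<eta> (compose (points \<A>) f \<Phi>) x = \<eta> f (base_map \<Phi> x)"
proof -
  let ?f = "compose (points \<A>) f \<Phi>"
  have \<Phi>': "\<Phi> \<in> diffeos \<A>" "equivariant \<Phi>" using \<Phi> by (auto simp: carrier_aut_vol)
  note sm\<Phi> = diffeos_smooth_map[OF \<Phi>'(1)]
  obtain \<Psi> where \<Psi>: "\<Psi> \<in> diffeos \<A>" "\<And>z. z \<in> points \<A> \<Longrightarrow> \<Psi> (\<Phi> z) = z" "\<And>z. z \<in> points \<A> \<Longrightarrow> \<Phi> (\<Psi> z) = z"
    by (rule diffeosE[OF \<Phi>'(1)]) blast
  note sm\<Psi> = diffeos_smooth_map[OF \<Psi>(1)]
  have femb: "f \<in> smooth_maps \<A> \<T>" "embedding_map (mtop \<A>) (mtop \<T>) f"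
    and fimm: "\<And>p. p \<in> points \<A> \<Longrightarrow> inj_on (tangent_map \<A> \<T> f) (tangent_space \<A> p)"
    using f by (auto simp: equiv_embeddings_def embeddings_def)
  have val: "?f z = f (\<Phi> z)" if "z \<in> points \<A>" for z using that by (simp add: compose_def)
  have sm: "?f \<in> smooth_maps \<A> \<T>"
    by (rule smooth_maps_compose[OF A A T _ femb(1)]) (use \<Phi>' in \<open>simp add: diffeos_def\<close>)
  have "homeomorphic_maps (mtop \<A>) (mtop \<A>) \<Phi> \<Psi>"
    using sm\<Phi> sm\<Psi> \<Psi>(2,3) by (simp add: homeomorphic_maps_def smooth_map_def topspace_mtop[OF A] del: points_A)
  then have h\<Phi>: "homeomorphic_map (mtop \<A>) (mtop \<A>) \<Phi>" by (auto simp: homeomorphic_map_maps)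
  then have "embedding_map (mtop \<A>) (mtop \<A>) \<Phi>"
    unfolding embedding_map_def homeomorphic_imp_surjective_map[OF h\<Phi>] by (simp only: subtopology_topspace)
  from embedding_map_compose[OF this femb(2)]
  have emb: "embedding_map (mtop \<A>) (mtop \<T>) ?f"
    by (rule embedding_map_eq) (simp add: topspace_mtop[OF A] val del: points_A)
  have imm: "inj_on (tangent_map \<A> \<T> ?f) (tangent_space \<A> p)" if p: "p \<in> points \<A>" for p
  proof (rule inj_onI)
    fix X Y assume X: "X \<in> tangent_space \<A> p" and Y: "Y \<in> tangent_space \<A> p"
      and eq: "tangent_map \<A> \<T> ?f X = tangent_map \<A> \<T> ?f Y"
    have c: "tangent_map \<A> \<T> ?f X = tangent_map \<A> \<T> f (tangent_map \<A> \<A> \<Phi> X)" for X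
      using tangent_map_compose[OF A A sm\<Phi> equiv_embeddings_smooth[OF f] T, of X]
        tangent_map_cong[of \<A> ?f "\<lambda>z. f (\<Phi> z)" \<T> X] val by simp
    have "tangent_map \<A> \<A> \<Phi> X = tangent_map \<A> \<A> \<Phi> Y"
      using inj_onD[OF fimm[OF diffeos_in[OF \<Phi>'(1) p]] _ tangent_map_in[OF A A sm\<Phi> X] tangent_map_in[OF A A sm\<Phi> Y]] eq
      unfolding c by blast
    moreover have "tangent_map \<A> \<A> \<Psi> (tangent_map \<A> \<A> \<Phi> X) = X" if X: "X \<in> tangent_space \<A> p" for X
      using tangent_map_compose[OF A A sm\<Phi> sm\<Psi> A, of X] tangent_map_ident[OF A X]
        tangent_map_cong[of \<A> "\<lambda>z. \<Psi> (\<Phi> z)" "\<lambda>z. z" \<A> X] \<Psi>(2) by simp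
    ultimately show "X = Y" using X Y by metis
  qed
  have act: "?f (x, g \<otimes> k) = (fst (?f (x, g)), cotangent_right L G (snd (?f (x, g))) k)"
    if x: "x \<in> points S" and g: "g \<in> points L" and k: "k \<in> points L" for x g k
    using equivariantD[OF \<Phi>'(2) x g k] equiv_embeddings_action[OF f diffeos_A_in[OF \<Phi>'(1) x g] k] x g k
    by (simp add: compose_def)
  show E: "?f \<in> \<E>"
    unfolding equiv_embeddings_def embeddings_def using sm emb imm act by blast
  show "\<eta> ?f x = \<eta> f (base_map \<Phi> x)" if x: "x \<in> points S"
  proof -
    let ?y = "base_map \<Phi> x"
    have y: "?y \<in> points S" using diffeos_in[OF base_map_diffeo[OF \<Phi>'] x] .
    \<comment> \<open>The point over \<open>x\<close> at which the composite lies over the unit of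
      the group; it is found by pulling the unit lift at the base point \<open>?y\<close> back along
      \<Phi>, and \<open>emb_eta_char\<close> applies there.\<close>
    let ?z = "\<Psi> (?y, unit_lift f ?y)"
    have yA: "(?y, unit_lift f ?y) \<in> points \<A>" using y unit_lift_in[OF y] by simp
    have zA: "?z \<in> points \<A>" by (rule diffeos_in[OF \<Psi>(1) yA])
    have \<Phi>z: "\<Phi> ?z = (?y, unit_lift f ?y)" by (rule \<Psi>(3)[OF yA])
    have "fst ?z = base_map \<Psi> ?y"
      by (rule base_map_eq[OF equivariant_inverse[OF \<Phi>' \<Psi>] y unit_lift_in[OF y]])
    then have "fst ?z = x"
      using base_map_inverse[OF \<Phi>' equivariant_inverse[OF \<Phi>' \<Psi>] \<Psi>(2) x] by simp
    then obtain g where z: "?z = (x, g)" by (cases ?z) simp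
    then have g: "g \<in> points L" using zA by simp
    have "?f (x, g) = f (?y, unit_lift f ?y)" using val[OF zA] \<Phi>z z by simp
    then have "?f (x, g) = (fst (\<eta> f ?y), \<one>, snd (\<eta> f ?y))"
      by (simp add: emb_eta_unit_lift'[OF y])
    then show ?thesis using emb_eta_char[OF E x g] by simp
  qed
qed

end

lemma momentum_L_eqD:
  assumes "\<J> f1 = \<J> f2" "h \<in> smooth_funs \<Q>"
  shows "(LINT x|\<nu>. h (\<eta> f1 x)) = (LINT x|\<nu>. h (\<eta> f2 x))"
  using fun_cong[OF assms(1), of h] assms(2) by (simp add: momentum_L_def)

text \<open>The integral in \<open>momentum_L\<close> has the default value 0 for functions that are
  not integrable. On the compact \<open>S\<close> continuous functions are bounded and the volume is
  finite, so this does not arise, and one may pass to nonnegative integrals.\<close>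

lemma nn_integral_continuous_fun:
  fixes k :: "'s \<Rightarrow> real"
  assumes k: "continuous_map (mtop S) euclidean k" and nn: "\<And>x. x \<in> points S \<Longrightarrow> k x \<ge> 0"
  shows "(\<integral>\<^sup>+ x. ennreal (k x) \<partial>\<nu>) = ennreal (LINT x|\<nu>. k x)" "(\<integral>\<^sup>+ x. ennreal (k x) \<partial>\<nu>) < \<infinity>"
    and "x \<in> points S \<Longrightarrow> k x > 0 \<Longrightarrow> 0 < (\<integral>\<^sup>+ x. ennreal (k x) \<partial>\<nu>)"
proof -
  note sets\<nu> = sets_volume_measure[OF volume_assms] and space\<nu> = space_volume_measure[OF volume_assms]
  have m: "k \<in> borel_measurable \<nu>"
    using borel_measurable_continuous_map[OF S k] by (simp add: measurable_volume_measure[OF volume_assms])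
  have "compactin euclidean (k ` points S)"
    using image_compactin[OF _ k, of "points S"] compact_S by (simp add: compact_space_def topspace_mtop[OF S])
  then have "bounded (k ` points S)" using compact_imp_bounded by simp
  then obtain C where C: "\<And>x. x \<in> points S \<Longrightarrow> \<bar>k x\<bar> \<le> C" by (auto simp: bounded_iff)
  have "(\<integral>\<^sup>+ x. ennreal (k x) \<partial>\<nu>) \<le> (\<integral>\<^sup>+ x. ennreal C \<partial>\<nu>)"
    by (intro nn_integral_mono ennreal_leI) (use C in \<open>fastforce simp: space\<nu>\<close>)
  also have "\<dots> = ennreal C * emeasure \<nu> (points S)" by (simp add: space\<nu>)
  also have "\<dots> < \<infinity>"
    using emeasure_volume_measure_finite[OF volume_assms] by (simp add: ennreal_mult_less_top)
  finally show fin: "(\<integral>\<^sup>+ x. ennreal (k x) \<partial>\<nu>) < \<infinity>" .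
  have ae: "AE x in \<nu>. 0 \<le> k x" by (rule AE_I2) (simp add: space\<nu> nn)
  show "(\<integral>\<^sup>+ x. ennreal (k x) \<partial>\<nu>) = ennreal (LINT x|\<nu>. k x)"
    using integral_eq_nn_integral[OF m ae] fin by simp
  assume x: "x \<in> points S" "k x > 0"
  let ?V = "{x \<in> topspace (mtop S). k x \<in> {0<..}}"
  have "openin (mtop S) ?V" by (intro openin_continuous_map_preimage[OF k]) simp
  moreover have "x \<in> ?V" using x by (simp add: topspace_mtop[OF S])
  ultimately have "emeasure \<nu> ?V > 0" by (rule emeasure_volume_measure_pos[OF volume_assms])
  moreover have "{x \<in> space \<nu>. ennreal (k x) \<noteq> 0} = ?V"
    using nn by (auto simp: space\<nu> topspace_mtop[OF S] less_le ennreal_eq_0_iff)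
  ultimately show "0 < (\<integral>\<^sup>+ x. ennreal (k x) \<partial>\<nu>)"
    using nn_integral_0_iff[of "\<lambda>x. ennreal (k x)" \<nu>] m by (simp add: zero_less_iff_neq_zero)
qed

section \<open>Reconstruction of an automorphism from equal momenta\<close>

context
  fixes f1 f2
  assumes f1: "f1 \<in> \<E>" and f2: "f2 \<in> \<E>"
    and J: "\<J> f1 = \<J> f2"
begin

lemma emb_eta_nn_integral_eq:
  assumes h: "h \<in> smooth_funs \<Q>" "\<And>z. z \<in> points \<Q> \<Longrightarrow> h z \<ge> 0"
  shows "(\<integral>\<^sup>+ x. ennreal (h (\<eta> f1 x)) \<partial>\<nu>) = (\<integral>\<^sup>+ x. ennreal (h (\<eta> f2 x)) \<partial>\<nu>)"
  using nn_integral_continuous_fun(1)[OF continuous_map_smooth_fun_emb_eta[OF f1 h(1)]]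
    nn_integral_continuous_fun(1)[OF continuous_map_smooth_fun_emb_eta[OF f2 h(1)]]
    h(2)[OF emb_eta_in[OF f1]] h(2)[OF emb_eta_in[OF f2]] momentum_L_eqD[OF J h(1)] by simp

text \<open>A bump function at a point outside the closed image of \<open>\<eta> f1\<close>,
  vanishing on that image, has integral 0 along \<open>\<eta> f1\<close> but a positive one along
  \<open>\<eta> f2\<close>, since nonempty open sets have positive volume.\<close>

lemma emb_eta_image_subset: "\<eta> f2 ` points S \<subseteq> \<eta> f1 ` points S"
proof (rule ccontr)
  assume "\<not> ?thesis"
  then obtain x where x: "x \<in> points S" "\<eta> f2 x \<notin> \<eta> f1 ` points S" by blast
  have "closedin (mtop S) (points S)" using closedin_topspace[of "mtop S"] by (simp add: topspace_mtop[OF S])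
  then obtain h where h: "h \<in> smooth_funs \<Q>" "\<And>z. z \<in> points \<Q> \<Longrightarrow> h z \<ge> 0" "h (\<eta> f2 x) > 0"
    "\<And>x. x \<in> points S \<Longrightarrow> h (\<eta> f1 x) = 0"
    using emb_eta_separation[OF f1 _ emb_eta_in[OF f2 x(1)] x(2)] by metis
  have "(\<integral>\<^sup>+ x. ennreal (h (\<eta> f1 x)) \<partial>\<nu>) = (\<integral>\<^sup>+ x. 0 \<partial>\<nu>)"
    by (intro nn_integral_cong) (simp add: space_volume_measure[OF volume_assms] h(4))
  then have "(\<integral>\<^sup>+ x. ennreal (h (\<eta> f2 x)) \<partial>\<nu>) = 0"
    using emb_eta_nn_integral_eq[OF h(1,2)] by simp
  moreover have "0 < (\<integral>\<^sup>+ x. ennreal (h (\<eta> f2 x)) \<partial>\<nu>)"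
    by (rule nn_integral_continuous_fun(3)[OF continuous_map_smooth_fun_emb_eta[OF f2 h(1)] _ x(1) h(3)])
      (simp add: h(2) emb_eta_in[OF f2])
  ultimately show False by simp
qed

text \<open>Where the values of \<eta> coincide, the two embeddings coincide at the unit lifts, and
  equivariance spreads this common value over the whole orbit.\<close>

lemma equiv_embeddings_image_subset: "f2 ` points \<A> \<subseteq> f1 ` points \<A>"
proof
  fix w assume "w \<in> f2 ` points \<A>"
  then obtain x g where x: "x \<in> points S" and g: "g \<in> points L" and w: "w = f2 (x, g)" by auto
  let ?u = "unit_lift f2 x"
  have u: "?u \<in> points L" by (rule unit_lift_in[OF f2 x])
  obtain y where y: "y \<in> points S" "\<eta> f2 x = \<eta> f1 y"
    using emb_eta_image_subset x by blast
  let ?v = "unit_lift f1 y" and ?k = "inv ?u \<otimes> g"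
  have v: "?v \<in> points L" by (rule unit_lift_in[OF f1 y(1)])
  have k: "?k \<in> points L" using u g by blast
  have uk: "?u \<otimes> ?k = g" using u g by (simp add: group_assoc[symmetric])
  have eq: "f2 (x, ?u) = f1 (y, ?v)"
    using emb_eta_unit_lift'[OF f2 x] emb_eta_unit_lift'[OF f1 y(1)] y(2) by simp
  have "w = f2 (x, ?u \<otimes> ?k)" unfolding uk w ..
  also have "\<dots> = f1 (y, ?v \<otimes> ?k)"
    unfolding equiv_embeddings_action[OF f2 x u k] equiv_embeddings_action[OF f1 y(1) v k] eq ..
  finally show "w \<in> f1 ` points \<A>" using y(1) v k by auto
qed

end

lemma level_set_transitive:
  assumes f1: "f1 \<in> \<E>" and f2: "f2 \<in> \<E>"
    and J: "\<J> f1 = \<J> f2"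
  obtains \<Phi> where "\<Phi> \<in> carrier \<G>" "\<And>z. z \<in> points \<A> \<Longrightarrow> f1 (\<Phi> z) = f2 z"
proof -
  have im: "f1 ` points \<A> = f2 ` points \<A>"
    using equiv_embeddings_image_subset[OF f1 f2 J] equiv_embeddings_image_subset[OF f2 f1 J[symmetric]] by blast
  obtain \<Phi> where \<Phi>: "\<Phi> \<in> diffeos \<A>" "\<And>z. z \<in> points \<A> \<Longrightarrow> f1 (\<Phi> z) = f2 z"
    by (rule diffeo_between_embeddings[OF A HA T equiv_embeddings_embeddings[OF f1] equiv_embeddings_embeddings[OF f2] im]) blast
  have e: "equivariant \<Phi>"
    unfolding equivariant_def
  proof (intro ballI)
    fix x g k assume x: "x \<in> points S" and g: "g \<in> points L" and k: "k \<in> points L"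
    note i = diffeos_A_in[OF \<Phi>(1) x g]
    let ?z = "(fst (\<Phi> (x, g)), snd (\<Phi> (x, g)) \<otimes> k)"
    have xg: "f1 (fst (\<Phi> (x, g)), snd (\<Phi> (x, g))) = f2 (x, g)" using \<Phi>(2)[of "(x, g)"] x g by simp
    have xgk: "(x, g \<otimes> k) \<in> points \<A>" using x g k by simp
    have "f1 ?z = f2 (x, g \<otimes> k)"
      unfolding equiv_embeddings_action[OF f1 i k] equiv_embeddings_action[OF f2 x g k] xg ..
    also have "\<dots> = f1 (\<Phi> (x, g \<otimes> k))" using \<Phi>(2)[OF xgk] by simp
    finally have "?z = \<Phi> (x, g \<otimes> k)"
      by (rule inj_onD[OF equiv_embeddings_inj[OF f1]]) (use i k diffeos_in[OF \<Phi>(1) xgk] in auto)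
    then show "\<Phi> (x, g \<otimes> k) = ?z" by simp
  qed
  let ?\<psi> = "base_map \<Phi>"
  note \<psi> = base_map_diffeo[OF \<Phi>(1) e]
  have eta: "\<eta> f1 (?\<psi> x) = \<eta> f2 x" if x: "x \<in> points S" for x
  proof -
    let ?u = "unit_lift f2 x"
    have u: "?u \<in> points L" by (rule unit_lift_in[OF f2 x])
    note i = diffeos_A_in[OF \<Phi>(1) x u]
    \<comment> \<open>At the image under \<Phi> of the unit lift for \<open>f2\<close>, the
      embedding \<open>f1\<close> lies over the unit as well, so \<open>emb_eta_char\<close> yields
      the value of \<open>\<eta> f1\<close> at \<open>?\<psi> x\<close>.\<close>
    have "f1 (?\<psi> x, snd (\<Phi> (x, ?u))) = f2 (x, ?u)"
      using \<Phi>(2)[of "(x, ?u)"] base_map_eq[OF e x u] x u by (metis mem_Sigma_iff points_A prod.collapse)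
    then have "f1 (?\<psi> x, snd (\<Phi> (x, ?u))) = (fst (\<eta> f2 x), \<one>, snd (\<eta> f2 x))"
      by (simp add: emb_eta_unit_lift'[OF f2 x])
    from emb_eta_char[OF f1 diffeos_in[OF \<psi> x] i(2) this] show ?thesis by simp
  qed
  have "preserves_volume S \<mu> ?\<psi>"
  proof (rule preserves_volumeI[OF volume_assms \<psi>])
    fix U assume U: "openin (mtop S) U" "U \<noteq> {}"
    then obtain p where p: "p \<in> U" by blast
    have sub: "U \<subseteq> points S" using U(1) openin_mtop[OF S] by auto
    have "closedin (mtop S) (points S - U)"
      using closedin_diff[OF closedin_topspace U(1)] by (simp add: topspace_mtop[OF S])
    moreover have "\<eta> f2 p \<notin> \<eta> f2 ` (points S - U)"
      using inj_emb_eta[OF f2] p sub by (auto simp: inj_on_def)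
    moreover have "\<eta> f2 p \<in> points \<Q>" using emb_eta_in[OF f2] p sub by blast
    ultimately obtain h where h: "h \<in> smooth_funs \<Q>" "\<And>z. z \<in> points \<Q> \<Longrightarrow> h z \<ge> 0" "h (\<eta> f2 p) > 0"
      "\<And>x. x \<in> points S - U \<Longrightarrow> h (\<eta> f2 x) = 0"
      using emb_eta_separation[OF f2] by metis
    \<comment> \<open>Pulled back by \<open>?\<psi>\<close> this becomes
      \<open>h \<circ> \<eta> f2\<close>, which vanishes off \<open>U\<close> by the choice of
      \<open>h\<close>; equality of the momenta says that both have the same integral.\<close>
    let ?g = "\<lambda>x. ennreal (h (\<eta> f1 x))"
    note c1 = continuous_map_smooth_fun_emb_eta[OF f1 h(1)] and c2 = continuous_map_smooth_fun_emb_eta[OF f2 h(1)]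
    have eq: "(\<integral>\<^sup>+ x. ?g (?\<psi> x) \<partial>\<nu>) = (\<integral>\<^sup>+ x. ?g x \<partial>\<nu>)"
    proof -
      have "(\<integral>\<^sup>+ x. ?g (?\<psi> x) \<partial>\<nu>) = (\<integral>\<^sup>+ x. ennreal (h (\<eta> f2 x)) \<partial>\<nu>)"
        by (intro nn_integral_cong) (simp add: space_volume_measure[OF volume_assms] eta)
      then show ?thesis using emb_eta_nn_integral_eq[OF f1 f2 J h(1,2)] by simp
    qed
    have "0 < (\<integral>\<^sup>+ x. ennreal (h (\<eta> f2 x)) \<partial>\<nu>)"
      by (rule nn_integral_continuous_fun(3)[OF c2 _ _ h(3)]) (use h(2) emb_eta_in[OF f2] p sub in auto)
    then have pos: "0 < (\<integral>\<^sup>+ x. ?g x \<partial>\<nu>)" using emb_eta_nn_integral_eq[OF f1 f2 J h(1,2)] by simp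
    have fin: "(\<integral>\<^sup>+ x. ?g x \<partial>\<nu>) < \<infinity>"
      by (rule nn_integral_continuous_fun(2)[OF c1]) (use h(2) emb_eta_in[OF f1] in auto)
    have m: "?g \<in> borel_measurable (mfd_borel S)"
      using borel_measurable_continuous_map[OF S c1] by simp
    have "?g (?\<psi> x) = 0" if "x \<in> points S - U" for x using eta h(4) that by simp
    then show "\<exists>g\<in>borel_measurable (mfd_borel S).
        (\<forall>x\<in>points S - U. g (?\<psi> x) = 0) \<and> 0 < (\<integral>\<^sup>+ x. g x \<partial>\<nu>) \<and> (\<integral>\<^sup>+ x. g x \<partial>\<nu>) < \<infinity> \<and>
        (\<integral>\<^sup>+ x. g (?\<psi> x) \<partial>\<nu>) = (\<integral>\<^sup>+ x. g x \<partial>\<nu>)"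
      using pos fin eq by (intro bexI[OF _ m]) blast
  qed
  then have "\<Phi> \<in> carrier \<G>" using \<Phi>(1) e by (simp add: carrier_aut_vol)
  then show thesis by (rule that[OF _ \<Phi>(2)])
qed

text \<open>Composition with \<Phi> changes \<eta> by precomposition with the volume preserving
  \<open>base_map \<Phi>\<close>, under which every integral in the momentum is invariant.\<close>

lemma level_set_compose:
  assumes f: "f \<in> \<L> j" and \<Phi>: "\<Phi> \<in> carrier \<G>"
  shows "compose (points \<A>) f \<Phi> \<in> \<L> j"
proof -
  let ?f = "compose (points \<A>) f \<Phi>"
  have fE: "f \<in> \<E>" and fj: "\<J> f = j" using f by (auto simp: level_set_def)
  have \<Phi>': "base_map \<Phi> \<in> diffeos S" "preserves_volume S \<mu> (base_map \<Phi>)"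
    using \<Phi> base_map_diffeo by (auto simp: carrier_aut_vol)
  have "(LINT x|\<nu>. h (\<eta> ?f x)) = (LINT x|\<nu>. h (\<eta> f x))" if h: "h \<in> smooth_funs \<Q>" for h
  proof -
    have "(LINT x|\<nu>. h (\<eta> ?f x)) = (LINT x|\<nu>. h (\<eta> f (base_map \<Phi> x)))"
      by (intro Bochner_Integration.integral_cong refl)
        (simp add: space_volume_measure[OF volume_assms] equiv_embeddings_compose_aut_vol(2)[OF fE \<Phi>] del: points_A)
    also have "\<dots> = (LINT x|\<nu>. h (\<eta> f x))"
      by (rule preserves_volume_integral[OF volume_assms \<Phi>'
            borel_measurable_continuous_map[OF S continuous_map_smooth_fun_emb_eta[OF fE h]]])
    finally show ?thesis .
  qed
  then have "\<J> ?f = \<J> f"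
    unfolding momentum_L_def by (intro restrict_ext)
  then show ?thesis
    using equiv_embeddings_compose_aut_vol(1)[OF fE \<Phi>] fj by (simp add: level_set_def)
qed

text \<open>Precomposition is a right action; the inverse turns it into the left action that
  \<open>transitive_action\<close> asks for. Restriction to the level set makes the acting maps
  extensional, as elements of \<open>BijGroup\<close> must be.\<close>

theorem transitive_action_level_set:
  "transitive_action \<G> (\<L> j)
     (\<lambda>\<Phi>. \<lambda>f\<in>\<L> j. compose (points \<A>) f (inv\<^bsub>\<G>\<^esub> \<Phi>))"
proof -
  let ?E = "\<L> j"
  let ?act = "\<lambda>\<Phi>. \<lambda>f\<in>?E. compose (points \<A>) f (inv\<^bsub>\<G>\<^esub> \<Phi>)"
  interpret A: group \<G> by (rule group_aut_vol)
  have cc: "compose (points \<A>) (compose (points \<A>) f \<Phi>) \<Psi> = compose (points \<A>) f (\<Phi> \<otimes>\<^bsub>\<G>\<^esub> \<Psi>)"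
    if "\<Psi> \<in> carrier \<G>" for f :: "'s \<times> 'g \<Rightarrow> ('m \<times> ('m tvec \<Rightarrow> real)) \<times> ('g \<times> ('g tvec \<Rightarrow> real))" and \<Phi> \<Psi>
    unfolding mult_aut_vol using aut_vol_ext_in(2)[OF that] by (simp add: compose_def restrict_def fun_eq_iff del: points_A)
  have c1: "compose (points \<A>) f \<one>\<^bsub>\<G>\<^esub> = f" if "f \<in> ?E" for f
  proof -
    have "f \<in> extensional (points \<A>)"
      using that by (simp add: level_set_def equiv_embeddings_def embeddings_def smooth_maps_def PiE_def del: points_A)
    then show ?thesis unfolding one_aut_vol by (auto simp: compose_def fun_eq_iff extensional_def simp del: points_A)
  qed
  have act_in: "?act \<Phi> f \<in> ?E" if "\<Phi> \<in> carrier \<G>" "f \<in> ?E" for \<Phi> f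
    using level_set_compose[OF that(2) A.inv_closed[OF that(1)]] that(2) by simp
  have act_mult: "?act (\<Phi> \<otimes>\<^bsub>\<G>\<^esub> \<Psi>) f = ?act \<Phi> (?act \<Psi> f)" if \<Phi>: "\<Phi> \<in> carrier \<G>" and \<Psi>: "\<Psi> \<in> carrier \<G>" and f: "f \<in> ?E" for \<Phi> \<Psi> f
    using act_in[OF \<Psi> f] f cc[OF A.inv_closed[OF \<Phi>]] by (simp add: A.inv_mult_group[OF \<Phi> \<Psi>])
  have act_one: "?act \<one>\<^bsub>\<G>\<^esub> f = f" if "f \<in> ?E" for f using that c1 by simp
  have bij: "?act \<Phi> \<in> Bij ?E" if \<Phi>: "\<Phi> \<in> carrier \<G>" for \<Phi>
  proof -
    note \<Phi>' = A.inv_closed[OF \<Phi>]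
    have "bij_betw (?act \<Phi>) ?E ?E"
    proof (rule bij_betw_byWitness[where f' = "?act (inv\<^bsub>\<G>\<^esub> \<Phi>)"])
      show "\<forall>f\<in>?E. ?act (inv\<^bsub>\<G>\<^esub> \<Phi>) (?act \<Phi> f) = f"
        using act_mult[OF \<Phi>' \<Phi>, symmetric] act_one A.l_inv[OF \<Phi>] by metis
      show "\<forall>f\<in>?E. ?act \<Phi> (?act (inv\<^bsub>\<G>\<^esub> \<Phi>) f) = f"
        using act_mult[OF \<Phi> \<Phi>', symmetric] act_one A.r_inv[OF \<Phi>] by metis
    qed (use act_in[OF \<Phi>] act_in[OF \<Phi>'] in blast)+
    then show ?thesis by (simp add: Bij_def)
  qed
  have hom: "?act \<in> hom \<G> (BijGroup ?E)"
  proof (rule homI)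
    fix \<Phi> \<Psi> assume \<Phi>: "\<Phi> \<in> carrier \<G>" and \<Psi>: "\<Psi> \<in> carrier \<G>"
    have "?act (\<Phi> \<otimes>\<^bsub>\<G>\<^esub> \<Psi>) = compose ?E (?act \<Phi>) (?act \<Psi>)"
    proof
      fix f
      show "?act (\<Phi> \<otimes>\<^bsub>\<G>\<^esub> \<Psi>) f = compose ?E (?act \<Phi>) (?act \<Psi>) f"
      proof (cases "f \<in> ?E")
        case True
        then show ?thesis using act_mult[OF \<Phi> \<Psi> True] by (simp only: compose_eq)
      qed (simp add: compose_def)
    qed
    then show "?act (\<Phi> \<otimes>\<^bsub>\<G>\<^esub> \<Psi>) = ?act \<Phi> \<otimes>\<^bsub>BijGroup ?E\<^esub> ?act \<Psi>"
      using bij[OF \<Phi>] bij[OF \<Psi>] by (simp add: BijGroup_def)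
  qed (use bij in \<open>simp add: BijGroup_def\<close>)
  show ?thesis
  proof (intro transitive_action.intro group_action.intro group_hom.intro group_hom_axioms.intro transitive_action_axioms.intro)
    show "group \<G>" by (rule group_aut_vol)
    show "group (BijGroup ?E)" by (rule group_BijGroup)
    show "?act \<in> hom \<G> (BijGroup ?E)" by (rule hom)
    fix f1 f2 assume f1: "f1 \<in> ?E" and f2: "f2 \<in> ?E"
    then obtain \<Phi> where \<Phi>: "\<Phi> \<in> carrier \<G>" "\<And>z. z \<in> points \<A> \<Longrightarrow> f1 (\<Phi> z) = f2 z"
      by (elim level_set_transitive[of f1 f2, rotated 3]) (auto simp: level_set_def)
    have "f2 \<in> extensional (points \<A>)"
      using f2 by (simp add: level_set_def equiv_embeddings_def embeddings_def smooth_maps_def PiE_def del: points_A)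
    then have "compose (points \<A>) f1 \<Phi> = f2"
      using \<Phi>(2) by (auto simp: compose_def fun_eq_iff extensional_def simp del: points_A)
    \<comment> \<open>As the action involves the inverse, the element that moves \<open>f1\<close>
      to \<open>f2\<close> is the inverse of the \<Phi> found with
      \<open>f1 \<circ> \<Phi> = f2\<close>.\<close>
    then have "?act (inv\<^bsub>\<G>\<^esub> \<Phi>) f1 = f2" using f1 A.inv_inv[OF \<Phi>(1)] by simp
    then show "\<exists>\<Phi>\<in>carrier \<G>. ?act \<Phi> f1 = f2" using A.inv_closed[OF \<Phi>(1)] by blast
  qed
qed

end

theorem proposition5p4:
  fixes S :: "('s, real ^ 'n::{finite,wellorder}) mfd"
    and \<mu> :: "('s, real ^ 'n::{finite,wellorder}) volume"
    and M :: "('m, 'e::euclidean_space) mfd"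
    and L :: "('g, 'f::euclidean_space) mfd"
    and G :: "'g monoid"
    and j :: "(('m \<times> ('m tvec \<Rightarrow> real)) \<times> ('g tvec \<Rightarrow> real) \<Rightarrow> real) \<Rightarrow> real"
  assumes "manifold S" and "compact_space (mtop S)" and "volume_form S \<mu>"
    and "manifold M"
    and "lie_group L G" and "compact_space (mtop L)"
  shows "transitive_action (aut_vol S \<mu> L G) (level_set S \<mu> M L G j)
           (\<lambda>\<Phi>. \<lambda>f\<in>level_set S \<mu> M L G j.
              compose (points (S \<times>\<^sub>m L)) f (inv\<^bsub>aut_vol S \<mu> L G\<^esub> \<Phi>))"
proof -
  interpret equivariant_embedding_setting S \<mu> M L G
    using assms by unfold_locales
  show ?thesis by (rule transitive_action_level_set)
qed

end
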